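(* Assume that there exist $\alpha > 0$ and a constant $C>0$ such that the angular power spectrum $(A_\ell)_{\ell \in \mathbb{N}_0}$ satisfies $A_\ell \le C\, \ell^{-\alpha}$ for all $\ell > 0$, and that $X_0 \in L^2(\Omega;H^{\eta}(\mathbb{S}^2))$ for some $\eta > 0$. Let $C_c>0$ be a fixed constant (with $C_c\le 1$ in the case of the forward scheme). Then, both for the forward and for the backward Euler--Maruyama scheme, there exists a constant $\hat{C}>0$, independent of $\kappa$, $h$ and $k$, such that for all $\kappa \in \mathbb{N}$ and all step sizes $h > 0$ with $\kappa(\kappa+1)h \le C_c$, the following hold on all time grid points $t_k$. (i) The error of the expectation is bounded by $$\| \mathbb{E}[ X^{(\kappa)}(t_k) - X^{(\kappa,h)}(t_k)]\|_{L^2(\mathbb{S}^2)} \le \hat{C}\, h^{\min\{1,\eta/2\}} \| \mathbb{E}[X_0] \|_{H^{\eta}(\mathbb{S}^2)}.$$ (ii) The second moment satisfies $$\Bigl| \mathbb{E}\bigl[ \| X^{(\kappa)}(t_k) \|^2_{L^2(\mathbb{S}^2)} - \| X^{(\kappa,h)}(t_k) \|^2_{L^2(\mathbb{S}^2)} \bigr] \Bigr| \le \hat{C} \Bigl( h^{\min\{1,\eta\}} \|X_0\|_{L^2(\Omega;H^{\eta}(\mathbb{S}^2))}^2 + h^{\min\{1,\alpha/2\}} \Bigr).$$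
   Context: $\mathbb{S}^2$ is the unit sphere in $\mathbb{R}^3$ with its surface measure. $(Y_{\ell,m},\ \ell\in\mathbb{N}_0,\ m=-\ell,\ldots,\ell)$ denotes the standard complex spherical harmonics, an orthonormal basis of $L^2(\mathbb{S}^2;\mathbb{C})$ with $Y_{\ell,m} = (-1)^m\overline{Y_{\ell,-m}}$ and $\Delta_{\mathbb{S}^2}Y_{\ell,m} = -\ell(\ell+1)Y_{\ell,m}$, where $\Delta_{\mathbb{S}^2}$ is the Laplace--Beltrami operator. $L^2(\mathbb{S}^2)$ is the space of real-valued square-integrable functions. For $s\in\mathbb{R}$, $H^s(\mathbb{S}^2) = (\mathrm{Id}-\Delta_{\mathbb{S}^2})^{-s/2}L^2(\mathbb{S}^2)$ with norm $\|f\|_{H^s(\mathbb{S}^2)} = \|(\mathrm{Id}-\Delta_{\mathbb{S}^2})^{s/2}f\|_{L^2(\mathbb{S}^2)}$, and $\|Z\|_{L^2(\Omega;H^s(\mathbb{S}^2))} = \mathbb{E}[\|Z\|_{H^s(\mathbb{S}^2)}^2]^{1/2}$. The expectation of an $L^2(\mathbb{S}^2)$-valued random variable is the Bochner integral. Let $(\Omega,\mathcal{A},(\mathcal{F}_t)_t,\mathbb{P})$ be a complete filtered probability space and $T<\infty$. Let $(A_\ell)_{\ell\in\mathbb{N}_0}$ be a sequence of nonnegative real numbers (the angular power spectrum), and let $\beta^1_{\ell,m}$ ($\ell\in\mathbb{N}_0$, $0\le m\le \ell$) and $\beta^2_{\ell,m}$ ($\ell\in\mathbb{N}$, $1\le m\le\ell$)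 be independent real-valued $(\mathcal{F}_t)$-Brownian motions. Set $a_{\ell,0}=\sqrt{A_\ell}\,\beta^1_{\ell,0}$, $a_{\ell,m}=\sqrt{A_\ell/2}\,(\beta^1_{\ell,m}+i\beta^2_{\ell,m})$ for $m=1,\ldots,\ell$, and $a_{\ell,-m}=(-1)^m\overline{a_{\ell,m}}$. The isotropic $Q$-Wiener process is $W(t)=\sum_{\ell=0}^\infty\sum_{m=-\ell}^\ell a_{\ell,m}(t)Y_{\ell,m}$. Consider the stochastic heat equation $\mathrm{d}X(t)=\Delta_{\mathbb{S}^2}X(t)\,\mathrm{d}t+\mathrm{d}W(t)$ on $[0,T]$ with $\mathcal{F}_0$-measurable initial condition $X(0)=X_0\in L^2(\Omega;L^2(\mathbb{S}^2))$, and set $X^0_{\ell,m}=\langle X_0,Y_{\ell,m}\rangle_{L^2(\mathbb{S}^2;\mathbb{C})}$. The spectral approximation is $$X^{(\kappa)}(t)=\sum_{\ell=0}^{\kappa}\sum_{m=-\ell}^{\ell}\Bigl(e^{-\ell(\ell+1)t}X^0_{\ell,m}+\int_0^t e^{-\ell(\ell+1)(t-s)}\,\mathrm{d}a_{\ell,m}(s)\Bigr)Y_{\ell,m}.$$ Euler--Maruyama schemes: let $0=t_0<t_1<\cdots<t_n=T$ be an equidistant grid with step size $h=T/n$, $n\in\mathbb{N}$. For each $\ell$ set $\xi=1-\ell(\ell+1)h$ and $\delta=0$ (forward scheme), or $\xi=(1+\ell(\ell+1)h)^{-1}$ and $\delta=1$ (backward scheme). For $m=0,\ldots,\ell$ let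 $X^{(h)}_{\ell,m}(t_0)=X^0_{\ell,m}$ and $$X^{(h)}_{\ell,m}(t_k)=\xi X^{(h)}_{\ell,m}(t_{k-1})+\xi^{\delta}\bigl(a_{\ell,m}(t_k)-a_{\ell,m}(t_{k-1})\bigr),\quad k=1,\ldots,n,$$ and $$X^{(\kappa,h)}(t_k)=\sum_{\ell=0}^{\kappa}\Bigl(X^{(h)}_{\ell,0}(t_k)Y_{\ell,0}+2\sum_{m=1}^{\ell}\bigl(\mathrm{Re}(X^{(h)}_{\ell,m}(t_k))\,\mathrm{Re}(Y_{\ell,m})-\mathrm{Im}(X^{(h)}_{\ell,m}(t_k))\,\mathrm{Im}(Y_{\ell,m})\bigr)\Bigr).$$
   Formalization: The second-moment bound (ii) is stated only for α ≠ 2, because it is false at α = 2: for A_ℓ = ℓ^{-2}, X_0 = 0 and the backward scheme, the error grows like h log κ, which exceeds Ĉ h; part (i) holds for all α > 0. *)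

theory Defs
  imports "HOL-Probability.Probability" "HOL-Computational_Algebra.Polynomial"
begin

section \<open>The surface measure on the unit sphere\<close>

definition spherical_coords :: "real \<times> real \<Rightarrow> real ^ 3" where
  "spherical_coords = (\<lambda>(\<theta>, \<phi>). vector [sin \<theta> * cos \<phi>, sin \<theta> * sin \<phi>, cos \<theta>])"

text \<open>
  The measure \<open>sin \<theta> d\<theta> d\<phi>\<close>, regarded as a Borel measure on \<open>\<real>\<^sup>3\<close> that is concentrated on the
  unit sphere. Values of a function off the sphere are therefore irrelevant almost everywhere.
\<close>

definition sphere_measure :: "(real ^ 3) measure" where
  "sphere_measure =
     distr (density (restrict_space lborel ({0..pi} \<times> {0..2 * pi})) (\<lambda>(\<theta>, \<phi>). ennreal (sin \<theta>)))
       borel spherical_coords"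

lemma space_sphere_measure [simp]: "space sphere_measure = UNIV"
  by (simp add: sphere_measure_def)

lemma sets_sphere_measure [simp, measurable_cong]: "sets sphere_measure = sets borel"
  by (simp add: sphere_measure_def)

lemma spherical_coords_measurable [measurable]: "spherical_coords \<in> borel_measurable borel"
proof (rule borel_measurable_continuous_onI)
  have eq: "spherical_coords = (\<lambda>p. \<chi> i. if i = 1 then sin (fst p) * cos (snd p)
      else if i = 2 then sin (fst p) * sin (snd p) else cos (fst p))"
    by (auto simp: spherical_coords_def fun_eq_iff vec_eq_iff forall_3 split_beta)
  have "continuous_on UNIV (\<lambda>p::real\<times>real. if i = 1 then sin (fst p) * cos (snd p)
      else if i = 2 then sin (fst p) * sin (snd p) else cos (fst p))" for i :: 3
    by (cases "i = 1"; cases "i = 2") (auto intro!: continuous_intros)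
  then show "continuous_on UNIV spherical_coords"
    unfolding eq by (rule continuous_on_vec_lambda)
qed

lemma finite_sphere_measure: "emeasure sphere_measure UNIV < \<infinity>"
proof -
  let ?R = "{0..pi} \<times> {0..2 * pi} :: (real \<times> real) set"
  have R: "?R = cbox (0, 0) (pi, 2 * pi)" by (auto simp: cbox_Pair_eq)
  have [measurable]: "?R \<in> sets borel" unfolding R by simp
  have m: "spherical_coords \<in> borel_measurable
      (density (restrict_space lborel ?R) (\<lambda>(\<theta>, \<phi>). ennreal (sin \<theta>)))"
    by (simp add: measurable_restrict_space1)
  have "emeasure sphere_measure UNIV =
      emeasure (density (restrict_space lborel ?R) (\<lambda>(\<theta>, \<phi>). ennreal (sin \<theta>))) ?R"
    unfolding sphere_measure_def by (subst emeasure_distr[OF m]) (auto simp: space_restrict_space)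
  also have "\<dots> = (\<integral>\<^sup>+ p. (case p of (\<theta>, \<phi>) \<Rightarrow> ennreal (sin \<theta>)) * indicator ?R p \<partial>restrict_space lborel ?R)"
  proof (rule emeasure_density)
    have "(\<lambda>(\<theta>, \<phi>). ennreal (sin \<theta>)) \<in> borel_measurable (lborel :: (real \<times> real) measure)"
      by (simp add: split_beta') (intro measurable_compose[OF _ measurable_ennreal]
          borel_measurable_continuous_onI continuous_intros)
    then show "(\<lambda>(\<theta>, \<phi>). ennreal (sin \<theta>)) \<in> borel_measurable (restrict_space lborel ?R)"
      by (rule measurable_restrict_space1)
  qed (auto simp: sets_restrict_space)
  also have "\<dots> \<le> (\<integral>\<^sup>+ p. 1 \<partial>restrict_space lborel ?R)"
    by (rule nn_integral_mono) (auto simp: indicator_def intro: order_trans[OF ennreal_leI[OF sin_le_one]])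
  also have "\<dots> = emeasure lborel ?R"
    by (simp add: emeasure_restrict_space space_restrict_space)
  also have "\<dots> < \<infinity>"
    unfolding R by (simp add: emeasure_lborel_cbox_eq)
  finally show ?thesis .
qed

interpretation sphere_measure: finite_measure sphere_measure
  by standard (use finite_sphere_measure in auto)


section \<open>The Hilbert space of square-integrable functions on the sphere\<close>

definition sq_integrable :: "(real ^ 3 \<Rightarrow> 'b::euclidean_space) \<Rightarrow> bool" where
  "sq_integrable f \<longleftrightarrow> f \<in> borel_measurable sphere_measure \<and>
     integrable sphere_measure (\<lambda>x. (norm (f x))\<^sup>2)"

lemma sq_integrable_inner:
  assumes "sq_integrable f" "sq_integrable g"
  shows "integrable sphere_measure (\<lambda>x. f x \<bullet> g x)"
proof (rule Bochner_Integration.integrable_bound)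
  show "integrable sphere_measure (\<lambda>x. (norm (f x))\<^sup>2 + (norm (g x))\<^sup>2)"
    using assms by (auto simp: sq_integrable_def)
  have [measurable]: "f \<in> borel_measurable borel" "g \<in> borel_measurable borel"
    using assms by (auto simp: sq_integrable_def)
  show "(\<lambda>x. f x \<bullet> g x) \<in> borel_measurable sphere_measure" by measurable
  have "\<bar>f x \<bullet> g x\<bar> \<le> (norm (f x))\<^sup>2 + (norm (g x))\<^sup>2" for x
  proof -
    have "\<bar>f x \<bullet> g x\<bar> \<le> norm (f x) * norm (g x)" by (rule Cauchy_Schwarz_ineq2)
    also have "\<dots> \<le> (norm (f x))\<^sup>2 + (norm (g x))\<^sup>2"
      using sum_squares_bound[of "norm (f x)" "norm (g x)"]
        mult_nonneg_nonneg[OF norm_ge_zero[of "f x"] norm_ge_zero[of "g x"]] by linarith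
    finally show ?thesis .
  qed
  then show "AE x in sphere_measure. norm (f x \<bullet> g x) \<le> norm ((norm (f x))\<^sup>2 + (norm (g x))\<^sup>2)"
    by (auto intro!: always_eventually)
qed

lemma sq_integrable_add:
  assumes "sq_integrable f" "sq_integrable g"
  shows "sq_integrable (\<lambda>x. f x + g x)"
proof -
  have "integrable sphere_measure (\<lambda>x. (norm (f x))\<^sup>2 + 2 * (f x \<bullet> g x) + (norm (g x))\<^sup>2)"
    using assms sq_integrable_inner[OF assms] by (auto simp: sq_integrable_def)
  moreover have "(norm (f x))\<^sup>2 + 2 * (f x \<bullet> g x) + (norm (g x))\<^sup>2 = (norm (f x + g x))\<^sup>2" for x
    by (simp add: power2_norm_eq_inner inner_add_left inner_add_right inner_commute)
  ultimately show ?thesis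
    using assms by (auto simp: sq_integrable_def)
qed

lemma sq_integrable_scaleR: "sq_integrable f \<Longrightarrow> sq_integrable (\<lambda>x. r *\<^sub>R f x)"
  by (auto simp: sq_integrable_def power_mult_distrib)

lemma sq_integrable_uminus: "sq_integrable f \<Longrightarrow> sq_integrable (\<lambda>x. - f x)"
  by (auto simp: sq_integrable_def)

lemma sq_integrable_diff: "sq_integrable f \<Longrightarrow> sq_integrable g \<Longrightarrow> sq_integrable (\<lambda>x. f x - g x)"
  using sq_integrable_add[of f "\<lambda>x. - g x"] by (simp add: sq_integrable_uminus)

lemma sq_integrable_zero: "sq_integrable (\<lambda>x. 0)"
  by (simp add: sq_integrable_def)

quotient_type (overloaded) 'b L2_sphere = "real ^ 3 \<Rightarrow> 'b::euclidean_space" / partial: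
  "\<lambda>f g. sq_integrable f \<and> sq_integrable g \<and> (AE x in sphere_measure. f x = g x)"
proof (rule part_equivpI)
  show "\<exists>f::real ^ 3 \<Rightarrow> 'b. sq_integrable f \<and> sq_integrable f \<and> (AE x in sphere_measure. f x = f x)"
    using sq_integrable_zero by auto
  show "symp (\<lambda>f g. sq_integrable f \<and> sq_integrable g \<and> (AE x in sphere_measure. f x = (g x::'b)))"
    by (auto intro!: sympI elim: AE_mp)
  show "transp (\<lambda>f g. sq_integrable f \<and> sq_integrable g \<and> (AE x in sphere_measure. f x = (g x::'b)))"
  proof (rule transpI, intro conjI; (elim conjE, assumption)?)
    fix f g h :: "real ^ 3 \<Rightarrow> 'b"
    assume "sq_integrable f \<and> sq_integrable g \<and> (AE x in sphere_measure. f x = g x)"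
      "sq_integrable g \<and> sq_integrable h \<and> (AE x in sphere_measure. g x = h x)"
    then have "AE x in sphere_measure. f x = g x" "AE x in sphere_measure. g x = h x" by auto
    then show "AE x in sphere_measure. f x = h x" by eventually_elim simp
  qed
qed

instantiation L2_sphere :: (euclidean_space) real_inner
begin

lift_definition zero_L2_sphere :: "'a L2_sphere" is "\<lambda>x. 0"
  by (simp add: sq_integrable_zero)

lift_definition plus_L2_sphere :: "'a L2_sphere \<Rightarrow> 'a L2_sphere \<Rightarrow> 'a L2_sphere"
  is "\<lambda>f g x. f x + g x"
proof (intro conjI; (elim conjE)?)
  fix f f' g g' :: "real ^ 3 \<Rightarrow> 'a"
  assume "AE x in sphere_measure. f x = f' x" "AE x in sphere_measure. g x = g' x"
  then show "AE x in sphere_measure. f x + g x = f' x + g' x" by eventually_elim simp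
qed (auto intro: sq_integrable_add)

lift_definition uminus_L2_sphere :: "'a L2_sphere \<Rightarrow> 'a L2_sphere" is "\<lambda>f x. - f x"
  by (auto intro: sq_integrable_uminus)

lift_definition minus_L2_sphere :: "'a L2_sphere \<Rightarrow> 'a L2_sphere \<Rightarrow> 'a L2_sphere"
  is "\<lambda>f g x. f x - g x"
proof (intro conjI; (elim conjE)?)
  fix f f' g g' :: "real ^ 3 \<Rightarrow> 'a"
  assume "AE x in sphere_measure. f x = f' x" "AE x in sphere_measure. g x = g' x"
  then show "AE x in sphere_measure. f x - g x = f' x - g' x" by eventually_elim simp
qed (auto intro: sq_integrable_diff)

lift_definition scaleR_L2_sphere :: "real \<Rightarrow> 'a L2_sphere \<Rightarrow> 'a L2_sphere" is "\<lambda>r f x. r *\<^sub>R f x"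
  by (auto intro: sq_integrable_scaleR)

lift_definition inner_L2_sphere :: "'a L2_sphere \<Rightarrow> 'a L2_sphere \<Rightarrow> real"
  is "\<lambda>f g. (\<integral>x. f x \<bullet> g x \<partial>sphere_measure)"
proof (elim conjE)
  fix f f' g g' :: "real ^ 3 \<Rightarrow> 'a"
  assume sq: "sq_integrable f" "sq_integrable f'" "sq_integrable g" "sq_integrable g'"
    and ae: "AE x in sphere_measure. f x = f' x" "AE x in sphere_measure. g x = g' x"
  have "AE x in sphere_measure. f x \<bullet> g x = f' x \<bullet> g' x"
    using ae by eventually_elim simp
  then show "(\<integral>x. f x \<bullet> g x \<partial>sphere_measure) = (\<integral>x. f' x \<bullet> g' x \<partial>sphere_measure)"
    by (intro integral_cong_AE borel_measurable_integrable sq_integrable_inner sq)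
qed

definition norm_L2_sphere :: "'a L2_sphere \<Rightarrow> real" where "norm_L2_sphere f = sqrt (f \<bullet> f)"

definition dist_L2_sphere :: "'a L2_sphere \<Rightarrow> 'a L2_sphere \<Rightarrow> real"
  where "dist_L2_sphere f g = norm (f - g)"

definition sgn_L2_sphere :: "'a L2_sphere \<Rightarrow> 'a L2_sphere" where "sgn_L2_sphere f = scaleR (inverse (norm f)) f"

definition uniformity_L2_sphere :: "('a L2_sphere \<times> 'a L2_sphere) filter"
  where "uniformity_L2_sphere = (INF e\<in>{0<..}. principal {(x, y). dist x y < e})"

definition open_L2_sphere :: "'a L2_sphere set \<Rightarrow> bool"
  where "open_L2_sphere U \<longleftrightarrow> (\<forall>x\<in>U. \<forall>\<^sub>F (x', y) in uniformity. x' = x \<longrightarrow> y \<in> U)"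

instance
proof
  fix f g h :: "'a L2_sphere" and r s :: real
  show "f + g + h = f + (g + h)" by transfer (auto intro!: sq_integrable_add simp: add.assoc)
  show "f + g = g + f" by transfer (auto intro!: sq_integrable_add simp: add.commute)
  show "0 + f = f" by transfer auto
  show "- f + f = 0" by transfer (auto intro: sq_integrable_zero)
  show "f - g = f + - g" by transfer (auto intro: sq_integrable_diff)
  show "r *\<^sub>R (f + g) = r *\<^sub>R f + r *\<^sub>R g"
    by transfer (auto intro!: sq_integrable_add sq_integrable_scaleR simp: scaleR_add_right
        simp flip: scaleR_add_right)
  show "(r + s) *\<^sub>R f = r *\<^sub>R f + s *\<^sub>R f"
    by transfer (auto intro!: sq_integrable_add sq_integrable_scaleR simp: scaleR_add_left
        simp flip: scaleR_add_left)
  show "r *\<^sub>R s *\<^sub>R f = (r * s) *\<^sub>R f"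
    by transfer (auto intro!: sq_integrable_scaleR)
  show "1 *\<^sub>R f = f" by transfer auto
  show "f \<bullet> g = g \<bullet> f" by transfer (simp add: inner_commute)
  show "(f + g) \<bullet> h = f \<bullet> h + g \<bullet> h"
    by transfer (auto simp: inner_add_left sq_integrable_inner)
  show "(r *\<^sub>R f) \<bullet> g = r * (f \<bullet> g)" by transfer simp
  show "0 \<le> f \<bullet> f" by transfer (simp add: integral_nonneg)
  show "f \<bullet> f = 0 \<longleftrightarrow> f = 0"
  proof transfer
    fix f :: "real ^ 3 \<Rightarrow> 'a"
    assume "sq_integrable f \<and> sq_integrable f \<and> (AE x in sphere_measure. f x = f x)"
    then have sq: "sq_integrable f" by simp
    have "(\<integral>x. f x \<bullet> f x \<partial>sphere_measure) = 0 \<longleftrightarrow> (AE x in sphere_measure. f x \<bullet> f x = 0)"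
      by (rule integral_nonneg_eq_0_iff_AE[OF sq_integrable_inner[OF sq sq]]) simp
    then show "(\<integral>x. f x \<bullet> f x \<partial>sphere_measure) = 0 \<longleftrightarrow>
        (sq_integrable f \<and> sq_integrable (\<lambda>x. 0::'a) \<and> (AE x in sphere_measure. f x = 0))"
      using sq by (simp add: sq_integrable_zero)
  qed
  show "norm f = sqrt (f \<bullet> f)" by (rule norm_L2_sphere_def)
  show "dist f g = norm (f - g)" by (rule dist_L2_sphere_def)
  show "sgn f = inverse (norm f) *\<^sub>R f" by (rule sgn_L2_sphere_def)
  show "uniformity = (INF e\<in>{0<..}. principal {(x::'a L2_sphere, y). dist x y < e})"
    by (rule uniformity_L2_sphere_def)
  show "open U \<longleftrightarrow> (\<forall>x\<in>U. \<forall>\<^sub>F (x', y) in uniformity. x' = x \<longrightarrow> y \<in> U)" for U :: "'a L2_sphere set"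
    by (rule open_L2_sphere_def)
qed

end

lemma borel_measurable_sphere_measure [simp]: "borel_measurable sphere_measure = borel_measurable borel"
  by (rule measurable_cong_sets) auto

text \<open>The class of a square-integrable function (and, as a default, 0 for all other functions).\<close>

lift_definition to_L2 :: "(real ^ 3 \<Rightarrow> 'b::euclidean_space) \<Rightarrow> 'b L2_sphere"
  is "\<lambda>f. if sq_integrable f then f else (\<lambda>x. 0)"
  by (auto simp: sq_integrable_zero)

lemma to_L2_cases:
  fixes F :: "'b::euclidean_space L2_sphere"
  obtains f where "sq_integrable f" "to_L2 f = F"
proof -
  have "\<exists>f. sq_integrable f \<and> to_L2 f = F"
  proof transfer
    fix F :: "real ^ 3 \<Rightarrow> 'b"
    assume "sq_integrable F \<and> sq_integrable F \<and> (AE x in sphere_measure. F x = F x)"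
    then show "\<exists>f. sq_integrable f \<and> sq_integrable (if sq_integrable f then f else (\<lambda>x. 0)) \<and> sq_integrable F \<and>
        (AE x in sphere_measure. (if sq_integrable f then f else (\<lambda>x. 0)) x = F x)"
      by (intro exI[of _ F]) simp
  qed
  then show ?thesis using that by blast
qed

lemma to_L2_add: "sq_integrable f \<Longrightarrow> sq_integrable g \<Longrightarrow> to_L2 (\<lambda>x. f x + g x) = to_L2 f + to_L2 g"
  by transfer (simp add: sq_integrable_add)

lemma to_L2_diff: "sq_integrable f \<Longrightarrow> sq_integrable g \<Longrightarrow> to_L2 (\<lambda>x. f x - g x) = to_L2 f - to_L2 g"
  by transfer (simp add: sq_integrable_diff)

lemma to_L2_scaleR: "sq_integrable f \<Longrightarrow> to_L2 (\<lambda>x. r *\<^sub>R f x) = r *\<^sub>R to_L2 f"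
  by transfer (simp add: sq_integrable_scaleR)

lemma inner_to_L2:
  "sq_integrable f \<Longrightarrow> sq_integrable g \<Longrightarrow> to_L2 f \<bullet> to_L2 g = (\<integral>x. f x \<bullet> g x \<partial>sphere_measure)"
  by transfer simp

lemma norm_to_L2:
  assumes "sq_integrable f"
  shows "(norm (to_L2 f))\<^sup>2 = (\<integral>x. (norm (f x))\<^sup>2 \<partial>sphere_measure)"
  by (simp add: power2_norm_eq_inner inner_to_L2 assms)

lemma norm_to_L2_nn:
  assumes "sq_integrable f"
  shows "(\<integral>\<^sup>+x. ennreal ((norm (f x))\<^sup>2) \<partial>sphere_measure) = ennreal ((norm (to_L2 f))\<^sup>2)"
  using assms unfolding norm_to_L2[OF assms]
  by (intro nn_integral_eq_integral) (auto simp: sq_integrable_def)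

lemma sq_integrable_nnI:
  assumes "f \<in> borel_measurable borel" "(\<integral>\<^sup>+x. ennreal ((norm (f x))\<^sup>2) \<partial>sphere_measure) < \<infinity>"
  shows "sq_integrable f"
  unfolding sq_integrable_def
  using assms by (auto intro!: integrableI_bounded)

instance L2_sphere :: (euclidean_space) banach
proof
  fix X :: "nat \<Rightarrow> 'a L2_sphere"
  assume X: "Cauchy X"
  have "\<exists>N. \<forall>m\<ge>N. \<forall>n\<ge>N. norm (X m - X n) < e" if "e > 0" for e
    using X that by (auto simp: Cauchy_def dist_norm)
  then have "\<exists>N. \<forall>m\<ge>N. \<forall>n\<ge>N. norm (X m - X n) < (1/2)^k" for k :: nat
    by simp
  then obtain N where "\<And>k. \<forall>m\<ge>N k. \<forall>n\<ge>N k. norm (X m - X n) < (1/2)^k"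
    by metis
  then have N: "\<And>k m n. m \<ge> N k \<Longrightarrow> n \<ge> N k \<Longrightarrow> norm (X m - X n) < (1/2)^k"
    by blast
  define r where "r k = (\<Sum>i\<le>k. N i) + k" for k
  have r: "strict_mono r" unfolding strict_mono_Suc_iff by (simp add: r_def)
  have rN: "N k \<le> r k" for k
    unfolding r_def by (rule order_trans[OF member_le_sum[of k "{..k}" N]]) auto
  have rN': "N k \<le> r j" if "k \<le> j" for j k
    using rN[of k] strict_mono_leD[OF r that] by (rule order_trans)
  have "\<forall>k. \<exists>f. sq_integrable f \<and> to_L2 f = X (r k)" by (metis to_L2_cases)
  then obtain f where f: "\<And>k. sq_integrable (f k)" "\<And>k. to_L2 (f k) = X (r k)" by metis
  have [measurable]: "f k \<in> borel_measurable borel" for k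
    using f(1)[of k] by (simp add: sq_integrable_def)
  have dist_f: "(\<integral>\<^sup>+x. ennreal ((norm (f j x - f k x))\<^sup>2) \<partial>sphere_measure) \<le> ennreal (((1/2)^l)\<^sup>2)"
    if "l \<le> j" "l \<le> k" for j k l
  proof -
    have "norm (X (r j) - X (r k)) < (1/2)^l" using that by (intro N rN')
    then have "norm (to_L2 (\<lambda>x. f j x - f k x)) \<le> (1/2)^l"
      by (simp add: to_L2_diff f)
    then show ?thesis
      by (subst norm_to_L2_nn) (auto intro!: sq_integrable_diff f ennreal_leI power_mono)
  qed
  let ?g = "\<lambda>k x. norm (f (Suc k) x - f k x)"
  let ?c = "measure sphere_measure UNIV"
  have L1: "(\<integral>\<^sup>+x. ennreal (?g k x) \<partial>sphere_measure) \<le> ennreal ((1 + ?c) * (1/2)^k)" for k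
  proof -
    have "?g k x \<le> 2^k * (?g k x)\<^sup>2 + (1/2)^k" for x
    proof -
      have "0 \<le> (2^k * ?g k x - 1)\<^sup>2" by simp
      then have "2 * (2^k * ?g k x) \<le> 2^k * (2^k * (?g k x)\<^sup>2) + 1"
        by (simp add: power2_eq_square algebra_simps)
      then have "2^k * (2 * ?g k x) \<le> 2^k * (2^k * (?g k x)\<^sup>2 + (1/2)^k)"
        by (simp add: algebra_simps power_one_over)
      then have "2 * ?g k x \<le> 2^k * (?g k x)\<^sup>2 + (1/2)^k"
        by simp
      then show ?thesis using norm_ge_zero[of "f (Suc k) x - f k x"] by linarith
    qed
    then have "(\<integral>\<^sup>+x. ennreal (?g k x) \<partial>sphere_measure)
        \<le> (\<integral>\<^sup>+x. ennreal (2^k) * ennreal ((?g k x)\<^sup>2) + ennreal ((1/2)^k) \<partial>sphere_measure)"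
      by (intro nn_integral_mono) (simp add: ennreal_leI flip: ennreal_plus ennreal_mult)
    also have "\<dots> = ennreal (2^k) * (\<integral>\<^sup>+x. ennreal ((?g k x)\<^sup>2) \<partial>sphere_measure)
        + ennreal ((1/2)^k) * emeasure sphere_measure UNIV"
      by (subst nn_integral_add) (auto simp: nn_integral_cmult)
    also have "\<dots> \<le> ennreal (2^k) * ennreal (((1/2)^k)\<^sup>2) + ennreal ((1/2)^k) * ennreal ?c"
      by (intro add_mono mult_left_mono dist_f) (auto simp: sphere_measure.emeasure_eq_measure)
    also have "\<dots> = ennreal (2^k * ((1/2)^k)\<^sup>2 + (1/2)^k * ?c)"
      by (simp flip: ennreal_plus ennreal_mult)
    also have "2^k * ((1/2::real)^k)\<^sup>2 = (1/2)^k"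
      by (simp add: power2_eq_square power_one_over)
    finally show ?thesis by (simp add: algebra_simps)
  qed
  have "(\<integral>\<^sup>+x. (\<Sum>k. ennreal (?g k x)) \<partial>sphere_measure) = (\<Sum>k. \<integral>\<^sup>+x. ennreal (?g k x) \<partial>sphere_measure)"
    by (rule nn_integral_suminf) simp
  also have "\<dots> \<le> (\<Sum>k. ennreal ((1 + ?c) * (1/2)^k))"
    by (intro suminf_le L1) auto
  also have "\<dots> < \<infinity>"
    by (subst suminf_ennreal2) (auto intro!: summable_mult)
  finally have "AE x in sphere_measure. (\<Sum>k. ennreal (?g k x)) \<noteq> \<infinity>"
    by (intro nn_integral_PInf_AE) auto
  then have conv: "AE x in sphere_measure. convergent (\<lambda>k. f k x)"
  proof eventually_elim
    case (elim x)
    then have "summable (\<lambda>k. ?g k x)" by (intro summable_suminf_not_top) auto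
    then have "summable (\<lambda>k. f (Suc k) x - f k x)" by (rule summable_norm_cancel)
    then have "convergent (\<lambda>n. f n x - f 0 x)"
      unfolding summable_iff_convergent by (subst (asm) sum_lessThan_telescope)
    then have "convergent (\<lambda>n. (f n x - f 0 x) + f 0 x)"
      by (intro convergent_add convergent_const)
    then show ?case by simp
  qed
  define h where "h x = lim (\<lambda>k. f k x)" for x
  have hm [measurable]: "h \<in> borel_measurable borel"
    unfolding h_def by (rule borel_measurable_lim_metric) simp
  have dist_h: "(\<integral>\<^sup>+x. ennreal ((norm (h x - f k x))\<^sup>2) \<partial>sphere_measure) \<le> ennreal (((1/2)^k)\<^sup>2)" for k
  proof -
    have "AE x in sphere_measure. ennreal ((norm (h x - f k x))\<^sup>2) =
        liminf (\<lambda>j. ennreal ((norm (f j x - f k x))\<^sup>2))"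
      using conv
    proof eventually_elim
      case (elim x)
      then have "(\<lambda>j. f j x) \<longlonglongrightarrow> h x" by (simp add: h_def convergent_LIMSEQ_iff)
      then have "(\<lambda>j. ennreal ((norm (f j x - f k x))\<^sup>2)) \<longlonglongrightarrow> ennreal ((norm (h x - f k x))\<^sup>2)"
        by (intro tendsto_intros) auto
      then show ?case by (rule lim_imp_Liminf[OF trivial_limit_sequentially, symmetric])
    qed
    then have "(\<integral>\<^sup>+x. ennreal ((norm (h x - f k x))\<^sup>2) \<partial>sphere_measure) =
        (\<integral>\<^sup>+x. liminf (\<lambda>j. ennreal ((norm (f j x - f k x))\<^sup>2)) \<partial>sphere_measure)"
      by (rule nn_integral_cong_AE)
    also have "\<dots> \<le> liminf (\<lambda>j. \<integral>\<^sup>+x. ennreal ((norm (f j x - f k x))\<^sup>2) \<partial>sphere_measure)"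
      by (rule nn_integral_liminf) simp
    also have "\<dots> \<le> liminf (\<lambda>j. ennreal (((1/2)^k)\<^sup>2))"
      by (rule Liminf_mono) (auto intro!: eventually_sequentiallyI[of k] dist_f)
    finally show ?thesis by (simp add: Liminf_const)
  qed
  have hd: "sq_integrable (\<lambda>x. h x - f k x)" for k
    by (rule sq_integrable_nnI) (auto intro: le_less_trans[OF dist_h])
  have hs: "sq_integrable h"
    using sq_integrable_add[OF hd[of 0] f(1)[of 0]] by simp
  have lim: "(\<lambda>k. X (r k)) \<longlonglongrightarrow> to_L2 h"
  proof (rule Lim_transform_bound[OF _ LIMSEQ_power_zero[of "1/2::real"], THEN LIM_zero_cancel])
    have "norm (X (r k) - to_L2 h) \<le> (1/2)^k" for k
    proof -
      have "ennreal ((norm (to_L2 (\<lambda>x. h x - f k x)))\<^sup>2) \<le> ennreal (((1/2)^k)\<^sup>2)"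
        using dist_h[of k] by (subst norm_to_L2_nn[symmetric]) (auto intro: hd)
      then have "(norm (to_L2 h - X (r k)))\<^sup>2 \<le> ((1/2)^k)\<^sup>2"
        by (simp add: to_L2_diff hs f)
      then show ?thesis
        by (simp add: norm_minus_commute abs_le_square_iff[symmetric])
    qed
    then show "\<forall>\<^sub>F k in sequentially. norm (X (r k) - to_L2 h) \<le> norm ((1/2::real)^k)"
      by (intro always_eventually allI) simp
  qed simp
  then show "convergent X"
    using Cauchy_converges_subseq[OF X r] by (auto simp: o_def convergent_def)
qed

lemma separable_imp_countable_subbasis:
  fixes D :: "'a::metric_space set"
  assumes "countable D" "closure D = UNIV"
  shows "\<exists>B::'a set set. countable B \<and> open = generate_topology B"
proof -
  define B where "B = (\<lambda>(d, n). ball d (1 / real (Suc n))) ` (D \<times> (UNIV :: nat set))"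
  have "topological_basis B"
  proof (rule topological_basisI)
    fix U :: "'a set" and x assume "open U" "x \<in> U"
    then obtain e where e: "e > 0" "ball x e \<subseteq> U" by (auto simp: open_contains_ball)
    obtain n where n: "1 / real (Suc n) < e / 2"
      using nat_approx_posE[of "e / 2"] e by auto
    have "x \<in> closure D" using assms by simp
    then obtain d where d: "d \<in> D" "dist d x < 1 / real (Suc n)"
      unfolding closure_approachable by (metis zero_less_divide_1_iff of_nat_0_less_iff zero_less_Suc)
    have "y \<in> U" if "dist d y < 1 / real (Suc n)" for y
    proof -
      have "dist x y \<le> dist d x + dist d y" by (metis dist_commute dist_triangle)
      then have "dist x y < e" using d that n by linarith
      then show ?thesis using e by auto
    qed
    then show "\<exists>W\<in>B. x \<in> W \<and> W \<subseteq> U"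
      using d by (intro bexI[of _ "ball d (1 / real (Suc n))"]) (auto simp: B_def)
  qed (auto simp: B_def)
  moreover have "countable B" using assms by (auto simp: B_def)
  ultimately show ?thesis using topological_basis_imp_subbasis by blast
qed

lemma closure_add_mem:
  fixes S :: "'a::real_normed_vector set"
  assumes S: "\<And>x y. x \<in> S \<Longrightarrow> y \<in> S \<Longrightarrow> x + y \<in> S" and "x \<in> closure S" "y \<in> closure S"
  shows "x + y \<in> closure S"
proof -
  obtain f g where "\<And>n. f n \<in> S" "f \<longlonglongrightarrow> x" "\<And>n. g n \<in> S" "g \<longlonglongrightarrow> y"
    using assms(2,3) unfolding closure_sequential by blast
  then show ?thesis
    unfolding closure_sequential by (intro exI[of _ "\<lambda>n. f n + g n"]) (auto intro: S tendsto_add)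
qed

lemma countable_span_imp_separable:
  fixes E :: "'a::real_normed_vector set"
  assumes "countable E" "closure (span E) = UNIV"
  shows "\<exists>D::'a set. countable D \<and> closure D = UNIV"
proof (intro exI conjI)
  define c where "c = (\<lambda>xs. \<Sum>(q, e)\<leftarrow>xs. real_of_rat q *\<^sub>R (e::'a))"
  define D where "D = c ` lists (UNIV \<times> E)"
  show "countable D" unfolding D_def using assms(1) by (intro countable_image countable_lists) auto
  have D_add: "x + y \<in> D" if xy: "x \<in> D" "y \<in> D" for x y
  proof -
    obtain xs ys where "xs \<in> lists (UNIV \<times> E)" "x = c xs" "ys \<in> lists (UNIV \<times> E)" "y = c ys"
      using xy unfolding D_def by blast
    then show ?thesis unfolding D_def by (intro image_eqI[of _ _ "xs @ ys"]) (auto simp: c_def)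
  qed
  have scale: "r *\<^sub>R e \<in> closure D" if e: "e \<in> E" for r e
  proof -
    have "(\<lambda>r. r *\<^sub>R e) ` closure \<rat> \<subseteq> closure ((\<lambda>r. r *\<^sub>R e) ` \<rat>)"
      by (rule image_closure_subset) (auto intro!: continuous_intros closure_subset[THEN subsetD])
    also have "\<dots> \<subseteq> closure D"
    proof (rule closure_mono, safe)
      fix q :: real assume "q \<in> \<rat>"
      then obtain q' where "q = of_rat q'" by (auto elim: Rats_cases)
      then show "q *\<^sub>R e \<in> D" unfolding D_def
        using e by (intro image_eqI[of _ _ "[(q', e)]"]) (auto simp: c_def)
    qed
    finally show ?thesis by (auto simp: Rats_closure_real)
  qed
  have "span E \<subseteq> closure D"
  proof
    fix x assume "x \<in> span E"
    then show "x \<in> closure D"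
    proof (induction rule: span_induct_alt)
      case base
      have "c [] \<in> D" unfolding D_def by (rule imageI) simp
      then show ?case by (simp add: c_def closure_subset[THEN subsetD])
    next
      case (step r e y)
      then show ?case using D_add by (intro closure_add_mem scale) auto
    qed
  qed
  then show "closure D = UNIV"
    using assms(2) by (metis closure_closure closure_mono top.extremum_uniqueI)
qed

lemma sq_integrable_indicator:
  assumes A: "A \<in> sets borel"
  shows "sq_integrable (\<lambda>x. indicator A x *\<^sub>R b)"
proof -
  have "integrable sphere_measure (\<lambda>x. indicator A x * (norm b)\<^sup>2)"
    using A by (intro integrable_mult_left integrable_real_indicator)
      (auto simp: sphere_measure.emeasure_eq_measure)
  moreover have "indicator A x * (norm b)\<^sup>2 = (norm (indicator A x *\<^sub>R b))\<^sup>2" for x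
    by (simp add: indicator_def)
  ultimately show ?thesis using A by (simp add: sq_integrable_def)
qed

lemma sq_integrable_sum:
  "(\<And>i. i \<in> S \<Longrightarrow> sq_integrable (f i)) \<Longrightarrow> sq_integrable (\<lambda>x. \<Sum>i\<in>S. f i x)"
  by (induction S rule: infinite_finite_induct) (auto simp: sq_integrable_zero sq_integrable_add)

lemma to_L2_zero: "to_L2 (\<lambda>x. 0) = 0"
  by transfer (simp add: sq_integrable_zero)

lemma to_L2_sum:
  "(\<And>i. i \<in> S \<Longrightarrow> sq_integrable (f i)) \<Longrightarrow> to_L2 (\<lambda>x. \<Sum>i\<in>S. f i x) = (\<Sum>i\<in>S. to_L2 (f i))"
  by (induction S rule: infinite_finite_induct)
    (auto simp: to_L2_zero to_L2_add sq_integrable_sum)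

instance L2_sphere :: (euclidean_space) second_countable_topology
proof
  obtain B :: "(real ^ 3) set set" where B: "countable B" "topological_basis B"
    using ex_countable_basis by blast
  define G where "G = Inter ` {S. finite S \<and> S \<subseteq> B}"
  have "countable G" unfolding G_def by (intro countable_image countable_Collect_finite_subset B)
  have open_G: "open A" if "A \<in> G" for A
    using that topological_basis_open[OF B(2)] by (auto simp: G_def intro!: open_Inter)
  have "topological_basis G"
  proof (rule topological_basisI)
    fix U :: "(real ^ 3) set" and x assume "open U" "x \<in> U"
    with B(2) obtain W where "W \<in> B" "x \<in> W" "W \<subseteq> U" by (rule topological_basisE)
    then show "\<exists>W\<in>G. x \<in> W \<and> W \<subseteq> U"
      unfolding G_def by (intro bexI[of _ W] image_eqI[of _ _ "{W}"]) auto
  qed (rule open_G)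
  then have borel_G: "sets borel = sigma_sets UNIV G"
    using borel_eq_countable_basis[OF \<open>countable G\<close>] by (metis Pow_UNIV sets_measure_of subset_UNIV)
  have Int_G: "Int_stable G"
  proof (rule Int_stableI)
    fix A A' assume "A \<in> G" "A' \<in> G"
    then obtain S S' where S: "finite S" "S \<subseteq> B" "A = \<Inter>S" "finite S'" "S' \<subseteq> B" "A' = \<Inter>S'"
      by (auto simp: G_def)
    then show "A \<inter> A' \<in> G" unfolding G_def by (intro image_eqI[of _ _ "S \<union> S'"]) auto
  qed
  have Pow_G: "G \<subseteq> Pow UNIV" by simp
  let ?I = "\<lambda>A (b::'a). to_L2 (\<lambda>x. indicator A x *\<^sub>R b)"
  define E where "E = (\<lambda>(A, b). ?I A b) ` (G \<times> Basis)"
  define V where "V = closure (span E)"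
  have V_add: "x + y \<in> V" if "x \<in> V" "y \<in> V" for x y
    using that unfolding V_def by (intro closure_add_mem span_add)
  have V_scale: "r *\<^sub>R x \<in> V" if "x \<in> V" for r x
  proof -
    have "(\<lambda>x. r *\<^sub>R x) ` closure (span E) \<subseteq> closure ((\<lambda>x. r *\<^sub>R x) ` span E)"
      by (rule image_closure_subset) (auto intro!: continuous_intros closure_subset[THEN subsetD])
    also have "\<dots> \<subseteq> closure (span E)" by (intro closure_mono) (auto intro: span_scale)
    finally show ?thesis using that by (auto simp: V_def)
  qed
  have V_0: "0 \<in> V" unfolding V_def by (intro closure_subset[THEN subsetD] span_zero)
  have V_diff: "x - y \<in> V" if "x \<in> V" "y \<in> V" for x y
    using V_add[OF that(1) V_scale[OF that(2), of "-1"]] by simp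
  have V_sum: "(\<Sum>i\<in>J. h i) \<in> V" if "\<And>i. i \<in> J \<Longrightarrow> h i \<in> V" for h and J :: "'i set"
    using that by (induction J rule: infinite_finite_induct) (auto simp: V_0 V_add)
  have V_lim: "x \<in> V" if "\<And>n. h n \<in> V" "h \<longlonglongrightarrow> x" for h x
    using closed_sequentially[of V h x] that by (simp add: V_def)
  have V_E: "x \<in> V" if "x \<in> E" for x
    using that unfolding V_def by (intro closure_subset[THEN subsetD] span_base)

  have conv: "(\<lambda>n. to_L2 (s n)) \<longlonglongrightarrow> to_L2 f"
    if s: "\<And>n. sq_integrable (s n)" and f: "sq_integrable f" and lim: "\<And>x. (\<lambda>n. s n x) \<longlonglongrightarrow> f x"
      and bd: "\<And>n x. norm (s n x) \<le> 2 * norm (f x)" for s and f :: "real ^ 3 \<Rightarrow> 'a"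
  proof -
    have [measurable]: "f \<in> borel_measurable borel" "s n \<in> borel_measurable borel" for n
      using s[of n] f by (auto simp: sq_integrable_def)
    have "(\<lambda>n. \<integral>x. (norm (s n x - f x))\<^sup>2 \<partial>sphere_measure) \<longlonglongrightarrow> (\<integral>x. 0 \<partial>sphere_measure)"
    proof (rule integral_dominated_convergence)
      show "integrable sphere_measure (\<lambda>x. 9 * (norm (f x))\<^sup>2)"
        using f by (auto simp: sq_integrable_def)
      show "AE x in sphere_measure. (\<lambda>n. (norm (s n x - f x))\<^sup>2) \<longlonglongrightarrow> 0"
      proof (intro always_eventually allI)
        fix x
        have "(\<lambda>n. (norm (s n x - f x))\<^sup>2) \<longlonglongrightarrow> (norm (f x - f x))\<^sup>2"
          by (intro tendsto_intros lim)
        then show "(\<lambda>n. (norm (s n x - f x))\<^sup>2) \<longlonglongrightarrow> 0" by simp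
      qed
      show "AE x in sphere_measure. norm ((norm (s n x - f x))\<^sup>2) \<le> 9 * (norm (f x))\<^sup>2" for n
      proof (intro always_eventually allI)
        fix x
        have "norm (s n x - f x) \<le> 3 * norm (f x)"
          using norm_triangle_ineq4[of "s n x" "f x"] bd[of n x] by linarith
        then have "(norm (s n x - f x))\<^sup>2 \<le> (3 * norm (f x))\<^sup>2" by (rule power_mono) simp
        then show "norm ((norm (s n x - f x))\<^sup>2) \<le> 9 * (norm (f x))\<^sup>2"
          by (simp add: power_mult_distrib)
      qed
    qed auto
    then have "(\<lambda>n. (norm (to_L2 (s n) - to_L2 f))\<^sup>2) \<longlonglongrightarrow> 0"
      by (simp add: norm_to_L2[OF sq_integrable_diff[OF s f]] flip: to_L2_diff[OF s f])
    then have "(\<lambda>n. sqrt ((norm (to_L2 (s n) - to_L2 f))\<^sup>2)) \<longlonglongrightarrow> sqrt 0"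
      by (rule tendsto_real_sqrt)
    then show ?thesis by (simp add: tendsto_norm_zero_iff LIM_zero_iff)
  qed

  have UNIV_V: "?I UNIV b \<in> V" if "b \<in> Basis" for b
  proof -
    have "UNIV \<in> G" unfolding G_def by (intro image_eqI[of _ _ "{}"]) auto
    then show ?thesis using that unfolding E_def
      by (intro V_E[unfolded E_def] image_eqI[of _ _ "(UNIV, b)"]) auto
  qed
  have ind_V: "?I A b \<in> V" if A: "A \<in> sets borel" and b: "b \<in> Basis" for A b
    using Int_G Pow_G A[unfolded borel_G]
  proof (induction rule: sigma_sets_induct_disjoint)
    case (basic A)
    then show ?case using b
      by (intro V_E[unfolded E_def] image_eqI[of _ _ "(A, b)"]) auto
  next
    case empty
    have "?I {} b = 0" by (simp add: to_L2_zero)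
    then show ?case using V_0 by simp
  next
    case (compl A)
    then have "A \<in> sets borel" by (simp add: borel_G)
    have "(\<lambda>x. indicator (UNIV - A) x *\<^sub>R b) = (\<lambda>x. indicator UNIV x *\<^sub>R b - indicator A x *\<^sub>R b)"
      by (auto simp: fun_eq_iff indicator_def)
    moreover have "to_L2 (\<lambda>x. indicator UNIV x *\<^sub>R b - indicator A x *\<^sub>R b) = ?I UNIV b - ?I A b"
      by (intro to_L2_diff sq_integrable_indicator \<open>A \<in> sets borel\<close>) simp
    ultimately have "?I (UNIV - A) b = ?I UNIV b - ?I A b" by simp
    then show ?case using V_diff[OF UNIV_V[OF b] compl(2)] by simp
  next
    case (union A)
    then have [measurable]: "A i \<in> sets borel" for i using borel_G by auto
    have "(\<lambda>n. ?I (\<Union>i<n. A i) b) \<longlonglongrightarrow> ?I (\<Union>i. A i) b"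
    proof (rule conv)
      fix x
      have "(\<lambda>n. indicator (\<Union>i<n. A i) x :: real) \<longlonglongrightarrow> indicator (\<Union>i. A i) x"
        by (rule LIMSEQ_indicator_UN)
      then show "(\<lambda>n. indicator (\<Union>i<n. A i) x *\<^sub>R b) \<longlonglongrightarrow> indicator (\<Union>i. A i) x *\<^sub>R b"
        by (intro tendsto_intros)
      show "norm (indicator (\<Union>i<n. A i) x *\<^sub>R b) \<le> 2 * norm (indicator (\<Union>i. A i) x *\<^sub>R b)" for n
        by (auto simp: indicator_def)
    qed (intro sq_integrable_indicator, measurable)+
    moreover have "?I (\<Union>i<n. A i) b \<in> V" for n
    proof (induction n)
      case 0
      have "?I {} b = 0" by (simp add: to_L2_zero)
      then show ?case using V_0 by simp
    next
      case (Suc n)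
      have disj: "A i \<inter> A n = {}" if "i < n" for i
        by (rule disjoint_family_onD[OF union(1)]) (use that in auto)
      have "(\<lambda>x. indicator (\<Union>i<Suc n. A i) x *\<^sub>R b) =
          (\<lambda>x. indicator (\<Union>i<n. A i) x *\<^sub>R b + indicator (A n) x *\<^sub>R b)"
      proof
        fix x
        show "indicator (\<Union>i<Suc n. A i) x *\<^sub>R b = indicator (\<Union>i<n. A i) x *\<^sub>R b + indicator (A n) x *\<^sub>R b"
        proof (cases "x \<in> A n")
          case True
          then have "x \<notin> (\<Union>i<n. A i)" using disj by blast
          then show ?thesis using True by (simp add: lessThan_Suc)
        next
          case False
          then show ?thesis by (simp add: lessThan_Suc indicator_def)
        qed
      qed
      moreover have "to_L2 (\<lambda>x. indicator (\<Union>i<n. A i) x *\<^sub>R b + indicator (A n) x *\<^sub>R b)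
          = ?I (\<Union>i<n. A i) b + ?I (A n) b"
        by (intro to_L2_add sq_integrable_indicator) measurable
      ultimately have "?I (\<Union>i<Suc n. A i) b = ?I (\<Union>i<n. A i) b + ?I (A n) b" by simp
      then show ?case using V_add[OF Suc union(3)] by simp
    qed
    ultimately show ?case by (rule V_lim[rotated])
  qed
  have ind_V': "?I A c \<in> V" if A: "A \<in> sets borel" for A c
  proof -
    have "to_L2 (\<lambda>x. \<Sum>b\<in>Basis. (c \<bullet> b) *\<^sub>R (indicator A x *\<^sub>R b)) = (\<Sum>b\<in>Basis. (c \<bullet> b) *\<^sub>R ?I A b)"
      by (subst to_L2_sum)
        (intro sq_integrable_scaleR sq_integrable_indicator A sum.cong refl to_L2_scaleR)+
    moreover have "(\<Sum>b\<in>Basis. (c \<bullet> b) *\<^sub>R (indicator A x *\<^sub>R b)) = indicator A x *\<^sub>R c" for x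
    proof -
      have "(\<Sum>b\<in>Basis. (c \<bullet> b) *\<^sub>R (indicator A x *\<^sub>R b)) = indicator A x *\<^sub>R (\<Sum>b\<in>Basis. (c \<bullet> b) *\<^sub>R b)"
        by (simp add: scaleR_sum_right mult.commute)
      then show ?thesis by (simp add: euclidean_representation)
    qed
    ultimately have "?I A c = (\<Sum>b\<in>Basis. (c \<bullet> b) *\<^sub>R ?I A b)" by simp
    then show ?thesis by (simp add: V_sum V_scale ind_V A)
  qed
  have simple_V: "to_L2 s \<in> V \<and> sq_integrable s" if s: "simple_function sphere_measure s" for s :: "real ^ 3 \<Rightarrow> 'a"
  proof -
    have meas: "s -` {y} \<in> sets borel" for y
      using simple_functionD(2)[OF s, of "{y}"] by simp
    have fin: "finite (range s)" using simple_functionD(1)[OF s] by simp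
    have 1: "to_L2 (\<lambda>x. \<Sum>y\<in>range s. indicator (s -` {y}) x *\<^sub>R y) = (\<Sum>y\<in>range s. ?I (s -` {y}) y)"
      by (intro to_L2_sum sq_integrable_indicator meas)
    have 2: "sq_integrable (\<lambda>x. \<Sum>y\<in>range s. indicator (s -` {y}) x *\<^sub>R y)"
      by (intro sq_integrable_sum sq_integrable_indicator meas)
    have "(\<Sum>y\<in>range s. indicator (s -` {y}) x *\<^sub>R y) = s x" for x
    proof -
      have "(\<Sum>y\<in>range s. indicator (s -` {y}) x *\<^sub>R y) = (\<Sum>y\<in>{s x}. indicator (s -` {y}) x *\<^sub>R y)"
        by (rule sum.mono_neutral_right[OF fin]) (auto simp: indicator_def)
      then show ?thesis by simp
    qed
    with 1 2 show ?thesis by (simp add: V_sum ind_V'[OF meas])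
  qed
  have "F \<in> V" for F
  proof -
    obtain f where f: "sq_integrable f" "to_L2 f = F" by (rule to_L2_cases)
    then have "f \<in> borel_measurable sphere_measure" by (simp add: sq_integrable_def)
    from borel_measurable_implies_sequence_metric[OF this, of 0] obtain s where
      s: "\<And>i. simple_function sphere_measure (s i)" "\<And>x. (\<lambda>i. s i x) \<longlonglongrightarrow> f x"
        "\<And>i x. norm (s i x) \<le> 2 * norm (f x)" by auto
    have "(\<lambda>n. to_L2 (s n)) \<longlonglongrightarrow> to_L2 f"
      by (rule conv) (use s f simple_V in auto)
    then have "to_L2 f \<in> V"
      by (rule V_lim[of "\<lambda>n. to_L2 (s n)", rotated]) (use simple_V[OF s(1)] in auto)
    then show ?thesis using f by simp
  qed
  then have "closure (span E) = UNIV" by (auto simp: V_def)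
  moreover have "countable E" unfolding E_def using \<open>countable G\<close>
    by (intro countable_image countable_SIGMA) (auto simp: countable_finite)
  ultimately show "\<exists>B::'a L2_sphere set set. countable B \<and> open = generate_topology B"
    using countable_span_imp_separable separable_imp_countable_subbasis by blast
qed


lift_definition cplx_L2 :: "real L2_sphere \<Rightarrow> complex L2_sphere" is "\<lambda>f x. complex_of_real (f x)"
  by (auto simp: sq_integrable_def intro!: borel_measurable_of_real elim: AE_mp)


section \<open>Spherical harmonics\<close>

definition legendre :: "nat \<Rightarrow> real poly" where
  "legendre l = smult (1 / (2 ^ l * fact l)) ((pderiv ^^ l) ([:-1, 0, 1:] ^ l))"

definition assoc_legendre :: "nat \<Rightarrow> nat \<Rightarrow> real \<Rightarrow> real" where
  "assoc_legendre l m \<mu> = (- 1) ^ m * sqrt (1 - \<mu>\<^sup>2) ^ m * poly ((pderiv ^^ m) (legendre l)) \<mu>"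

text \<open>
  At the point \<open>x\<close> of the sphere with spherical coordinates \<open>(\<theta>, \<phi>)\<close> one has \<open>cos \<theta> = x\<^sub>3\<close> and, off the
  poles, \<open>\<phi> = Arg (x\<^sub>1 + i x\<^sub>2)\<close> modulo \<open>2\<pi>\<close>. At the poles \<open>\<phi>\<close> is immaterial, as \<open>assoc_legendre l m\<close>
  vanishes there for \<open>m > 0\<close>.
\<close>

definition sph_harm_nonneg :: "nat \<Rightarrow> nat \<Rightarrow> real ^ 3 \<Rightarrow> complex" where
  "sph_harm_nonneg l m x =
     complex_of_real (sqrt ((2 * real l + 1) / (4 * pi) * (fact (l - m) / fact (l + m)))
       * assoc_legendre l m (x $ 3))
     * cis (real m * Arg (Complex (x $ 1) (x $ 2)))"

definition sph_harm :: "nat \<Rightarrow> int \<Rightarrow> real ^ 3 \<Rightarrow> complex" where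
  "sph_harm l m x =
     (if 0 \<le> m then sph_harm_nonneg l (nat m) x
      else (- 1) ^ nat (- m) * cnj (sph_harm_nonneg l (nat (- m)) x))"

lemma sph_harm_measurable [measurable]: "sph_harm l m \<in> borel_measurable borel"
proof -
  have cis_eq: "cis (real k * Arg z) = (if z = 0 then 1 else sgn z) ^ k" for k z
    by (cases "z = 0") (simp_all add: Arg_zero cis_Arg flip: Complex.DeMoivre)
  have [measurable]: "(\<lambda>x::real ^ 3. x $ i) \<in> borel_measurable borel" for i
    by (intro borel_measurable_continuous_onI continuous_intros)
  have [measurable]: "(\<lambda>x::real ^ 3. poly p (x $ i)) \<in> borel_measurable borel" for p i
    by (intro borel_measurable_continuous_onI continuous_intros)
  have [measurable]: "(\<lambda>x::real ^ 3. Complex (x $ 1) (x $ 2)) \<in> borel_measurable borel"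
    unfolding Complex_eq by measurable
  have "sph_harm_nonneg l k \<in> borel_measurable borel" for k
    unfolding sph_harm_nonneg_def assoc_legendre_def cis_eq sgn_div_norm by measurable
  then have [measurable]: "sph_harm_nonneg l k \<in> borel_measurable borel" for k .
  have "(\<lambda>x. cnj (sph_harm_nonneg l k x)) \<in> borel_measurable borel" for k
    by (rule measurable_compose[OF _ borel_measurable_continuous_onI]) (auto intro!: continuous_intros)
  then show ?thesis
    unfolding sph_harm_def by (cases "0 \<le> m") auto
qed

lemma sph_harm_bounded: "\<exists>K. AE x in sphere_measure. cmod (sph_harm l m x) \<le> K"
proof -
  have coord3: "spherical_coords p $ 3 = cos (fst p)" for p
    by (simp add: spherical_coords_def split_beta)
  have nonneg: "\<exists>K. \<forall>p. cmod (sph_harm_nonneg l k (spherical_coords p)) \<le> K" for k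
  proof -
    let ?P = "poly ((pderiv ^^ k) (legendre l))"
    have "compact (?P ` {-1..1})"
      by (intro compact_continuous_image continuous_intros) auto
    then obtain K where "\<forall>y\<in>?P ` {-1..1}. norm y \<le> K"
      unfolding bounded_iff[symmetric] using compact_imp_bounded bounded_iff by blast
    then have K: "\<bar>?P \<mu>\<bar> \<le> K" if "\<mu> \<in> {-1..1}" for \<mu>
      using that by auto
    let ?N = "sqrt ((2 * real l + 1) / (4 * pi) * (fact (l - k) / fact (l + k)))"
    have "cmod (sph_harm_nonneg l k (spherical_coords p)) \<le> \<bar>?N\<bar> * K" for p
    proof -
      let ?\<mu> = "cos (fst p)"
      have "\<bar>sqrt (1 - ?\<mu>\<^sup>2)\<bar> \<le> 1"
        by (simp add: abs_square_le_1 flip: sin_squared_eq)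
      then have "\<bar>sqrt (1 - ?\<mu>\<^sup>2)\<bar> ^ k \<le> 1" by (intro power_le_one) auto
      then have "\<bar>assoc_legendre l k ?\<mu>\<bar> \<le> 1 * K"
        unfolding assoc_legendre_def abs_mult power_abs
        by (intro mult_mono) (auto intro!: K)
      then show ?thesis
        unfolding sph_harm_nonneg_def coord3 norm_mult norm_cis norm_of_real abs_mult
        by (auto intro!: mult_left_mono)
    qed
    then show ?thesis by blast
  qed
  have "\<exists>K. \<forall>p. cmod (sph_harm l m (spherical_coords p)) \<le> K"
    using nonneg[of "nat m"] nonneg[of "nat (- m)"]
    by (cases "0 \<le> m") (auto simp: sph_harm_def norm_mult norm_power)
  then obtain K where K: "\<And>p. cmod (sph_harm l m (spherical_coords p)) \<le> K" by blast
  have "AE x in sphere_measure. cmod (sph_harm l m x) \<le> K"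
    unfolding sphere_measure_def
    by (subst AE_distr_iff) (auto intro!: K always_eventually measurable_restrict_space1)
  then show ?thesis ..
qed

lemma sq_integrable_sph_harm: "sq_integrable (sph_harm l m)"
proof -
  obtain K where K: "AE x in sphere_measure. cmod (sph_harm l m x) \<le> K"
    using sph_harm_bounded by blast
  have "AE x in sphere_measure. norm ((cmod (sph_harm l m x))\<^sup>2) \<le> K\<^sup>2"
    using K by eventually_elim (simp add: power_mono)
  then have "integrable sphere_measure (\<lambda>x. (cmod (sph_harm l m x))\<^sup>2)"
    by (intro sphere_measure.integrable_const_bound) auto
  then show ?thesis by (simp add: sq_integrable_def)
qed

text \<open>The Fourier coefficient \<open>\<langle>f, Y\<^sub>l\<^sub>m\<rangle>\<close> in \<open>L\<^sup>2(S\<^sup>2; \<complex>)\<close>.\<close>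

lift_definition sph_coeff :: "complex L2_sphere \<Rightarrow> nat \<Rightarrow> int \<Rightarrow> complex"
  is "\<lambda>f l m. (\<integral>x. f x * cnj (sph_harm l m x) \<partial>sphere_measure)"
proof (intro ext, elim conjE)
  fix f g :: "real ^ 3 \<Rightarrow> complex" and l m
  assume sq: "sq_integrable f" "sq_integrable g" and ae: "AE x in sphere_measure. f x = g x"
  have [measurable]: "f \<in> borel_measurable borel" "g \<in> borel_measurable borel"
    using sq by (auto simp: sq_integrable_def)
  have [measurable]: "(\<lambda>x. cnj (sph_harm l m x)) \<in> borel_measurable borel"
    by (rule measurable_compose[OF _ borel_measurable_continuous_onI]) (auto intro!: continuous_intros)
  show "(\<integral>x. f x * cnj (sph_harm l m x) \<partial>sphere_measure) =
      (\<integral>x. g x * cnj (sph_harm l m x) \<partial>sphere_measure)"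
    by (rule integral_cong_AE) (use ae in auto)
qed


section \<open>Functional calculus of the Laplace--Beltrami operator and Sobolev spaces\<close>

text \<open>The eigenvalue of \<open>-\<Delta>\<close> on the span of the \<open>sph_harm l m\<close>.\<close>

definition sph_eigenvalue :: "nat \<Rightarrow> real" where "sph_eigenvalue l = real l * (real l + 1)"

text \<open>
  \<open>lb_calculus \<psi> f\<close> is \<open>\<psi>(\<Delta>) f\<close>, i.e. the sum over \<open>l\<close> and \<open>m\<close> of \<open>\<psi>(- l (l + 1)) \<langle>f, Y\<^sub>l\<^sub>m\<rangle> Y\<^sub>l\<^sub>m\<close>,
  the series over \<open>l\<close> being taken in \<open>L\<^sup>2\<close>. It is meaningful for \<open>f\<close> in the domain of
  \<open>\<psi>(\<Delta>)\<close>, which is where the series converges.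
\<close>

definition lb_calculus :: "(real \<Rightarrow> real) \<Rightarrow> complex L2_sphere \<Rightarrow> complex L2_sphere" where
  "lb_calculus \<psi> f = (\<Sum>l. to_L2 (\<lambda>x. \<Sum>m\<in>{- int l..int l}.
     complex_of_real (\<psi> (- sph_eigenvalue l)) * sph_coeff f l m * sph_harm l m x))"

text \<open>The operator \<open>(Id - \<Delta>)\<^bsup>s/2\<^esup>\<close>.\<close>

definition bessel_op :: "real \<Rightarrow> complex L2_sphere \<Rightarrow> complex L2_sphere" where
  "bessel_op s = lb_calculus (\<lambda>\<mu>. (1 - \<mu>) powr (s / 2))"

text \<open>
  \<open>H\<^sup>s(S\<^sup>2) = (Id - \<Delta>)\<^bsup>-s/2\<^esup> L\<^sup>2(S\<^sup>2)\<close> for \<open>s \<ge> 0\<close>, where it is a subspace of \<open>L\<^sup>2(S\<^sup>2)\<close>. (For \<open>s < 0\<close> it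
  would have to contain distributions, which is not modelled.)
\<close>

definition sobolev_space :: "real \<Rightarrow> real L2_sphere set" where
  "sobolev_space s = {f. \<exists>g. cplx_L2 f = bessel_op (- s) (cplx_L2 g)}"

definition sobolev_norm :: "real \<Rightarrow> real L2_sphere \<Rightarrow> real" where
  "sobolev_norm s f = norm (bessel_op s (cplx_L2 f))"

text \<open>
  Membership in \<open>L\<^sup>2(\<Omega>; H\<^sup>s(S\<^sup>2))\<close>. Borel measurability in \<open>L\<^sup>2(S\<^sup>2)\<close> of an \<open>H\<^sup>s\<close>-valued map is equivalent to
  its (strong) measurability in \<open>H\<^sup>s\<close>, both spaces being separable Hilbert spaces and the embedding
  continuous and injective.
\<close>

definition sobolev_L2_rv :: "'w measure \<Rightarrow> real \<Rightarrow> ('w \<Rightarrow> real L2_sphere) \<Rightarrow> bool" where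
  "sobolev_L2_rv M s Z \<longleftrightarrow> Z \<in> borel_measurable M \<and> (AE \<omega> in M. Z \<omega> \<in> sobolev_space s) \<and>
     integrable M (\<lambda>\<omega>. (sobolev_norm s (Z \<omega>))\<^sup>2)"

definition sobolev_L2_norm :: "'w measure \<Rightarrow> real \<Rightarrow> ('w \<Rightarrow> real L2_sphere) \<Rightarrow> real" where
  "sobolev_L2_norm M s Z = sqrt (\<integral>\<omega>. (sobolev_norm s (Z \<omega>))\<^sup>2 \<partial>M)"


section \<open>Brownian motions and Wiener integrals\<close>

text \<open>Filtrations and processes are indexed by \<open>real\<close>, but only times \<open>t \<ge> 0\<close> are constrained.\<close>

definition complete_filtered_prob_space :: "'w measure \<Rightarrow> (real \<Rightarrow> 'w measure) \<Rightarrow> bool" where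
  "complete_filtered_prob_space M F \<longleftrightarrow> prob_space M \<and> complete_measure M \<and>
     (\<forall>t\<ge>0. subalgebra M (F t)) \<and> (\<forall>s\<ge>0. \<forall>t\<ge>s. sets (F s) \<subseteq> sets (F t)) \<and>
     null_sets M \<subseteq> sets (F 0)"

definition brownian_motion ::
    "'w measure \<Rightarrow> (real \<Rightarrow> 'w measure) \<Rightarrow> (real \<Rightarrow> 'w \<Rightarrow> real) \<Rightarrow> bool" where
  "brownian_motion M F B \<longleftrightarrow>
     (\<forall>t\<ge>0. B t \<in> borel_measurable (F t)) \<and>
     (AE \<omega> in M. B 0 \<omega> = 0) \<and>
     (AE \<omega> in M. continuous_on {0..} (\<lambda>t. B t \<omega>)) \<and>
     (\<forall>s\<ge>0. \<forall>t>s.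
        distributed M lborel (\<lambda>\<omega>. B t \<omega> - B s \<omega>) (normal_density 0 (sqrt (t - s))) \<and>
        prob_space.indep_set M (sets (F s))
          {(\<lambda>\<omega>. B t \<omega> - B s \<omega>) -` U \<inter> space M |U. U \<in> sets borel})"

text \<open>\<open>\<beta> 1 l m\<close> with \<open>0 \<le> m \<le> l\<close> and \<open>\<beta> 2 l m\<close> with \<open>1 \<le> m \<le> l\<close>; all other indices are unused.\<close>

definition noise_indices :: "(nat \<times> nat \<times> nat) set" where
  "noise_indices = {(1, l, m) |l m. m \<le> l} \<union> {(2, l, m) |l m. 1 \<le> m \<and> m \<le> l}"

definition independent_brownian_motions ::
    "'w measure \<Rightarrow> (real \<Rightarrow> 'w measure) \<Rightarrow> (nat \<Rightarrow> nat \<Rightarrow> nat \<Rightarrow> real \<Rightarrow> 'w \<Rightarrow> real) \<Rightarrow> bool" where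
  "independent_brownian_motions M F \<beta> \<longleftrightarrow>
     (\<forall>(j, l, m) \<in> noise_indices. brownian_motion M F (\<beta> j l m)) \<and>
     prob_space.indep_vars M (\<lambda>_. Pi\<^sub>M {0..} (\<lambda>_. borel))
       (\<lambda>(j, l, m) \<omega>. \<lambda>t\<in>{0..}. \<beta> j l m t \<omega>) noise_indices"

text \<open>
  The Wiener integral \<open>\<integral>\<^sub>0\<^sup>t f(s) dZ(s)\<close> of a deterministic function: the limit in \<open>L\<^sup>2(\<Omega>)\<close> of the
  elementary integrals of step functions that converge to \<open>f\<close> in \<open>L\<^sup>2(0, t)\<close>. A step function takes the
  value \<open>c i\<close> on \<open>(p i, p (i + 1)]\<close>, \<open>i < n\<close>.
\<close>

definition step_fun :: "(nat \<Rightarrow> real) \<Rightarrow> (nat \<Rightarrow> real) \<Rightarrow> nat \<Rightarrow> real \<Rightarrow> real" where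
  "step_fun p c n s = (\<Sum>i<n. c i * indicator {p i<..p (Suc i)} s)"

definition step_integral ::
    "(real \<Rightarrow> 'w \<Rightarrow> complex) \<Rightarrow> (nat \<Rightarrow> real) \<Rightarrow> (nat \<Rightarrow> real) \<Rightarrow> nat \<Rightarrow> 'w \<Rightarrow> complex" where
  "step_integral Z p c n \<omega> = (\<Sum>i<n. complex_of_real (c i) * (Z (p (Suc i)) \<omega> - Z (p i) \<omega>))"

definition has_wiener_integral ::
    "'w measure \<Rightarrow> (real \<Rightarrow> 'w \<Rightarrow> complex) \<Rightarrow> (real \<Rightarrow> real) \<Rightarrow> real \<Rightarrow> ('w \<Rightarrow> complex) \<Rightarrow> bool" where
  "has_wiener_integral M Z f t I \<longleftrightarrow>
     I \<in> borel_measurable M \<and> integrable M (\<lambda>\<omega>. (cmod (I \<omega>))\<^sup>2) \<and>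
     (\<exists>p c n.
        (\<forall>k. p k 0 = 0 \<and> p k (n k) = t \<and> (\<forall>i<n k. p k i \<le> p k (Suc i))) \<and>
        (\<lambda>k. \<integral>\<^sup>+s\<in>{0..t}. ennreal ((step_fun (p k) (c k) (n k) s - f s)\<^sup>2) \<partial>lborel) \<longlonglongrightarrow> 0 \<and>
        (\<lambda>k. \<integral>\<^sup>+\<omega>. ennreal ((cmod (step_integral Z (p k) (c k) (n k) \<omega> - I \<omega>))\<^sup>2) \<partial>M) \<longlonglongrightarrow> 0)"

text \<open>A version of the integral, which is determined almost surely.\<close>

definition wiener_integral ::
    "'w measure \<Rightarrow> (real \<Rightarrow> 'w \<Rightarrow> complex) \<Rightarrow> (real \<Rightarrow> real) \<Rightarrow> real \<Rightarrow> 'w \<Rightarrow> complex" where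
  "wiener_integral M Z f t = (SOME I. has_wiener_integral M Z f t I)"


section \<open>The stochastic heat equation: spectral and Euler--Maruyama approximations\<close>

text \<open>The coefficient processes \<open>a\<^sub>l\<^sub>m\<close> of the \<open>Q\<close>-Wiener process with angular power spectrum \<open>A\<close>.\<close>

definition noise_coeff_nonneg :: "(nat \<Rightarrow> real) \<Rightarrow> (nat \<Rightarrow> nat \<Rightarrow> nat \<Rightarrow> real \<Rightarrow> 'w \<Rightarrow> real) \<Rightarrow>
    nat \<Rightarrow> nat \<Rightarrow> real \<Rightarrow> 'w \<Rightarrow> complex" where
  "noise_coeff_nonneg A \<beta> l m t \<omega> =
     (if m = 0 then complex_of_real (sqrt (A l) * \<beta> 1 l 0 t \<omega>)
      else complex_of_real (sqrt (A l / 2)) * Complex (\<beta> 1 l m t \<omega>) (\<beta> 2 l m t \<omega>))"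

definition noise_coeff :: "(nat \<Rightarrow> real) \<Rightarrow> (nat \<Rightarrow> nat \<Rightarrow> nat \<Rightarrow> real \<Rightarrow> 'w \<Rightarrow> real) \<Rightarrow>
    nat \<Rightarrow> int \<Rightarrow> real \<Rightarrow> 'w \<Rightarrow> complex" where
  "noise_coeff A \<beta> l m t \<omega> =
     (if 0 \<le> m then noise_coeff_nonneg A \<beta> l (nat m) t \<omega>
      else (- 1) ^ nat (- m) * cnj (noise_coeff_nonneg A \<beta> l (nat (- m)) t \<omega>))"

definition spectral_approx :: "'w measure \<Rightarrow> (nat \<Rightarrow> real) \<Rightarrow>
    (nat \<Rightarrow> nat \<Rightarrow> nat \<Rightarrow> real \<Rightarrow> 'w \<Rightarrow> real) \<Rightarrow> ('w \<Rightarrow> real L2_sphere) \<Rightarrow>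
    nat \<Rightarrow> real \<Rightarrow> 'w \<Rightarrow> complex L2_sphere" where
  "spectral_approx M A \<beta> X0 \<kappa> t \<omega> = to_L2 (\<lambda>x. \<Sum>l\<le>\<kappa>. \<Sum>m\<in>{- int l..int l}.
     (complex_of_real (exp (- sph_eigenvalue l * t)) * sph_coeff (cplx_L2 (X0 \<omega>)) l m
       + wiener_integral M (noise_coeff A \<beta> l m) (\<lambda>s. exp (- sph_eigenvalue l * (t - s))) t \<omega>)
     * sph_harm l m x)"

datatype em_scheme = Forward | Backward

fun em_xi :: "em_scheme \<Rightarrow> real \<Rightarrow> nat \<Rightarrow> real" where
  "em_xi Forward h l = 1 - sph_eigenvalue l * h"
| "em_xi Backward h l = inverse (1 + sph_eigenvalue l * h)"

fun em_delta :: "em_scheme \<Rightarrow> nat" where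
  "em_delta Forward = 0"
| "em_delta Backward = 1"

text \<open>\<open>em_mode sch A \<beta> X0 h l m k\<close> is the value of the scheme at the grid point \<open>k h\<close> for the mode \<open>(l, m)\<close>.\<close>

primrec em_mode :: "em_scheme \<Rightarrow> (nat \<Rightarrow> real) \<Rightarrow> (nat \<Rightarrow> nat \<Rightarrow> nat \<Rightarrow> real \<Rightarrow> 'w \<Rightarrow> real) \<Rightarrow>
    ('w \<Rightarrow> real L2_sphere) \<Rightarrow> real \<Rightarrow> nat \<Rightarrow> nat \<Rightarrow> nat \<Rightarrow> 'w \<Rightarrow> complex" where
  "em_mode sch A \<beta> X0 h l m 0 \<omega> = sph_coeff (cplx_L2 (X0 \<omega>)) l (int m)"
| "em_mode sch A \<beta> X0 h l m (Suc k) \<omega> =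
     complex_of_real (em_xi sch h l) * em_mode sch A \<beta> X0 h l m k \<omega>
     + complex_of_real (em_xi sch h l ^ em_delta sch)
       * (noise_coeff A \<beta> l (int m) (real (Suc k) * h) \<omega> - noise_coeff A \<beta> l (int m) (real k * h) \<omega>)"

definition em_approx :: "em_scheme \<Rightarrow> (nat \<Rightarrow> real) \<Rightarrow>
    (nat \<Rightarrow> nat \<Rightarrow> nat \<Rightarrow> real \<Rightarrow> 'w \<Rightarrow> real) \<Rightarrow> ('w \<Rightarrow> real L2_sphere) \<Rightarrow> real \<Rightarrow>
    nat \<Rightarrow> nat \<Rightarrow> 'w \<Rightarrow> complex L2_sphere" where
  "em_approx sch A \<beta> X0 h \<kappa> k \<omega> = to_L2 (\<lambda>x. \<Sum>l\<le>\<kappa>.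
     em_mode sch A \<beta> X0 h l 0 k \<omega> * sph_harm l 0 x
     + 2 * (\<Sum>m=1..l. complex_of_real
         (Re (em_mode sch A \<beta> X0 h l m k \<omega>) * Re (sph_harm l (int m) x)
          - Im (em_mode sch A \<beta> X0 h l m k \<omega>) * Im (sph_harm l (int m) x))))"

end

theory Submission
  imports Defs
begin

text \<open>
  Everything is diagonal in the spherical harmonics. Expanding both approximations in the orthonormal
  system \<open>Y\<^sub>l\<^sub>m\<close>, the mode \<open>(l, m)\<close> of the spectral approximation at time \<open>k h\<close> is
  \<open>e\<^bsup>-\<mu>kh\<^esup> X\<^sub>l\<^sub>m\<close> plus a Wiener integral, and that of the Euler--Maruyama scheme is \<open>\<xi>\<^sup>k X\<^sub>l\<^sub>m\<close> plus a
  geometrically weighted sum of increments, where \<open>\<mu> = l (l + 1)\<close>. The noise terms are centred and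
  uncorrelated with the initial value. Hence the expectations differ, mode by mode, by
  \<open>(e\<^bsup>-\<mu>kh\<^esup> - \<xi>\<^sup>k) E X\<^sub>l\<^sub>m\<close>, and the second moments by
  \<open>(e\<^bsup>-2\<mu>kh\<^esup> - \<xi>\<^bsup>2k\<^esup>) E |X\<^sub>l\<^sub>m|\<^sup>2\<close> plus \<open>A\<^sub>l\<close> times the difference of two deterministic variances.

  Two elementary estimates, uniform in \<open>k\<close>, then carry the proof. With \<open>z = \<mu> h\<close> one has
  \<open>|e\<^bsup>-kz\<^esup> - \<xi>\<^sup>k| \<le> z\<close> (\<open>em_power_error\<close>), and the two variances differ by at most \<open>h\<close>
  (\<open>em_noise_variance_error\<close>). As \<open>z\<close> stays bounded for \<open>l \<le> \<kappa>\<close>, the bound \<open>z\<close> may be weakened to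
  a multiple of \<open>z\<^sup>p\<close> for any \<open>0 < p \<le> 1\<close>; the factor \<open>\<mu>\<^sup>p\<close> is absorbed by the Sobolev norm of the initial
  value, with \<open>p = min 1 (\<eta> / 2)\<close> for the expectation and \<open>p = min 1 \<eta>\<close> for the second moment. The noise
  contributes \<open>h\<close> times the sum of \<open>(2 l + 1) A\<^sub>l\<close> over \<open>1 \<le> l \<le> \<kappa>\<close>, which is a bounded multiple of \<open>h\<close> for
  \<open>\<alpha> > 2\<close> and of \<open>h \<kappa>\<^bsup>2-\<alpha>\<^esup>\<close> for \<open>\<alpha> < 2\<close>; by the restriction on \<open>\<kappa>\<^sup>2 h\<close> the latter is a multiple of
  \<open>h\<^bsup>\<alpha>/2\<^esup>\<close> (\<open>noise_sum_rate\<close>).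

  The explicitly given spherical harmonics are
  orthonormal by repeated integration by parts in Rodrigues' formula (\<open>sph_harm_orthonormal\<close>). An element
  of a Sobolev space is the sum of a harmonic series, whose coefficients Bessel's inequality controls
  (\<open>sobolev_space_density_le_norm\<close>). Wiener integrals of Lipschitz functions exist as \<open>L\<^sup>2\<close>-limits
  along dyadic partitions,
  and the isometry holds for every version of the integral (\<open>heat_wiener_integral\<close>).
\<close>


section \<open>Time stepping of a single mode\<close>

lemma sph_eigenvalue_nonneg: "0 \<le> sph_eigenvalue l"
  by (simp add: sph_eigenvalue_def)

text \<open>
  The form multiplied by \<open>a\<close> of the mean value bound \<open>|x\<^sup>k - y\<^sup>k| \<le> k a\<^bsup>k-1\<^esup> |x - y|\<close>, which avoids the
  exponent \<open>k - 1\<close>.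
\<close>

lemma power_diff_bound:
  fixes x y a :: real
  assumes "0 \<le> x" "x \<le> a" "0 \<le> y" "y \<le> a"
  shows "a * \<bar>x ^ k - y ^ k\<bar> \<le> real k * a ^ k * \<bar>x - y\<bar>"
proof (induction k)
  case 0
  then show ?case by simp
next
  case (Suc k)
  have a: "0 \<le> a" using assms by linarith
  have yk: "y ^ k \<le> a ^ k" using assms by (intro power_mono)
  have "\<bar>x ^ Suc k - y ^ Suc k\<bar> = \<bar>x * (x ^ k - y ^ k) + y ^ k * (x - y)\<bar>"
    by (simp add: algebra_simps)
  also have "\<dots> \<le> x * \<bar>x ^ k - y ^ k\<bar> + y ^ k * \<bar>x - y\<bar>"
    using assms by (intro order_trans[OF abs_triangle_ineq]) (simp add: abs_mult)
  also have "\<dots> \<le> a * \<bar>x ^ k - y ^ k\<bar> + a ^ k * \<bar>x - y\<bar>"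
    using assms yk by (intro add_mono mult_right_mono) auto
  also have "\<dots> \<le> real k * a ^ k * \<bar>x - y\<bar> + a ^ k * \<bar>x - y\<bar>"
    using Suc by simp
  finally have "\<bar>x ^ Suc k - y ^ Suc k\<bar> \<le> real (Suc k) * a ^ k * \<bar>x - y\<bar>"
    by (simp add: algebra_simps)
  from mult_left_mono[OF this a] show ?case by (simp add: algebra_simps)
qed

text \<open>
  With \<open>z = \<mu> h\<close>, both schemes place \<open>\<xi>\<close> in the interval \<open>[1 - z, 1 / (1 + z)]\<close>, one at each end point. As
  \<open>e\<^bsup>-z\<^esup>\<close> lies in the same interval, whose length is \<open>z\<^sup>2 / (1 + z)\<close>, the schemes need not be distinguished
  any further.
\<close>

lemma em_xi_bounds:
  assumes "0 \<le> h" "sch = Forward \<Longrightarrow> sph_eigenvalue l * h \<le> 1"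
  shows "0 \<le> em_xi sch h l" "1 - sph_eigenvalue l * h \<le> em_xi sch h l"
    "em_xi sch h l \<le> 1 / (1 + sph_eigenvalue l * h)"
proof -
  define z where "z = sph_eigenvalue l * h"
  have z: "0 \<le> z" using assms by (simp add: z_def sph_eigenvalue_nonneg)
  have "1 - z \<le> 1 / (1 + z)"
    using z by (simp add: field_simps)
  then show "0 \<le> em_xi sch h l" "1 - sph_eigenvalue l * h \<le> em_xi sch h l"
    "em_xi sch h l \<le> 1 / (1 + sph_eigenvalue l * h)"
    using assms z by (cases sch; simp add: z_def[symmetric] inverse_eq_divide)+
qed

text \<open>
  The mean value bound with \<open>a = 1 / (1 + z)\<close> gives \<open>|e\<^bsup>-kz\<^esup> - \<xi>\<^sup>k| \<le> k z\<^sup>2 a\<^sup>k\<close>. Bernoulli's inequality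
  \<open>1 + k z \<le> (1 + z)\<^sup>k\<close> shows \<open>k z a\<^sup>k \<le> 1\<close>, which makes the bound uniform in the number of steps.
\<close>

lemma em_power_error:
  assumes h: "0 \<le> h" and stab: "sch = Forward \<Longrightarrow> sph_eigenvalue l * h \<le> 1"
  shows "\<bar>exp (- sph_eigenvalue l * (real k * h)) - em_xi sch h l ^ k\<bar> \<le> sph_eigenvalue l * h"
proof -
  define z where "z = sph_eigenvalue l * h"
  define a where "a = 1 / (1 + z)"
  define \<xi> where "\<xi> = em_xi sch h l"
  have z: "0 \<le> z" using h by (simp add: z_def sph_eigenvalue_nonneg)
  have a: "0 < a" using z by (simp add: a_def)
  have \<xi>: "0 \<le> \<xi>" "1 - z \<le> \<xi>" "\<xi> \<le> a"
    using em_xi_bounds[OF assms] by (simp_all add: \<xi>_def z_def a_def)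
  have e1: "1 - z \<le> exp (- z)" using exp_ge_add_one_self[of "- z"] by simp
  have e2: "exp (- z) \<le> a"
    unfolding a_def exp_minus inverse_eq_divide using exp_ge_add_one_self[of z] z
    by (intro divide_left_mono) auto
  have gap: "\<bar>exp (- z) - \<xi>\<bar> \<le> z * z * a"
  proof -
    have "a - (1 - z) = z * z * a" using z by (simp add: a_def field_simps)
    then show ?thesis using \<xi> e1 e2 by linarith
  qed
  have "a * \<bar>exp (- z) ^ k - \<xi> ^ k\<bar> \<le> real k * a ^ k * \<bar>exp (- z) - \<xi>\<bar>"
    by (rule power_diff_bound) (use \<xi> e2 in auto)
  also have "\<dots> \<le> real k * a ^ k * (z * z * a)"
    using gap a by (intro mult_left_mono) auto
  also have "\<dots> = a * (z * ((real k * z) * a ^ k))" by simp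
  also have "\<dots> \<le> a * (z * 1)"
  proof (intro mult_left_mono)
    have "1 + real k * z \<le> (1 + z) ^ k" by (rule Bernoulli_inequality) (use z in auto)
    then show "(real k * z) * a ^ k \<le> 1"
      using z by (simp add: a_def power_one_over field_simps)
  qed (use a z in auto)
  finally have "\<bar>exp (- z) ^ k - \<xi> ^ k\<bar> \<le> z" using a by simp
  moreover have "exp (- z) ^ k = exp (- sph_eigenvalue l * (real k * h))"
    by (simp add: z_def mult.commute mult.left_commute flip: exp_of_nat_mult)
  ultimately show ?thesis by (simp add: z_def \<xi>_def)
qed

text \<open>
  Both variances are \<open>1 / \<mu>\<close> times a factor: \<open>(1 - e\<^bsup>-2kz\<^esup>) / 2\<close> for the exact process, and, summing the
  geometric series, \<open>(1 - \<xi>\<^bsup>2k\<^esup>) / (2 \<plusminus> z)\<close> for the scheme (minus for the forward one). The factors differ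
  by at most \<open>z\<close>, half of it from the denominators and half from \<open>em_power_error\<close>, and \<open>z / \<mu> = h\<close>.
\<close>

lemma em_variance_error:
  assumes h: "0 \<le> h" and stab: "sch = Forward \<Longrightarrow> sph_eigenvalue l * h \<le> 1" and l: "0 < l"
  shows "\<bar>(1 - exp (- 2 * sph_eigenvalue l * (real k * h))) / (2 * sph_eigenvalue l)
      - h * (em_xi sch h l ^ em_delta sch)\<^sup>2 * (\<Sum>j<k. (em_xi sch h l)\<^sup>2 ^ j)\<bar> \<le> h"
proof (cases "h = 0")
  case False
  define \<mu> where "\<mu> = sph_eigenvalue l"
  define z where "z = \<mu> * h"
  define \<xi> where "\<xi> = em_xi sch h l"
  \<comment> \<open>The sign by which the denominators \<open>2 - z\<close> and \<open>2 + z\<close> of the two schemes differ.\<close>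
  define s where "s = (if sch = Forward then - 1 else 1 :: real)"
  have \<mu>: "0 < \<mu>" using l by (simp add: \<mu>_def sph_eigenvalue_def)
  have z: "0 < z" using False h \<mu> by (simp add: z_def)
  have z1: "sch = Forward \<Longrightarrow> z \<le> 1" using stab by (simp add: z_def \<mu>_def)
  have pos: "1 \<le> 2 + s * z" using z z1 by (cases sch) (auto simp: s_def)
  have "\<xi> \<le> 1 / (1 + z)" using em_xi_bounds(3)[OF h stab] by (simp add: \<xi>_def z_def \<mu>_def)
  also have "\<dots> \<le> 1" using z by simp
  finally have \<xi>: "0 \<le> \<xi>" "\<xi> \<le> 1"
    using em_xi_bounds(1)[OF h stab] by (simp_all add: \<xi>_def)
  have \<xi>1: "\<xi> < 1" and num: "h * (\<xi> ^ em_delta sch)\<^sup>2 / (1 - \<xi>\<^sup>2) = 1 / (\<mu> * (2 + s * z))"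
  proof -
    consider "sch = Forward" | "sch = Backward" by (cases sch)
    then have "\<xi> < 1 \<and> h * (\<xi> ^ em_delta sch)\<^sup>2 / (1 - \<xi>\<^sup>2) = 1 / (\<mu> * (2 + s * z))"
    proof cases
      case 1
      then have "\<xi> = 1 - z" by (simp add: \<xi>_def z_def \<mu>_def)
      moreover have "1 - (1 - z)\<^sup>2 = h * (\<mu> * (2 - z))" by (simp add: z_def power2_eq_square algebra_simps)
      ultimately show ?thesis using 1 z False by (simp add: s_def)
    next
      case 2
      then have x: "\<xi> = inverse (1 + z)" by (simp add: \<xi>_def z_def \<mu>_def)
      have "(1 + z)\<^sup>2 - 1 = h * (\<mu> * (2 + z))" by (simp add: z_def power2_eq_square algebra_simps)
      moreover have "(inverse (1 + z))\<^sup>2 / (1 - (inverse (1 + z))\<^sup>2) = 1 / ((1 + z)\<^sup>2 - 1)"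
        using z by (simp add: power_inverse field_simps)
      ultimately have "h * (inverse (1 + z))\<^sup>2 / (1 - (inverse (1 + z))\<^sup>2) = h / (h * (\<mu> * (2 + z)))"
        by (metis times_divide_eq_right mult.right_neutral)
      then show ?thesis using 2 z False by (simp add: s_def x inverse_less_1_iff)
    qed
    then show "\<xi> < 1" "h * (\<xi> ^ em_delta sch)\<^sup>2 / (1 - \<xi>\<^sup>2) = 1 / (\<mu> * (2 + s * z))" by auto
  qed
  define q where "q = \<xi> ^ (2 * k)"
  have q: "0 \<le> q" "q \<le> 1" using \<xi> by (auto simp: q_def intro: power_le_one)
  define e where "e = exp (- 2 * \<mu> * (real k * h))"
  have "\<xi>\<^sup>2 < 1" using \<xi> \<xi>1 by (simp add: power_less_one_iff)
  then have geo: "(\<Sum>j<k. \<xi>\<^sup>2 ^ j) = (1 - q) / (1 - \<xi>\<^sup>2)"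
    by (subst sum_gp_strict) (simp add: q_def power_mult)
  have eq: "\<bar>e - q\<bar> \<le> z"
    using em_power_error[OF h stab, where k = "2 * k"]
    by (simp add: e_def q_def z_def \<mu>_def \<xi>_def algebra_simps)
  have "h * (\<xi> ^ em_delta sch)\<^sup>2 * (\<Sum>j<k. \<xi>\<^sup>2 ^ j) = (1 - q) * (1 / (\<mu> * (2 + s * z)))"
    unfolding geo num[symmetric] by simp
  then have "(1 - e) / (2 * \<mu>) - h * (\<xi> ^ em_delta sch)\<^sup>2 * (\<Sum>j<k. \<xi>\<^sup>2 ^ j)
      = ((q - e) / 2 + (1 - q) * (1 / 2 - 1 / (2 + s * z))) / \<mu>"
    using \<mu> by (simp add: diff_divide_distrib add_divide_distrib algebra_simps)
  also have "\<bar>\<dots>\<bar> \<le> (z / 2 + 1 * (z / 2)) / \<mu>"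
  proof -
    have "\<bar>1 / 2 - 1 / (2 + s * z)\<bar> = z / (2 * (2 + s * z))"
      using pos z by (simp add: s_def field_simps)
    also have "\<dots> \<le> z / 2" using pos z by (intro divide_left_mono) auto
    finally have "\<bar>(1 - q) * (1 / 2 - 1 / (2 + s * z))\<bar> \<le> 1 * (z / 2)"
      unfolding abs_mult using q by (intro mult_mono) auto
    moreover have "\<bar>(q - e) / 2\<bar> \<le> z / 2" using eq by (simp add: abs_minus_commute)
    ultimately have "\<bar>(q - e) / 2 + (1 - q) * (1 / 2 - 1 / (2 + s * z))\<bar> \<le> z / 2 + 1 * (z / 2)"
      by (intro order_trans[OF abs_triangle_ineq] add_mono)
    then show ?thesis using \<mu> by (simp add: abs_divide divide_right_mono)
  qed
  also have "\<dots> = h" using \<mu> by (simp add: z_def)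
  finally show ?thesis by (simp add: e_def \<mu>_def \<xi>_def)
qed (simp)

lemma le_powr_of_bounded:
  fixes z c p :: real
  assumes "0 \<le> z" "z \<le> c" "0 < p" "p \<le> 1"
  shows "z \<le> max 1 c * z powr p"
proof (cases "z = 0")
  case False
  then have z: "0 < z" using assms by simp
  have "z powr (1 - p) \<le> max 1 c powr (1 - p)" using assms by (intro powr_mono2) auto
  also have "\<dots> \<le> max 1 c powr 1" using assms by (intro powr_mono) auto
  finally have "z powr (1 - p) \<le> max 1 c" by simp
  then have "z powr (1 - p) * z powr p \<le> max 1 c * z powr p"
    by (intro mult_right_mono) auto
  then show ?thesis using z by (simp flip: powr_add)
qed simp

text \<open>
  The trade-off between rate and smoothness: giving up the full rate \<open>z\<close> in favour of \<open>z\<^sup>p\<close> costs only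
  \<open>(1 + \<mu>)\<^sup>p\<close>, that is, \<open>2 p\<close> derivatives of the initial value.
\<close>

lemma power_error_rate:
  assumes h: "0 < h" and stab: "sch = Forward \<Longrightarrow> sph_eigenvalue l * h \<le> 1"
    and c: "sph_eigenvalue l * h \<le> c" and p: "0 < p" "p \<le> 1"
  shows "\<bar>exp (- sph_eigenvalue l * (real k * h)) - em_xi sch h l ^ k\<bar>
    \<le> max 1 c * h powr p * (1 + sph_eigenvalue l) powr p"
proof -
  have nn: "0 \<le> sph_eigenvalue l" by (rule sph_eigenvalue_nonneg)
  have "\<bar>exp (- sph_eigenvalue l * (real k * h)) - em_xi sch h l ^ k\<bar> \<le> sph_eigenvalue l * h"
    by (rule em_power_error) (use h stab in auto)
  also have "\<dots> \<le> max 1 c * (sph_eigenvalue l * h) powr p"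
    by (rule le_powr_of_bounded) (use nn h c p in auto)
  also have "\<dots> = max 1 c * h powr p * sph_eigenvalue l powr p"
    using nn h by (simp add: powr_mult)
  also have "\<dots> \<le> max 1 c * h powr p * (1 + sph_eigenvalue l) powr p"
    using nn p by (intro mult_left_mono powr_mono2) auto
  finally show ?thesis .
qed

text \<open>
  Comparison with the integral of \<open>x\<^bsup>-s\<^esup>\<close>: with \<open>p = 1 - s\<close>, the summand is at most a multiple of the
  increment of \<open>x\<^sup>p\<close>, by the mean value theorem if \<open>p \<le> 1\<close> and by monotonicity if \<open>p > 1\<close>.
\<close>

lemma sum_powr_le:
  fixes s :: real
  assumes "s < 1"
  shows "\<exists>K>0. \<forall>n. (\<Sum>l=1..n. real l powr (- s)) \<le> K * real n powr (1 - s)"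
proof -
  define p where "p = 1 - s"
  have p: "0 < p" using assms by (simp add: p_def)
  define K where "K = max 1 (1 / p)"
  have K: "1 \<le> K" "1 \<le> K * p" using p by (auto simp: K_def max_def field_simps)
  have step: "real (Suc n) powr (p - 1) \<le> K * (real (Suc n) powr p - real n powr p)" for n
  proof (cases "n = 0")
    case False
    show ?thesis
    proof (cases "p \<le> 1")
      case True
      have "\<exists>x::real. real n < x \<and> x < real (Suc n) \<and>
          real (Suc n) powr p - real n powr p = (real (Suc n) - real n) * (p * x powr (p - 1))"
        by (rule MVT2) (use False in \<open>auto intro!: derivative_eq_intros\<close>)
      then obtain x where x: "real n < x" "x < real (Suc n)"
        "real (Suc n) powr p - real n powr p = p * x powr (p - 1)" by auto
      have "real (Suc n) powr (p - 1) \<le> x powr (p - 1)"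
        using x True by (intro powr_mono2') auto
      also have "\<dots> \<le> (K * p) * x powr (p - 1)" using K mult_right_mono[of 1 "K * p" "x powr (p-1)"] by simp
      finally show ?thesis unfolding x(3) by (simp add: mult.assoc)
    next
      case False
      have "real n powr p = real n powr (p - 1) * real n" using \<open>n \<noteq> 0\<close> by (simp add: powr_diff)
      also have "\<dots> \<le> real (Suc n) powr (p - 1) * real n"
        using False by (intro mult_right_mono powr_mono2) auto
      also have "\<dots> = real (Suc n) powr (p - 1) * real (Suc n) - real (Suc n) powr (p - 1)"
        by (simp add: algebra_simps)
      also have "real (Suc n) powr (p - 1) * real (Suc n) = real (Suc n) powr p" by (simp add: powr_diff)
      finally have "real (Suc n) powr (p - 1) \<le> real (Suc n) powr p - real n powr p" by simp
      then have "real (Suc n) powr (p - 1) \<le> 1 * (real (Suc n) powr p - real n powr p)" by simp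
      also have "\<dots> \<le> K * (real (Suc n) powr p - real n powr p)"
        using K p by (intro mult_right_mono) (auto intro: powr_mono2)
      finally show ?thesis .
    qed
  qed (use K in auto)
  have "(\<Sum>l=1..n. real l powr (- s)) \<le> K * real n powr p" for n
  proof (induction n)
    case (Suc n)
    then show ?case using step[of n] by (simp add: p_def algebra_simps)
  qed simp
  then show ?thesis using K by (intro exI[of _ K]) (auto simp: p_def)
qed

text \<open>
  For \<open>\<alpha> < 2\<close> the sum grows like \<open>\<kappa>\<^bsup>2-\<alpha>\<^esup>\<close>, and \<open>\<kappa>\<^sup>2 \<le> c / h\<close> converts this into a negative power of \<open>h\<close>; for
  \<open>\<alpha> > 2\<close> the series converges. At \<open>\<alpha> = 2\<close> the sum is harmonic and a factor \<open>log \<kappa>\<close> would appear.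
\<close>

lemma noise_sum_rate:
  fixes \<alpha> c :: real
  assumes \<alpha>: "0 < \<alpha>" "\<alpha> \<noteq> 2" and c: "0 < c"
  shows "\<exists>K>0. \<forall>\<kappa>\<ge>1. \<forall>h>0. real \<kappa> * (real \<kappa> + 1) * h \<le> c \<longrightarrow>
    h * (\<Sum>l=1..\<kappa>. real l powr (1 - \<alpha>)) \<le> K * h powr min 1 (\<alpha> / 2)"
proof (cases "\<alpha> < 2")
  case True
  then obtain K where K: "0 < K" "\<And>n. (\<Sum>l=1..n. real l powr (- (\<alpha> - 1))) \<le> K * real n powr (1 - (\<alpha> - 1))"
    using sum_powr_le[of "\<alpha> - 1"] by auto
  define r where "r = (2 - \<alpha>) / 2"
  have r: "0 < r" using True by (simp add: r_def)
  show ?thesis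
  proof (intro exI[of _ "K * c powr r"] conjI allI impI)
    fix \<kappa> :: nat and h :: real
    assume \<kappa>: "1 \<le> \<kappa>" and h: "0 < h" and le: "real \<kappa> * (real \<kappa> + 1) * h \<le> c"
    have "real \<kappa> ^ 2 * h \<le> real \<kappa> * (real \<kappa> + 1) * h"
      using h by (simp add: power2_eq_square algebra_simps)
    then have "real \<kappa> ^ 2 \<le> c / h" using h le by (simp add: field_simps)
    then have "(real \<kappa> ^ 2) powr r \<le> (c / h) powr r" using r by (intro powr_mono2) auto
    moreover have "(real \<kappa> ^ 2) powr r = real \<kappa> powr (2 - \<alpha>)"
      using \<kappa> by (simp add: r_def powr_powr diff_divide_distrib flip: powr_numeral)
    ultimately have "real \<kappa> powr (2 - \<alpha>) \<le> (c / h) powr r" by simp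
    then have "h * (\<Sum>l=1..\<kappa>. real l powr (1 - \<alpha>)) \<le> h * (K * (c / h) powr r)"
      using K(2)[of \<kappa>] K(1) h
      by (intro mult_left_mono) (auto intro: order_trans mult_left_mono)
    also have "\<dots> = K * c powr r * (h powr 1 / h powr r)"
      using h c by (simp add: powr_divide)
    also have "h powr 1 / h powr r = h powr min 1 (\<alpha> / 2)"
      unfolding powr_diff[symmetric] using True by (simp add: r_def min_def field_simps)
    finally show "h * (\<Sum>l=1..\<kappa>. real l powr (1 - \<alpha>)) \<le> K * c powr r * h powr min 1 (\<alpha> / 2)" .
  qed (use K c in auto)
next
  case False
  then have "1 - \<alpha> < - 1" using \<alpha> by simp
  then have s: "summable (\<lambda>l. real l powr (1 - \<alpha>))" by (simp add: summable_real_powr_iff)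
  define K where "K = 1 + (\<Sum>l. real l powr (1 - \<alpha>))"
  have pos: "0 \<le> (\<Sum>l. real l powr (1 - \<alpha>))" by (intro suminf_nonneg s) auto
  show ?thesis
  proof (intro exI[of _ K] conjI allI impI)
    fix \<kappa> :: nat and h :: real
    assume h: "0 < h"
    have "(\<Sum>l=1..\<kappa>. real l powr (1 - \<alpha>)) \<le> K"
      using sum_le_suminf[OF s, of "{1..\<kappa>}"] by (simp add: K_def)
    then show "h * (\<Sum>l=1..\<kappa>. real l powr (1 - \<alpha>)) \<le> K * h powr min 1 (\<alpha> / 2)"
      using h False by (simp add: min_def mult.commute)
  qed (use pos in \<open>simp add: K_def\<close>)
qed

section \<open>Orthogonality of the associated Legendre functions\<close>

definition poly_integral :: "real poly \<Rightarrow> real" where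
  "poly_integral p = integral {-1..1} (poly p)"

lemma poly_integrable_on: "poly (p :: real poly) integrable_on {a..b}"
  by (intro integrable_continuous_real continuous_intros)

lemma poly_integral_add: "poly_integral (p + q) = poly_integral p + poly_integral q"
  unfolding poly_integral_def poly_add
  by (intro Henstock_Kurzweil_Integration.integral_add poly_integrable_on)

lemma poly_integral_smult: "poly_integral (smult c p) = c * poly_integral p"
  by (simp add: poly_integral_def poly_smult[abs_def])

lemma poly_integral_pderiv: "poly_integral (pderiv p) = poly p 1 - poly p (- 1)"
  unfolding poly_integral_def
  by (intro integral_unique fundamental_theorem_of_calculus)
    (auto intro!: derivative_eq_intros simp flip: has_real_derivative_iff_has_vector_derivative)

abbreviation parabola :: "real poly" where "parabola \<equiv> [:-1, 0, 1:]"

text \<open>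
  The boundary terms vanish as soon as \<open>x\<^sup>2 - 1\<close> divides the product.
\<close>

lemma poly_integral_by_parts:
  assumes "parabola dvd p * q"
  shows "poly_integral (pderiv p * q) = - poly_integral (p * pderiv q)"
proof -
  from assms obtain r where "p * q = parabola * r" by (elim dvdE)
  then have "poly (p * q) 1 = 0" "poly (p * q) (- 1) = 0" by (simp_all only: poly_mult) (simp_all)
  then have "poly_integral (pderiv (p * q)) = 0" by (simp only: poly_integral_pderiv)
  then show ?thesis
    by (simp add: pderiv_mult poly_integral_add algebra_simps)
qed

lemma power_dvd_pderiv:
  fixes u p :: "real poly"
  assumes "u ^ Suc n dvd p"
  shows "u ^ n dvd pderiv p"
proof -
  from assms obtain r where p: "p = u ^ Suc n * r" by (elim dvdE)
  show ?thesis unfolding p pderiv_mult pderiv_power_Suc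
    by (intro dvd_add) (auto simp: dvd_mult2 intro: dvd_mult dvd_smult)
qed

text \<open>
  A derivative lowers the multiplicity of a divisor by at most one. This is what makes all boundary
  terms in Rodrigues' formula vanish.
\<close>

lemma power_dvd_pderiv_iter:
  fixes u p :: "real poly"
  shows "u ^ (n + j) dvd p \<Longrightarrow> u ^ n dvd (pderiv ^^ j) p"
proof (induction j arbitrary: n)
  case (Suc j)
  have "u ^ Suc n dvd (pderiv ^^ j) p" by (rule Suc.IH) (use Suc.prems in simp)
  then show ?case by (simp only: funpow.simps o_apply power_dvd_pderiv)
qed simp

lemma poly_integral_by_parts_iter:
  assumes "\<And>j. j < n \<Longrightarrow> parabola dvd (pderiv ^^ (n - 1 - j)) p * (pderiv ^^ j) q"
  shows "poly_integral ((pderiv ^^ n) p * q) = (- 1) ^ n * poly_integral (p * (pderiv ^^ n) q)"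
proof -
  have "poly_integral ((pderiv ^^ n) p * q)
      = (- 1) ^ j * poly_integral ((pderiv ^^ (n - j)) p * (pderiv ^^ j) q)" if "j \<le> n" for j
    using that
  proof (induction j)
    case (Suc j)
    have eq: "(pderiv ^^ (n - j)) p = pderiv ((pderiv ^^ (n - 1 - j)) p)"
      using Suc.prems by (metis Suc_diff_Suc Suc_le_lessD diff_Suc_eq_diff_pred funpow.simps(2) o_apply)
    have "poly_integral ((pderiv ^^ (n - j)) p * (pderiv ^^ j) q)
        = - poly_integral ((pderiv ^^ (n - 1 - j)) p * pderiv ((pderiv ^^ j) q))"
      unfolding eq by (intro poly_integral_by_parts assms) (use Suc.prems in auto)
    then show ?case using Suc by simp
  qed simp
  from this[of n] show ?thesis by simp
qed

lemma degree_pderiv_iter: "degree ((pderiv ^^ n) (p :: real poly)) = degree p - n"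
  by (induction n) (auto simp: degree_pderiv)

lemma pderiv_iter_eq_0:
  assumes "degree (p :: real poly) < n"
  shows "(pderiv ^^ n) p = 0"
proof -
  obtain m where n: "n = Suc m" using assms by (cases n) auto
  have "degree ((pderiv ^^ m) p) = 0" using assms n by (simp add: degree_pderiv_iter)
  then show ?thesis by (simp add: n pderiv_eq_0_iff)
qed

lemma coeff_pderiv_iter:
  "coeff ((pderiv ^^ n) (p :: real poly)) i = fact (i + n) / fact i * coeff p (i + n)"
proof (induction n arbitrary: i)
  case (Suc n)
  have "coeff ((pderiv ^^ Suc n) p) i = real (Suc i) * (fact (Suc i + n) / fact (Suc i) * coeff p (Suc i + n))"
    using Suc[of "Suc i"] by (simp add: coeff_pderiv)
  also have "\<dots> = fact (i + Suc n) / fact i * coeff p (i + Suc n)"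
    by (simp add: divide_simps)
  finally show ?case .
qed simp

text \<open>
  Only the coefficient at \<open>n\<close> survives \<open>n\<close> derivatives, and it may itself be zero.
\<close>

lemma pderiv_iter_degree:
  assumes "degree (p :: real poly) \<le> n"
  shows "(pderiv ^^ n) p = [: fact n * coeff p n :]"
proof (rule poly_eqI)
  fix i
  show "coeff ((pderiv ^^ n) p) i = coeff [: fact n * coeff p n :] i"
    using assms by (cases i) (auto simp: coeff_pderiv_iter coeff_eq_0)
qed

lemma degree_parabola_power: "degree (parabola ^ l) = 2 * l" and
  coeff_parabola_power: "coeff (parabola ^ l) (2 * l) = 1"
proof -
  show d: "degree (parabola ^ l) = 2 * l"
    by (subst degree_power_eq) auto
  have "lead_coeff (parabola ^ l) = 1" by (subst lead_coeff_power) simp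
  then show "coeff (parabola ^ l) (2 * l) = 1" by (simp add: d)
qed

text \<open>
  Integrating \<open>w\<^bsup>l+1\<^esup>\<close> by parts against \<open>x' = 1\<close>, where \<open>w = x\<^sup>2 - 1\<close>, and using \<open>x w' = 2 (w + 1)\<close> gives the
  recursion \<open>(2 l + 3) I\<^bsub>l+1\<^esub> = - 2 (l + 1) I\<^sub>l\<close>.
\<close>

lemma poly_integral_parabola_power:
  "poly_integral (parabola ^ l) = (- 1) ^ l * 2 * (2 ^ l * fact l)\<^sup>2 / fact (2 * l + 1)"
proof (induction l)
  case 0
  have "poly_integral 1 = poly_integral (pderiv [:0, 1:])" by (simp add: pderiv_pCons one_pCons)
  then show ?case by (simp only: poly_integral_pderiv) simp
next
  case (Suc l)
  let ?w = "parabola" and ?X = "[:0, 1:] :: real poly"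
  have X: "pderiv ?X = 1" by (simp add: pderiv_pCons)
  have dw: "pderiv ?w = smult 2 ?X" by (simp add: pderiv_pCons)
  have "poly_integral (?w ^ Suc l) = poly_integral (pderiv ?X * ?w ^ Suc l)" by (simp add: X)
  also have "\<dots> = - poly_integral (?X * pderiv (?w ^ Suc l))"
    by (rule poly_integral_by_parts) (simp only: power_Suc dvd_mult dvd_triv_left)
  also have "?X * pderiv (?w ^ Suc l) = smult (2 * real (Suc l)) (?w ^ Suc l + ?w ^ l)"
  proof -
    have XX: "?X * ?X = ?w + 1" by (simp add: one_pCons)
    have "?X * pderiv (?w ^ Suc l) = smult (2 * real (Suc l)) ((?X * ?X) * ?w ^ l)"
    proof -
      have "a * (smult r b * smult 2 a) = smult (2 * r) ((a * a) * b)" for a b :: "real poly" and r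
        by (simp add: mult_ac)
      then show ?thesis unfolding pderiv_power_Suc dw .
    qed
    then show ?thesis unfolding XX by (simp only: ring_distribs mult_1_left power_Suc)
  qed
  finally have "(2 * real l + 3) * poly_integral (?w ^ Suc l) = - 2 * (real l + 1) * poly_integral (?w ^ l)"
    unfolding poly_integral_smult poly_integral_add by (simp add: algebra_simps)
  then have "poly_integral (?w ^ Suc l) = - (2 * real (Suc l)) / (2 * real l + 3) * poly_integral (?w ^ l)"
    by (simp add: field_simps)
  also have "\<dots> = (- 1) ^ Suc l * 2 * (2 ^ Suc l * fact (Suc l))\<^sup>2 / fact (2 * Suc l + 1)"
  proof -
    have f1: "(fact (2 * Suc l + 1) :: real) = (2 * real l + 3) * ((2 * real (Suc l)) * fact (2 * l + 1))"
      by (simp add: algebra_simps)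
    have f2: "(2 ^ Suc l * fact (Suc l))\<^sup>2 = (2 * real (Suc l)) * ((2 * real (Suc l)) * (2 ^ l * fact l)\<^sup>2)"
      by (simp add: power2_eq_square algebra_simps)
    have f3: "- c / d * (s * 2 * G / F) = (- 1 * s) * 2 * (c * (c * G)) / (d * (c * F))" if "c \<noteq> 0"
      for c d s G F :: real using that by simp
    show ?thesis unfolding Suc f1 f2 power_Suc[of "- 1"] by (rule f3) simp
  qed
  finally show ?case .
qed

text \<open>
  All \<open>l + m\<close> derivatives are moved from \<open>w\<^sup>l\<close> onto \<open>q = w\<^sup>m D\<^bsup>l'+m\<^esup> w\<^bsup>l'\<^esup>\<close>, a polynomial of degree \<open>l' + m\<close>.
  The result vanishes for \<open>l' < l\<close> and is a constant times the integral of \<open>w\<^sup>l\<close> for \<open>l' = l\<close>. Of the boundary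
  terms, those with fewer than \<open>m\<close> derivatives on \<open>q\<close> vanish through the factor \<open>w\<^sup>m\<close>, the others through
  \<open>w\<^sup>l\<close>, which has then lost fewer than \<open>l\<close> of its factors.
\<close>

lemma rodrigues_orthogonality:
  assumes "m \<le> l'" "l' \<le> l"
  shows "poly_integral ((pderiv ^^ (l + m)) (parabola ^ l) * (parabola ^ m * (pderiv ^^ (l' + m)) (parabola ^ l')))
    = (if l = l' then (- 1) ^ m * 2 * (2 ^ l * fact l)\<^sup>2 / (2 * real l + 1) * (fact (l + m) / fact (l - m)) else 0)"
proof -
  define q where "q = parabola ^ m * (pderiv ^^ (l' + m)) (parabola ^ l')"
  have deg: "degree q \<le> l' + m"
    using degree_mult_le[of "parabola ^ m" "(pderiv ^^ (l' + m)) (parabola ^ l')"] assms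
    by (simp add: q_def degree_parabola_power degree_pderiv_iter)
  have bd: "parabola dvd (pderiv ^^ (l + m - 1 - j)) (parabola ^ l) * (pderiv ^^ j) q" if j: "j < l + m" for j
  proof (cases "j < m")
    case True
    have "parabola ^ (1 + j) dvd parabola ^ m" by (rule le_imp_power_dvd) (use True in simp)
    then have "parabola ^ (1 + j) dvd q" unfolding q_def by (rule dvd_mult2)
    then have "parabola ^ 1 dvd (pderiv ^^ j) q" by (rule power_dvd_pderiv_iter)
    then show ?thesis by simp
  next
    case False
    have "parabola ^ (1 + (l + m - 1 - j)) dvd parabola ^ l"
      by (rule le_imp_power_dvd) (use False j in simp)
    then have "parabola ^ 1 dvd (pderiv ^^ (l + m - 1 - j)) (parabola ^ l)" by (rule power_dvd_pderiv_iter)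
    then show ?thesis by simp
  qed
  have ibp: "poly_integral ((pderiv ^^ (l + m)) (parabola ^ l) * q)
      = (- 1) ^ (l + m) * poly_integral (parabola ^ l * (pderiv ^^ (l + m)) q)"
    by (rule poly_integral_by_parts_iter) (rule bd)
  show ?thesis
  proof (cases "l = l'")
    case False
    then have "(pderiv ^^ (l + m)) q = 0" using deg assms by (intro pderiv_iter_eq_0) linarith
    then show ?thesis using False ibp poly_integral_smult[of 0 0] by (simp add: q_def)
  next
    case True
    have cq: "coeff q (l + m) = fact (2 * l) / fact (l - m)"
    proof -
      have "coeff q (2 * m + (l - m)) = coeff (parabola ^ m) (2 * m) * coeff ((pderiv ^^ (l' + m)) (parabola ^ l')) (l - m)"
        unfolding q_def using coeff_mult_degree_sum[of "parabola ^ m" "(pderiv ^^ (l' + m)) (parabola ^ l')"] assms True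
        by (simp add: degree_parabola_power degree_pderiv_iter mult_2)
      also have "\<dots> = fact (2 * l) / fact (l - m)"
        using assms True coeff_parabola_power[of l] coeff_parabola_power[of m] by (simp add: coeff_parabola_power coeff_pderiv_iter mult_2)
      finally show ?thesis using assms True by (simp add: mult_2 add.commute)
    qed
    have "(pderiv ^^ (l + m)) q = [: fact (l + m) * coeff q (l + m) :]"
      by (rule pderiv_iter_degree) (use deg True in simp)
    then have "parabola ^ l * (pderiv ^^ (l + m)) q = smult (fact (l + m) * coeff q (l + m)) (parabola ^ l)"
      by simp
    then have "poly_integral ((pderiv ^^ (l + m)) (parabola ^ l) * q)
        = (- 1) ^ (l + m) * (fact (l + m) * (fact (2 * l) / fact (l - m)) *
          ((- 1) ^ l * 2 * (2 ^ l * fact l)\<^sup>2 / fact (2 * l + 1)))"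
      by (simp add: ibp poly_integral_smult poly_integral_parabola_power cq del: fact_Suc)
    also have "\<dots> = (- 1) ^ m * 2 * (2 ^ l * fact l)\<^sup>2 / (2 * real l + 1) * (fact (l + m) / fact (l - m))"
    proof -
      have f1: "(fact (2 * l + 1) :: real) = (2 * real l + 1) * fact (2 * l)" by simp
      have f2: "(- 1) ^ (l + m) * (- 1) ^ l = ((- 1) ^ m :: real)"
        by (simp add: power_add mult.commute mult.left_commute flip: power_mult_distrib)
      have f3: "a * (b * (c / d) * (e * 2 * f / (g * c))) = (a * e) * 2 * f / g * (b / d)"
        if "c \<noteq> 0" for a b c d e f g :: real using that by (simp add: mult_ac)
      show ?thesis unfolding f1 f3[OF fact_nonzero] f2 ..
    qed
    finally show ?thesis using True by (simp add: q_def)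
  qed
qed

lemma pderiv_iter_smult: "(pderiv ^^ n) (smult c p) = smult c ((pderiv ^^ n) p)"
  by (induction n) (simp_all add: pderiv_smult)

lemma pderiv_iter_legendre:
  "(pderiv ^^ m) (legendre l) = smult (1 / (2 ^ l * fact l)) ((pderiv ^^ (l + m)) (parabola ^ l))"
  by (simp add: legendre_def pderiv_iter_smult funpow_add add.commute[of l m])

text \<open>
  The weight \<open>(1 - x\<^sup>2)\<^sup>m\<close> comes from the two factors \<open>sqrt (1 - x\<^sup>2)\<^sup>m\<close> of a product of associated Legendre
  functions of the same order.
\<close>

lemma legendre_orthogonality:
  assumes "m \<le> l" "m \<le> l'"
  shows "poly_integral ((1 - [:0, 0, 1:]) ^ m * (pderiv ^^ m) (legendre l) * (pderiv ^^ m) (legendre l'))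
    = (if l = l' then 2 / (2 * real l + 1) * (fact (l + m) / fact (l - m)) else 0)"
  using assms
proof (induction l' l rule: linorder_wlog)
  case (le l' l)
  have w: "(1 - [:0, 0, 1:]) ^ m = smult ((- 1) ^ m) (parabola ^ m)"
    unfolding smult_power[symmetric] by (simp add: one_pCons)
  define c where "c k = 1 / (2 ^ k * fact k :: real)" for k :: nat
  have "(1 - [:0, 0, 1:]) ^ m * (pderiv ^^ m) (legendre l) * (pderiv ^^ m) (legendre l')
      = smult ((- 1) ^ m * c l * c l')
         ((pderiv ^^ (l + m)) (parabola ^ l) * (parabola ^ m * (pderiv ^^ (l' + m)) (parabola ^ l')))"
    unfolding w pderiv_iter_legendre c_def[symmetric] by (simp add: mult_ac)
  then show ?case
    using le by (simp add: poly_integral_smult rodrigues_orthogonality c_def power2_eq_square)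
next
  case (sym l' l)
  then show ?case by (auto simp: mult_ac)
qed

section \<open>Orthonormality of the spherical harmonics\<close>

lemma integral_sphere_measure:
  fixes g :: "real ^ 3 \<Rightarrow> 'b::{banach, second_countable_topology}"
  assumes g: "g \<in> borel_measurable borel"
  shows "(\<integral>x. g x \<partial>sphere_measure) =
    (\<integral>p. indicator ({0..pi} \<times> {0..2 * pi}) p *\<^sub>R sin (fst p) *\<^sub>R g (spherical_coords p) \<partial>lborel)"
proof -
  let ?R = "{0..pi} \<times> {0..2 * pi} :: (real \<times> real) set"
  have R: "?R \<in> sets borel" by (simp add: borel_Times)
  have m: "spherical_coords \<in> borel_measurable (restrict_space lborel ?R)"
    by (simp add: measurable_restrict_space1)
  have g': "(\<lambda>p. g (spherical_coords p)) \<in> borel_measurable (restrict_space lborel ?R)"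
    by (rule measurable_compose[OF m g])
  have s: "(\<lambda>p. sin (fst p)) \<in> borel_measurable (restrict_space lborel ?R)"
    by (rule measurable_restrict_space1) (simp, intro borel_measurable_continuous_onI continuous_intros)
  have "(\<integral>x. g x \<partial>sphere_measure)
      = (\<integral>p. g (spherical_coords p) \<partial>density (restrict_space lborel ?R) (\<lambda>p. ennreal (sin (fst p))))"
    unfolding sphere_measure_def using m g by (subst integral_distr) (auto simp: split_beta')
  also have "\<dots> = (\<integral>p. sin (fst p) *\<^sub>R g (spherical_coords p) \<partial>restrict_space lborel ?R)"
    by (rule integral_density[OF g' s]) (auto intro!: AE_I2 sin_ge_zero simp: space_restrict_space)
  also have "\<dots> = (\<integral>p. indicator ?R p *\<^sub>R sin (fst p) *\<^sub>R g (spherical_coords p) \<partial>lborel)"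
    using R by (subst integral_restrict_space) auto
  finally show ?thesis .
qed

text \<open>
  The substitution \<open>x = cos \<theta>\<close>, carried out on an antiderivative.
\<close>

lemma integral_cos_substitution:
  "(\<integral>\<theta>. indicator {0..pi} \<theta> *\<^sub>R (sin \<theta> * poly p (cos \<theta>)) \<partial>lborel) = poly_integral p"
proof -
  define G where "G x = integral {- 1..x} (poly p)" for x
  have d: "((\<lambda>\<theta>. - G (cos \<theta>)) has_real_derivative sin \<theta> * poly p (cos \<theta>)) (at \<theta> within {0..pi})"
    if "0 \<le> \<theta>" "\<theta> \<le> pi" for \<theta>
  proof -
    have "(G has_real_derivative poly p (cos \<theta>)) (at (cos \<theta>) within {- 1..1})"
      unfolding G_def by (intro integral_has_real_derivative continuous_intros) auto
    then have "(G has_real_derivative poly p (cos \<theta>)) (at (cos \<theta>) within cos ` {0..pi})"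
      by (rule has_field_derivative_subset) auto
    then have "(G \<circ> cos has_real_derivative poly p (cos \<theta>) * - sin \<theta>) (at \<theta> within {0..pi})"
      by (rule DERIV_image_chain) (auto intro!: derivative_eq_intros)
    from DERIV_minus[OF this] show ?thesis by (simp add: o_def mult.commute)
  qed
  have "(\<integral>\<theta>. indicator {0..pi} \<theta> *\<^sub>R (sin \<theta> * poly p (cos \<theta>)) \<partial>lborel) = - G (cos pi) - (- G (cos 0))"
    by (rule integral_FTC_Icc)
      (auto intro!: continuous_intros d simp flip: has_real_derivative_iff_has_vector_derivative)
  also have "\<dots> = poly_integral p" by (simp add: G_def poly_integral_def)
  finally show ?thesis .
qed

lemma integral_cis:
  "(\<integral>\<phi>. indicator {0..2 * pi} \<phi> *\<^sub>R cis (of_int d * \<phi>) \<partial>lborel) = (if d = 0 then 2 * pi else 0)"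
proof (cases "d = 0")
  case True
  have "(\<integral>\<phi>. indicator {0..2 * pi} \<phi> *\<^sub>R (1::complex) \<partial>lborel) = of_real (2 * pi) - of_real 0"
    by (rule integral_FTC_Icc) (auto intro!: derivative_eq_intros simp: scaleR_conv_of_real has_vector_derivative_of_real)
  then show ?thesis using True by simp
next
  case False
  define G where "G z = exp (\<i> * of_int d * z) / (\<i> * of_int d)" for z :: complex
  have G: "G (of_real x) = cis (of_int d * x) / (\<i> * of_int d)" for x
    by (simp add: G_def cis_conv_exp mult.assoc)
  have "(\<integral>\<phi>. indicator {0..2 * pi} \<phi> *\<^sub>R cis (of_int d * \<phi>) \<partial>lborel) = G (of_real (2 * pi)) - G (of_real 0)"
  proof (rule integral_FTC_Icc)
    fix x :: real
    have "(G has_field_derivative exp (\<i> * of_int d * of_real x)) (at (of_real x))"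
      unfolding G_def using False by (auto intro!: derivative_eq_intros)
    moreover have "exp (\<i> * of_int d * of_real x) = cis (of_int d * x)" by (simp add: cis_conv_exp mult.assoc)
    ultimately show "((\<lambda>x. G (of_real x)) has_vector_derivative cis (of_int d * x)) (at x within {0..2 * pi})"
      by (metis has_vector_derivative_real_field)
  qed (auto intro!: continuous_intros)
  also have "cis (of_int d * (2 * pi)) = 1"
    using cis_multiple_2pi[of "of_int d"] by (simp add: mult.commute mult.left_commute)
  then have "G (of_real (2 * pi)) - G (of_real 0) = 0" unfolding G by simp
  finally show ?thesis using False by simp
qed

definition sph_norm_const :: "nat \<Rightarrow> nat \<Rightarrow> real" where
  "sph_norm_const l m = sqrt ((2 * real l + 1) / (4 * pi) * (fact (l - m) / fact (l + m)))"

text \<open>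
  Away from the poles \<open>cis (Arg (x\<^sub>1 + i x\<^sub>2))\<close> is \<open>cis \<phi>\<close>, whatever the branch of the argument,
  so that the harmonic is a function of \<open>\<theta>\<close> times a character of \<open>\<phi>\<close>.
\<close>

lemma sph_harm_spherical_coords:
  assumes "0 < \<theta>" "\<theta> < pi"
  shows "sph_harm l m (spherical_coords (\<theta>, \<phi>)) =
    of_real ((if 0 \<le> m then 1 else (- 1) ^ nat \<bar>m\<bar>) * sph_norm_const l (nat \<bar>m\<bar>) * assoc_legendre l (nat \<bar>m\<bar>) (cos \<theta>))
      * cis (of_int m * \<phi>)"
proof -
  have s: "0 < sin \<theta>" using assms by (intro sin_gt_zero) auto
  have "cis (Arg (Complex (sin \<theta> * cos \<phi>) (sin \<theta> * sin \<phi>))) = cis \<phi>"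
  proof -
    have "Complex (sin \<theta> * cos \<phi>) (sin \<theta> * sin \<phi>) = of_real (sin \<theta>) * cis \<phi>"
      by (simp add: complex_eq_iff)
    moreover have "sgn (of_real (sin \<theta>) * cis \<phi>) = cis \<phi>" using s by (simp add: sgn_mult sgn_of_real)
    moreover have "of_real (sin \<theta>) * cis \<phi> \<noteq> 0" using s by simp
    ultimately show ?thesis by (metis cis_Arg)
  qed
  then have c: "cis (real k * Arg (Complex (sin \<theta> * cos \<phi>) (sin \<theta> * sin \<phi>))) = cis (real k * \<phi>)" for k
    unfolding Complex.DeMoivre[symmetric] by simp
  have nn: "sph_harm_nonneg l k (spherical_coords (\<theta>, \<phi>)) =
      of_real (sph_norm_const l k * assoc_legendre l k (cos \<theta>)) * cis (real k * \<phi>)" for k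
    by (simp add: sph_harm_nonneg_def spherical_coords_def sph_norm_const_def c)
  show ?thesis
  proof (cases "0 \<le> m")
    case True
    then show ?thesis by (simp add: sph_harm_def nn)
  next
    case False
    then have "cnj (cis (real (nat (- m)) * \<phi>)) = cis (of_int m * \<phi>)" by (simp add: cis_cnj)
    then show ?thesis using False by (simp add: sph_harm_def nn)
  qed
qed

lemma assoc_legendre_mult:
  assumes "\<bar>\<mu>\<bar> \<le> 1"
  shows "assoc_legendre l m \<mu> * assoc_legendre l' m \<mu> =
    poly ((1 - [:0, 0, 1:]) ^ m * (pderiv ^^ m) (legendre l) * (pderiv ^^ m) (legendre l')) \<mu>"
proof -
  have "0 \<le> 1 - \<mu>\<^sup>2" using assms by (simp add: abs_square_le_1)
  then have "sqrt (1 - \<mu>\<^sup>2) ^ m * sqrt (1 - \<mu>\<^sup>2) ^ m = (1 - \<mu>\<^sup>2) ^ m"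
    by (simp flip: power_mult_distrib)
  moreover have "(- 1) ^ m * (- 1) ^ m = (1 :: real)" by (simp flip: power_mult_distrib)
  moreover have "s * r * p * (s * r * q) = (s * s) * (r * r) * p * q" for s r p q :: real by simp
  ultimately show ?thesis
    unfolding assoc_legendre_def by (simp only:) (simp add: poly_power power2_eq_square)
qed

lemma continuous_on_assoc_legendre: "continuous_on A (assoc_legendre l m)"
  unfolding assoc_legendre_def by (intro continuous_intros)

text \<open>
  The poles are excluded from the hypothesis, where the argument of \<open>x\<^sub>1 + i x\<^sub>2\<close> is arbitrary; there the
  density \<open>sin \<theta>\<close> vanishes.
\<close>

lemma integral_sphere_separated:
  fixes u :: "real \<Rightarrow> real" and v :: "real \<Rightarrow> complex"
  assumes g: "g \<in> borel_measurable borel" and u: "continuous_on {0..pi} u" and v: "continuous_on {0..2 * pi} v"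
    and eq: "\<And>\<theta> \<phi>. 0 < \<theta> \<Longrightarrow> \<theta> < pi \<Longrightarrow> g (spherical_coords (\<theta>, \<phi>)) = of_real (u \<theta>) * v \<phi>"
  shows "(\<integral>x. g x \<partial>sphere_measure) =
    of_real (\<integral>\<theta>. indicator {0..pi} \<theta> *\<^sub>R (sin \<theta> * u \<theta>) \<partial>lborel) * (\<integral>\<phi>. indicator {0..2 * pi} \<phi> *\<^sub>R v \<phi> \<partial>lborel)"
proof -
  let ?R = "{0..pi} \<times> {0..2 * pi} :: (real \<times> real) set"
  let ?f = "\<lambda>\<theta> \<phi>. complex_of_real (indicator {0..pi} \<theta> *\<^sub>R (sin \<theta> * u \<theta>)) * (indicator {0..2 * pi} \<phi> *\<^sub>R v \<phi>)"
  have "(\<lambda>p. indicator ?R p *\<^sub>R (of_real (sin (fst p) * u (fst p)) * v (snd p))) = (\<lambda>(\<theta>, \<phi>). ?f \<theta> \<phi>)"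
    by (auto simp: fun_eq_iff indicator_def)
  moreover have "integrable lborel (\<lambda>p. indicator ?R p *\<^sub>R (of_real (sin (fst p) * u (fst p)) * v (snd p)))"
  proof (rule borel_integrable_compact)
    show "compact ?R" by (intro compact_Times) auto
    show "continuous_on ?R (\<lambda>p. of_real (sin (fst p) * u (fst p)) * v (snd p))"
      by (intro continuous_intros continuous_on_compose2[OF u] continuous_on_compose2[OF v]) auto
  qed
  ultimately have int: "integrable (lborel \<Otimes>\<^sub>M lborel) (\<lambda>(\<theta>, \<phi>). ?f \<theta> \<phi>)"
    by (simp add: lborel_prod)
  have "(\<integral>x. g x \<partial>sphere_measure) = (\<integral>p. (\<lambda>(\<theta>, \<phi>). ?f \<theta> \<phi>) p \<partial>(lborel \<Otimes>\<^sub>M lborel))"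
    unfolding integral_sphere_measure[OF g] lborel_prod
  proof (intro Bochner_Integration.integral_cong refl)
    fix p :: "real \<times> real"
    obtain \<theta> \<phi> where p: "p = (\<theta>, \<phi>)" by (cases p)
    consider "\<theta> \<notin> {0..pi}" | "\<theta> = 0 \<or> \<theta> = pi" | "0 < \<theta>" "\<theta> < pi" by fastforce
    then show "indicator ?R p *\<^sub>R sin (fst p) *\<^sub>R g (spherical_coords p) = (case p of (\<theta>, \<phi>) \<Rightarrow> ?f \<theta> \<phi>)"
      unfolding p by cases (auto simp: eq scaleR_conv_of_real indicator_def)
  qed
  also have "\<dots> = (\<integral>\<theta>. (\<integral>\<phi>. ?f \<theta> \<phi> \<partial>lborel) \<partial>lborel)"
    using lborel_pair.integral_fst[OF int] by simp
  also have "\<dots> = of_real (\<integral>\<theta>. indicator {0..pi} \<theta> *\<^sub>R (sin \<theta> * u \<theta>) \<partial>lborel) * (\<integral>\<phi>. indicator {0..2 * pi} \<phi> *\<^sub>R v \<phi> \<partial>lborel)"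
    by (simp only: integral_mult_right_zero integral_mult_left_zero integral_complex_of_real)
  finally show ?thesis .
qed

text \<open>
  Different \<open>m\<close> are separated by the integral over \<open>\<phi>\<close>, and different \<open>l\<close> with equal \<open>m\<close> by the
  integral over \<open>\<theta>\<close>.
\<close>

lemma sph_harm_orthonormal:
  assumes m: "\<bar>m\<bar> \<le> int l" "\<bar>m'\<bar> \<le> int l'"
  shows "(\<integral>x. sph_harm l m x * cnj (sph_harm l' m' x) \<partial>sphere_measure) = (if l = l' \<and> m = m' then 1 else 0)"
proof -
  define \<epsilon> where "\<epsilon> m = (if 0 \<le> m then 1 else (- 1) ^ nat \<bar>m\<bar> :: real)" for m :: int
  define N where "N = \<epsilon> m * sph_norm_const l (nat \<bar>m\<bar>) * (\<epsilon> m' * sph_norm_const l' (nat \<bar>m'\<bar>))"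
  define u where "u \<theta> = assoc_legendre l (nat \<bar>m\<bar>) (cos \<theta>) * assoc_legendre l' (nat \<bar>m'\<bar>) (cos \<theta>)" for \<theta>
  have [measurable]: "(\<lambda>x. cnj (sph_harm l' m' x)) \<in> borel_measurable borel"
    by (rule measurable_compose[OF _ borel_measurable_continuous_onI]) (auto intro!: continuous_intros)
  have "(\<integral>x. sph_harm l m x * cnj (sph_harm l' m' x) \<partial>sphere_measure) =
      of_real (\<integral>\<theta>. indicator {0..pi} \<theta> *\<^sub>R (sin \<theta> * (N * u \<theta>)) \<partial>lborel) *
      (\<integral>\<phi>. indicator {0..2 * pi} \<phi> *\<^sub>R cis (of_int (m - m') * \<phi>) \<partial>lborel)"
  proof (rule integral_sphere_separated)
    show "continuous_on {0..pi} (\<lambda>\<theta>. N * u \<theta>)" unfolding u_def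
      by (intro continuous_intros continuous_on_compose2[OF continuous_on_assoc_legendre[of UNIV]]) auto
    show "sph_harm l m (spherical_coords (\<theta>, \<phi>)) * cnj (sph_harm l' m' (spherical_coords (\<theta>, \<phi>)))
      = of_real (N * u \<theta>) * cis (of_int (m - m') * \<phi>)" if "0 < \<theta>" "\<theta> < pi" for \<theta> \<phi>
    proof -
      have "cis (of_int (m - m') * \<phi>) = cis (of_int m * \<phi>) * cnj (cis (of_int m' * \<phi>))"
        by (simp add: cis_mult cis_cnj left_diff_distrib)
      then show ?thesis unfolding sph_harm_spherical_coords[OF that] \<epsilon>_def[symmetric]
        by (simp add: N_def u_def)
    qed
  qed (measurable, auto intro!: continuous_intros)
  also have "\<dots> = (if l = l' \<and> m = m' then 1 else 0)"
  proof (cases "m = m'")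
    case True
    define k where "k = nat \<bar>m\<bar>"
    have k: "k \<le> l" "k \<le> l'" using m True by (auto simp: k_def)
    have "\<epsilon> m * \<epsilon> m = 1" by (simp add: \<epsilon>_def flip: power_mult_distrib)
    then have N: "N = sph_norm_const l k * sph_norm_const l' k" using True by (simp add: N_def k_def)
    have "(\<integral>\<theta>. indicator {0..pi} \<theta> *\<^sub>R (sin \<theta> * (N * u \<theta>)) \<partial>lborel)
        = N * (\<integral>\<theta>. indicator {0..pi} \<theta> *\<^sub>R (sin \<theta> *
            poly ((1 - [:0, 0, 1:]) ^ k * (pderiv ^^ k) (legendre l) * (pderiv ^^ k) (legendre l')) (cos \<theta>)) \<partial>lborel)"
      using True by (subst integral_mult_right_zero[symmetric], intro Bochner_Integration.integral_cong)
        (simp_all only: u_def True k_def assoc_legendre_mult[OF abs_cos_le_one] scaleR_conv_of_real mult.left_commute)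
    also have "\<dots> = N * (if l = l' then 2 / (2 * real l + 1) * (fact (l + k) / fact (l - k)) else 0)"
      unfolding integral_cos_substitution legendre_orthogonality[OF k] ..
    also have "\<dots> = (if l = l' then 1 / (2 * pi) else 0)"
    proof -
      have "N = (2 * real l + 1) / (4 * pi) * (fact (l - k) / fact (l + k))" if "l = l'"
        using that unfolding N sph_norm_const_def by simp
      moreover have "g / (4 * pi) * (a / b) * (2 / g * (b / a)) = 1 / (2 * pi)"
        if "g \<noteq> 0" "a \<noteq> 0" "b \<noteq> 0" for a b g :: real using that by (simp add: field_simps)
      moreover have "2 * real l + 1 \<noteq> 0" by linarith
      ultimately show ?thesis by (cases "l = l'") (simp_all only: fact_nonzero not_False_eq_True simp_thms if_True if_False mult_zero_right)
    qed
    finally show ?thesis using True unfolding integral_cis by simp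
  next
    case False
    then show ?thesis unfolding integral_cis by simp
  qed
  finally show ?thesis .
qed

section \<open>Harmonic expansions and Sobolev norms\<close>

text \<open>
  The space \<open>complex L2_sphere\<close> is a real inner product space only. Multiplication by complex scalars
  enters through these real-linear maps \<open>c \<mapsto> c Y\<^sub>l\<^sub>m\<close>.
\<close>

definition harmonic :: "nat \<Rightarrow> int \<Rightarrow> complex \<Rightarrow> complex L2_sphere" where
  "harmonic l m c = to_L2 (\<lambda>x. c * sph_harm l m x)"

lemma sq_integrable_harmonic: "sq_integrable (\<lambda>x. c * sph_harm l m x)"
  using sq_integrable_sph_harm[of l m]
  by (auto simp: sq_integrable_def norm_mult power_mult_distrib)

lemma linear_harmonic: "linear (harmonic l m)"
proof
  fix c d :: complex and r :: real
  show "harmonic l m (c + d) = harmonic l m c + harmonic l m d"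
    unfolding harmonic_def by (subst to_L2_add[symmetric]) (auto intro: sq_integrable_harmonic simp: distrib_right)
  show "harmonic l m (r *\<^sub>R c) = r *\<^sub>R harmonic l m c"
    unfolding harmonic_def by (subst to_L2_scaleR[symmetric]) (auto intro: sq_integrable_harmonic)
qed

lemma bounded_linear_harmonic: "bounded_linear (harmonic l m)"
  by (rule linear_conv_bounded_linear[THEN iffD1, OF linear_harmonic])

lemma integrable_sph_harm_mult:
  fixes f :: "real ^ 3 \<Rightarrow> complex"
  assumes "sq_integrable f"
  shows "integrable sphere_measure (\<lambda>x. f x * cnj (sph_harm l m x))"
proof -
  have [measurable]: "(\<lambda>x. cnj (sph_harm l m x)) \<in> borel_measurable borel"
    by (rule measurable_compose[OF _ borel_measurable_continuous_onI]) (auto intro!: continuous_intros)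
  have [measurable]: "f \<in> borel_measurable borel" using assms by (simp add: sq_integrable_def)
  show ?thesis
  proof (rule Bochner_Integration.integrable_bound)
    show "integrable sphere_measure (\<lambda>x. (cmod (f x))\<^sup>2 + (cmod (sph_harm l m x))\<^sup>2)"
      using assms sq_integrable_sph_harm[of l m] by (auto simp: sq_integrable_def)
    have "cmod (f x) * cmod (sph_harm l m x) \<le> (cmod (f x))\<^sup>2 + (cmod (sph_harm l m x))\<^sup>2" for x
      using sum_squares_bound[of "cmod (f x)" "cmod (sph_harm l m x)"]
        mult_nonneg_nonneg[OF norm_ge_zero[of "f x"] norm_ge_zero[of "sph_harm l m x"]] by linarith
    then show "AE x in sphere_measure. norm (f x * cnj (sph_harm l m x))
        \<le> norm ((cmod (f x))\<^sup>2 + (cmod (sph_harm l m x))\<^sup>2)"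
      by (intro AE_I2) (simp add: norm_mult)
  qed simp
qed

lemma sph_coeff_to_L2:
  "sq_integrable f \<Longrightarrow> sph_coeff (to_L2 f) l m = (\<integral>x. f x * cnj (sph_harm l m x) \<partial>sphere_measure)"
  by transfer simp

text \<open>
  The real inner product is the real part of the Hermitian one.
\<close>

lemma inner_harmonic: "harmonic l m c \<bullet> f = Re (c * cnj (sph_coeff f l m))"
proof -
  obtain g where g: "sq_integrable g" "to_L2 g = f" by (rule to_L2_cases)
  have int: "integrable sphere_measure (\<lambda>x. cnj c * (g x * cnj (sph_harm l m x)))"
    by (intro integrable_mult_right integrable_sph_harm_mult g)
  have "harmonic l m c \<bullet> f = (\<integral>x. Re (cnj c * (g x * cnj (sph_harm l m x))) \<partial>sphere_measure)"
    unfolding harmonic_def g(2)[symmetric] inner_to_L2[OF sq_integrable_harmonic g(1)]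
    by (intro Bochner_Integration.integral_cong refl) (simp add: inner_complex_def algebra_simps)
  also have "\<dots> = Re (cnj c * sph_coeff f l m)"
    unfolding g(2)[symmetric] sph_coeff_to_L2[OF g(1)] using integral_Re[OF int] by simp
  also have "\<dots> = Re (c * cnj (sph_coeff f l m))" by simp
  finally show ?thesis .
qed

text \<open>
  Real and imaginary part of a Fourier coefficient are real inner products, from which continuity and
  linearity of the coefficient functionals follow at once.
\<close>

lemma sph_coeff_eq_inner: "sph_coeff f l m = Complex (harmonic l m 1 \<bullet> f) (harmonic l m \<i> \<bullet> f)"
  by (simp add: inner_harmonic complex_eq_iff)

lemma bounded_linear_sph_coeff: "bounded_linear (\<lambda>f. sph_coeff f l m)"
  unfolding sph_coeff_eq_inner Complex_eq
  by (intro bounded_linear_intros bounded_linear_add bounded_linear_const_mult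
      bounded_linear_compose[OF bounded_linear_of_real] bounded_linear_inner_right)

lemma sph_coeff_harmonic:
  assumes "\<bar>m\<bar> \<le> int l" "\<bar>m'\<bar> \<le> int l'"
  shows "sph_coeff (harmonic l m c) l' m' = (if l = l' \<and> m = m' then c else 0)"
  unfolding harmonic_def sph_coeff_to_L2[OF sq_integrable_harmonic]
  using sph_harm_orthonormal[OF assms] by (simp add: mult.assoc)

definition harmonic_indices :: "nat set \<Rightarrow> (nat \<times> int) set" where
  "harmonic_indices L = (SIGMA l:L. {- int l..int l})"

lemma finite_harmonic_indices: "finite L \<Longrightarrow> finite (harmonic_indices L)"
  by (simp add: harmonic_indices_def)

lemma sum_harmonic_indices:
  "finite L \<Longrightarrow> (\<Sum>(l, m)\<in>harmonic_indices L. f l m) = (\<Sum>l\<in>L. \<Sum>m\<in>{- int l..int l}. f l m)"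
  by (simp add: harmonic_indices_def sum.Sigma)

definition harmonic_sum :: "nat set \<Rightarrow> (nat \<Rightarrow> int \<Rightarrow> complex) \<Rightarrow> complex L2_sphere" where
  "harmonic_sum L c = (\<Sum>(l, m)\<in>harmonic_indices L. harmonic l m (c l m))"

lemma sph_coeff_harmonic_sum:
  assumes "finite L" "\<bar>m\<bar> \<le> int l"
  shows "sph_coeff (harmonic_sum L c) l m = (if l \<in> L then c l m else 0)"
proof -
  have "sph_coeff (harmonic_sum L c) l m
      = (\<Sum>(l', m')\<in>harmonic_indices L. sph_coeff (harmonic l' m' (c l' m')) l m)"
    unfolding harmonic_sum_def
    by (subst linear_sum[OF bounded_linear.linear[OF bounded_linear_sph_coeff]]) (simp add: split_beta')
  also have "\<dots> = (\<Sum>p\<in>harmonic_indices L. if p = (l, m) then c l m else 0)"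
    by (intro sum.cong refl) (use assms in \<open>auto simp: harmonic_indices_def sph_coeff_harmonic split: if_splits\<close>)
  also have "\<dots> = (if l \<in> L then c l m else 0)"
    using assms by (simp add: finite_harmonic_indices) (auto simp: harmonic_indices_def split: if_splits)
  finally show ?thesis .
qed

lemma inner_harmonic_sum:
  assumes "finite L"
  shows "harmonic_sum L c \<bullet> f = (\<Sum>l\<in>L. \<Sum>m\<in>{- int l..int l}. Re (c l m * cnj (sph_coeff f l m)))"
  unfolding harmonic_sum_def inner_sum_left sum_harmonic_indices[OF assms, symmetric]
  by (intro sum.cong refl) (simp add: split_beta' inner_harmonic)

lemma norm_harmonic_sum:
  assumes "finite L"
  shows "(norm (harmonic_sum L c))\<^sup>2 = (\<Sum>l\<in>L. \<Sum>m\<in>{- int l..int l}. (cmod (c l m))\<^sup>2)"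
proof -
  have "Re (z * cnj z) = (cmod z)\<^sup>2" for z by (simp add: cmod_power2) (simp add: power2_eq_square)
  then show ?thesis
    unfolding power2_norm_eq_inner[of "harmonic_sum L c"] inner_harmonic_sum[OF assms]
    by (intro sum.cong refl) (subst sph_coeff_harmonic_sum[OF assms], auto)
qed

lemma bessel_inequality:
  assumes L: "finite L"
  shows "(\<Sum>l\<in>L. \<Sum>m\<in>{- int l..int l}. (cmod (sph_coeff f l m))\<^sup>2) \<le> (norm f)\<^sup>2"
proof -
  define g where "g = harmonic_sum L (sph_coeff f)"
  have "g \<bullet> f = (norm g)\<^sup>2"
    unfolding g_def inner_harmonic_sum[OF L] norm_harmonic_sum[OF L]
    by (intro sum.cong refl) (simp add: complex_mult_cnj cmod_power2)
  moreover have "0 \<le> (norm (f - g))\<^sup>2" by simp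
  ultimately have "(norm g)\<^sup>2 \<le> (norm f)\<^sup>2"
    by (simp add: power2_norm_eq_inner inner_diff_left inner_diff_right inner_commute[of f g])
  then show ?thesis by (simp add: g_def norm_harmonic_sum[OF L])
qed

lemma sum_harmonic_sum:
  "finite L \<Longrightarrow> (\<Sum>l\<in>L. harmonic_sum {l} c) = harmonic_sum L c"
  by (simp add: harmonic_sum_def sum_harmonic_indices)

lemma harmonic_sum_diff: "harmonic_sum L c - harmonic_sum L d = harmonic_sum L (\<lambda>l m. c l m - d l m)"
  unfolding harmonic_sum_def sum_subtractf[symmetric]
  by (intro sum.cong refl) (auto simp: linear_diff[OF linear_harmonic])

text \<open>
  The blocks of different degree \<open>l\<close> are orthogonal, so that their sum converges in \<open>L\<^sup>2\<close> as soon as the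
  squared norms of the blocks are summable, and the coefficients can be read off the limit.
\<close>

lemma harmonic_series:
  assumes b: "\<And>N. (\<Sum>l<N. \<Sum>m\<in>{- int l..int l}. (cmod (c l m))\<^sup>2) \<le> B"
  shows "summable (\<lambda>l. harmonic_sum {l} c)"
    and "\<bar>m\<bar> \<le> int l \<Longrightarrow> sph_coeff (\<Sum>l. harmonic_sum {l} c) l m = c l m"
    and "(\<Sum>l<N. \<Sum>m\<in>{- int l..int l}. (cmod (c l m))\<^sup>2) \<le> (norm (\<Sum>l. harmonic_sum {l} c))\<^sup>2"
proof -
  let ?b = "\<lambda>l. \<Sum>m\<in>{- int l..int l}. (cmod (c l m))\<^sup>2"
  have sb: "summable ?b"
    by (rule summableI_nonneg_bounded[of _ B]) (auto intro: sum_nonneg b)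
  show sm: "summable (\<lambda>l. harmonic_sum {l} c)"
    unfolding summable_Cauchy
  proof (intro allI impI)
    fix e :: real assume e: "e > 0"
    then obtain N where N: "\<And>m n. m \<ge> N \<Longrightarrow> norm (sum ?b {m..<n}) < e\<^sup>2"
      using sb[unfolded summable_Cauchy, rule_format, of "e\<^sup>2"] by auto
    have "norm (\<Sum>l=m..<n. harmonic_sum {l} c) < e" if "m \<ge> N" for m n
    proof -
      have "(norm (\<Sum>l=m..<n. harmonic_sum {l} c))\<^sup>2 < e\<^sup>2"
        using N[OF that, of n] by (simp add: sum_harmonic_sum norm_harmonic_sum)
      then show ?thesis using e by (simp add: power_less_imp_less_base)
    qed
    then show "\<exists>N. \<forall>m\<ge>N. \<forall>n. norm (\<Sum>l=m..<n. harmonic_sum {l} c) < e" by blast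
  qed
  show co: "sph_coeff (\<Sum>l. harmonic_sum {l} c) l m = c l m" if "\<bar>m\<bar> \<le> int l" for l m
  proof -
    have "(\<lambda>l'. sph_coeff (harmonic_sum {l'} c) l m) sums sph_coeff (\<Sum>l. harmonic_sum {l} c) l m"
      by (rule bounded_linear.sums[OF bounded_linear_sph_coeff summable_sums[OF sm]])
    moreover have "(\<lambda>l'. sph_coeff (harmonic_sum {l'} c) l m) = (\<lambda>l'. if l' = l then c l' m else 0)"
      using that by (auto simp: fun_eq_iff sph_coeff_harmonic_sum)
    ultimately show ?thesis using sums_single[of l "\<lambda>l'. c l' m"] sums_unique2 by metis
  qed
  have "(\<Sum>l<N. ?b l) = (\<Sum>l<N. \<Sum>m\<in>{- int l..int l}. (cmod (sph_coeff (\<Sum>l. harmonic_sum {l} c) l m))\<^sup>2)"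
    by (intro sum.cong refl) (auto simp: co)
  also have "\<dots> \<le> (norm (\<Sum>l. harmonic_sum {l} c))\<^sup>2" by (rule bessel_inequality) simp
  finally show "(\<Sum>l<N. ?b l) \<le> (norm (\<Sum>l. harmonic_sum {l} c))\<^sup>2" .
qed

lemma to_L2_harmonic_sum:
  assumes "finite L"
  shows "to_L2 (\<lambda>x. \<Sum>l\<in>L. \<Sum>m\<in>{- int l..int l}. c l m * sph_harm l m x) = harmonic_sum L c"
  unfolding harmonic_sum_def sum_harmonic_indices[OF assms] harmonic_def
  by (subst to_L2_sum, intro sq_integrable_sum sq_integrable_harmonic)
    (intro sum.cong refl to_L2_sum sq_integrable_harmonic)

lemma bessel_op_eq_series:
  "bessel_op s f = (\<Sum>l. harmonic_sum {l} (\<lambda>l m. of_real ((1 + sph_eigenvalue l) powr (s / 2)) * sph_coeff f l m))"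
  unfolding bessel_op_def lb_calculus_def
  using to_L2_harmonic_sum[of "{l}" "\<lambda>l m. of_real ((1 + sph_eigenvalue l) powr (s / 2)) * sph_coeff f l m" for l]
  by simp

text \<open>
  The contribution of the degree \<open>l\<close> to the squared norm in \<open>H\<^sup>s\<close>.
\<close>

definition sobolev_density :: "real \<Rightarrow> real L2_sphere \<Rightarrow> nat \<Rightarrow> real" where
  "sobolev_density s f l =
    (\<Sum>m\<in>{- int l..int l}. (1 + sph_eigenvalue l) powr s * (cmod (sph_coeff (cplx_L2 f) l m))\<^sup>2)"

lemma cmod_bessel_coeff:
  "(cmod (of_real ((1 + sph_eigenvalue l) powr (s / 2)) * z))\<^sup>2 = (1 + sph_eigenvalue l) powr s * (cmod z)\<^sup>2"
  by (simp add: norm_mult power_mult_distrib power2_eq_square flip: powr_add)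

text \<open>
  The boundedness hypothesis is what guarantees convergence of the series defining the Sobolev norm;
  the conclusion then replaces an arbitrary bound by the norm itself.
\<close>

lemma sobolev_density_le_norm:
  assumes "\<And>N. (\<Sum>l<N. sobolev_density s f l) \<le> B"
  shows "(\<Sum>l<N. sobolev_density s f l) \<le> (sobolev_norm s f)\<^sup>2"
  using harmonic_series(3)[where c = "\<lambda>l m. of_real ((1 + sph_eigenvalue l) powr (s / 2)) * sph_coeff (cplx_L2 f) l m"]
    assms unfolding sobolev_density_def cmod_bessel_coeff[symmetric] sobolev_norm_def bessel_op_eq_series by blast

text \<open>
  If \<open>f = (Id - \<Delta>)\<^bsup>-s/2\<^esup> g\<close>, then the Sobolev densities of \<open>f\<close> are the squared coefficients of \<open>g\<close>, to
  which Bessel's inequality applies.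
\<close>

lemma sobolev_space_density_le_norm:
  assumes f: "f \<in> sobolev_space s" and s: "0 \<le> s"
  shows "(\<Sum>l<N. sobolev_density s f l) \<le> (sobolev_norm s f)\<^sup>2"
proof -
  obtain g where g: "cplx_L2 f = bessel_op (- s) (cplx_L2 g)" using f by (auto simp: sobolev_space_def)
  let ?g = "sph_coeff (cplx_L2 g)"
  let ?c = "\<lambda>l m. of_real ((1 + sph_eigenvalue l) powr (- s / 2)) * ?g l m"
  have ev: "1 \<le> 1 + sph_eigenvalue l" for l by (simp add: sph_eigenvalue_def)
  have bess: "(\<Sum>l<N. \<Sum>m\<in>{- int l..int l}. (cmod (?g l m))\<^sup>2) \<le> (norm (cplx_L2 g))\<^sup>2" for N
    by (rule bessel_inequality) simp
  have "(\<Sum>l<N. \<Sum>m\<in>{- int l..int l}. (cmod (?c l m))\<^sup>2) \<le> (norm (cplx_L2 g))\<^sup>2" for N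
  proof (rule order_trans[OF sum_mono[OF sum_mono] bess])
    fix l m
    have "(1 + sph_eigenvalue l) powr - s \<le> 1"
      using powr_mono[of "- s" 0 "1 + sph_eigenvalue l"] ev[of l] s by simp
    then show "(cmod (?c l m))\<^sup>2 \<le> (cmod (?g l m))\<^sup>2"
      unfolding cmod_bessel_coeff by (intro mult_left_le_one_le) auto
  qed
  from harmonic_series(2)[OF this]
  have coeff: "sph_coeff (cplx_L2 f) l m = ?c l m" if "\<bar>m\<bar> \<le> int l" for l m
    using that unfolding g bessel_op_eq_series by simp
  have "sobolev_density s f l = (\<Sum>m\<in>{- int l..int l}. (cmod (?g l m))\<^sup>2)" for l
    unfolding sobolev_density_def
  proof (intro sum.cong refl)
    fix m assume "m \<in> {- int l..int l}"
    then have c: "sph_coeff (cplx_L2 f) l m = ?c l m" by (intro coeff) auto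
    have "1 + sph_eigenvalue l \<noteq> 0" using ev[of l] by linarith
    then show "(1 + sph_eigenvalue l) powr s * (cmod (sph_coeff (cplx_L2 f) l m))\<^sup>2 = (cmod (?g l m))\<^sup>2"
      unfolding c cmod_bessel_coeff by (simp add: powr_minus)
  qed
  then have "(\<Sum>l<N. sobolev_density s f l) \<le> (norm (cplx_L2 g))\<^sup>2" for N using bess by simp
  then show ?thesis by (rule sobolev_density_le_norm)
qed

lemma bounded_linear_cplx_L2: "bounded_linear cplx_L2"
proof (rule bounded_linear_intro[where K = 1])
  fix f g :: "real L2_sphere" and r :: real
  have of_real: "sq_integrable (\<lambda>x. complex_of_real (f x))" if "sq_integrable f" for f
    using that by (auto simp: sq_integrable_def intro!: borel_measurable_of_real)
  show "cplx_L2 (f + g) = cplx_L2 f + cplx_L2 g"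
    by transfer (auto intro!: of_real sq_integrable_add simp flip: of_real_add)
  show "cplx_L2 (r *\<^sub>R f) = r *\<^sub>R cplx_L2 f"
    by transfer (auto intro!: of_real sq_integrable_scaleR[where 'a = real, simplified] simp: scaleR_conv_of_real simp flip: of_real_mult)
  have "cplx_L2 f \<bullet> cplx_L2 f = f \<bullet> f"
    by transfer (simp add: inner_complex_def)
  then show "norm (cplx_L2 f) \<le> norm f * 1" by (simp add: norm_eq_sqrt_inner)
qed

text \<open>
  Real-valued functions have Hermitian coefficients.
\<close>

lemma sph_coeff_cplx_minus:
  assumes "0 \<le> m"
  shows "sph_coeff (cplx_L2 f) l (- m) = (- 1) ^ nat m * cnj (sph_coeff (cplx_L2 f) l m)"
proof -
  have Y: "sph_harm l (- m) x = (- 1) ^ nat m * cnj (sph_harm l m x)" for x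
    using assms by (cases "m = 0") (auto simp: sph_harm_def sph_harm_nonneg_def)
  show ?thesis
  proof (transfer fixing: l m)
    fix f :: "real ^ 3 \<Rightarrow> real"
    have "(\<integral>x. complex_of_real (f x) * cnj (sph_harm l (- m) x) \<partial>sphere_measure)
        = (\<integral>x. (- 1) ^ nat m * cnj (complex_of_real (f x) * cnj (sph_harm l m x)) \<partial>sphere_measure)"
      by (intro Bochner_Integration.integral_cong refl) (simp add: Y)
    also have "\<dots> = (- 1) ^ nat m * (\<integral>x. cnj (complex_of_real (f x) * cnj (sph_harm l m x)) \<partial>sphere_measure)"
      by (rule integral_mult_right_zero)
    also have "(\<integral>x. cnj (complex_of_real (f x) * cnj (sph_harm l m x)) \<partial>sphere_measure)
        = cnj (\<integral>x. complex_of_real (f x) * cnj (sph_harm l m x) \<partial>sphere_measure)"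
      by (rule Bochner_Integration.integral_cnj)
    finally show "(\<integral>x. complex_of_real (f x) * cnj (sph_harm l (- m) x) \<partial>sphere_measure)
        = (- 1) ^ nat m * cnj (\<integral>x. complex_of_real (f x) * cnj (sph_harm l m x) \<partial>sphere_measure)" .
  qed
qed

section \<open>Square-integrable complex functions\<close>

definition square_integrable :: "'a measure \<Rightarrow> ('a \<Rightarrow> complex) \<Rightarrow> bool" where
  "square_integrable N u \<longleftrightarrow> u \<in> borel_measurable N \<and> integrable N (\<lambda>x. (cmod (u x))\<^sup>2)"

lemma square_integrable_measurable: "square_integrable N u \<Longrightarrow> u \<in> borel_measurable N"
  by (simp add: square_integrable_def)

lemma borel_measurable_cnj:
  "u \<in> borel_measurable N \<Longrightarrow> (\<lambda>x. cnj (u x)) \<in> borel_measurable N"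
  by (rule measurable_compose[OF _ borel_measurable_continuous_onI]) (auto intro!: continuous_intros)

lemma square_integrable_cmult:
  "square_integrable N u \<Longrightarrow> square_integrable N (\<lambda>x. c * u x)"
  by (auto simp: square_integrable_def norm_mult power_mult_distrib)

lemma square_integrable_cnj: "square_integrable N u \<Longrightarrow> square_integrable N (\<lambda>x. cnj (u x))"
  by (auto simp: square_integrable_def borel_measurable_cnj)

lemma integrable_mult_cnj:
  assumes "square_integrable N u" "square_integrable N v"
  shows "integrable N (\<lambda>x. u x * cnj (v x))"
proof (rule Bochner_Integration.integrable_bound)
  show "integrable N (\<lambda>x. (cmod (u x))\<^sup>2 + (cmod (v x))\<^sup>2)"
    using assms by (auto simp: square_integrable_def)
  have "cmod (u x) * cmod (v x) \<le> (cmod (u x))\<^sup>2 + (cmod (v x))\<^sup>2" for x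
    using sum_squares_bound[of "cmod (u x)" "cmod (v x)"]
      mult_nonneg_nonneg[OF norm_ge_zero[of "u x"] norm_ge_zero[of "v x"]] by linarith
  then show "AE x in N. norm (u x * cnj (v x)) \<le> norm ((cmod (u x))\<^sup>2 + (cmod (v x))\<^sup>2)"
    by (intro AE_I2) (simp add: norm_mult)
  show "(\<lambda>x. u x * cnj (v x)) \<in> borel_measurable N"
    using assms by (intro borel_measurable_times borel_measurable_cnj) (auto simp: square_integrable_def)
qed

lemma cmod_add_squared: "(cmod (z + w))\<^sup>2 = (cmod z)\<^sup>2 + (cmod w)\<^sup>2 + 2 * Re (z * cnj w)"
  unfolding cmod_power2 by (simp add: power2_eq_square algebra_simps)

lemma
  assumes u: "square_integrable N u" and v: "square_integrable N v"
  shows square_integrable_add: "square_integrable N (\<lambda>x. u x + v x)"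
    and integral_cmod_add_squared: "(\<integral>x. (cmod (u x + v x))\<^sup>2 \<partial>N) =
      (\<integral>x. (cmod (u x))\<^sup>2 \<partial>N) + (\<integral>x. (cmod (v x))\<^sup>2 \<partial>N) + 2 * Re (\<integral>x. u x * cnj (v x) \<partial>N)"
proof -
  have int: "integrable N (\<lambda>x. (cmod (u x))\<^sup>2)" "integrable N (\<lambda>x. (cmod (v x))\<^sup>2)"
    using u v by (auto simp: square_integrable_def)
  note uv = integrable_mult_cnj[OF u v]
  then have re: "integrable N (\<lambda>x. Re (u x * cnj (v x)))" by (rule integrable_Re)
  show "square_integrable N (\<lambda>x. u x + v x)"
    unfolding square_integrable_def cmod_add_squared
    using u v int re by (auto simp: square_integrable_def simp del: times_complex.sel)
  show "(\<integral>x. (cmod (u x + v x))\<^sup>2 \<partial>N) =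
      (\<integral>x. (cmod (u x))\<^sup>2 \<partial>N) + (\<integral>x. (cmod (v x))\<^sup>2 \<partial>N) + 2 * Re (\<integral>x. u x * cnj (v x) \<partial>N)"
    unfolding cmod_add_squared integral_Re[OF uv, symmetric]
    using int re by (simp del: times_complex.sel)
qed

lemma square_integrable_diff:
  "square_integrable N u \<Longrightarrow> square_integrable N v \<Longrightarrow> square_integrable N (\<lambda>x. u x - v x)"
  using square_integrable_add[of N u "\<lambda>x. - 1 * v x"] square_integrable_cmult[of N v "- 1"] by simp

lemma square_integrable_zero: "square_integrable N (\<lambda>x. 0)"
  by (simp add: square_integrable_def)

lemma nn_integral_square:
  "square_integrable N u \<Longrightarrow> (\<integral>\<^sup>+x. ennreal ((cmod (u x))\<^sup>2) \<partial>N) = ennreal (\<integral>x. (cmod (u x))\<^sup>2 \<partial>N)"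
  by (rule nn_integral_eq_integral) (auto simp: square_integrable_def)

lemma cauchy_schwarz_integral:
  assumes u: "square_integrable N u" and v: "square_integrable N v"
  shows "cmod (\<integral>x. u x * cnj (v x) \<partial>N) \<le> sqrt (\<integral>x. (cmod (u x))\<^sup>2 \<partial>N) * sqrt (\<integral>x. (cmod (v x))\<^sup>2 \<partial>N)"
proof -
  let ?U = "\<integral>x. (cmod (u x))\<^sup>2 \<partial>N" and ?V = "\<integral>x. (cmod (v x))\<^sup>2 \<partial>N"
  let ?I = "\<integral>x. cmod (u x * cnj (v x)) \<partial>N"
  have [measurable]: "u \<in> borel_measurable N" "v \<in> borel_measurable N"
    using u v by (auto simp: square_integrable_def)
  have I: "0 \<le> ?I" by simp
  have "ennreal (?I\<^sup>2) = (ennreal ?I)\<^sup>2" by (rule ennreal_power[OF I, symmetric])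
  also have "ennreal ?I = (\<integral>\<^sup>+x. ennreal (cmod (u x)) * ennreal (cmod (v x)) \<partial>N)"
    using integrable_norm[OF integrable_mult_cnj[OF u v]]
    by (subst nn_integral_eq_integral[symmetric]) (auto simp: norm_mult ennreal_mult)
  also have "\<dots>\<^sup>2 \<le> (\<integral>\<^sup>+x. (ennreal (cmod (u x)))\<^sup>2 \<partial>N) * (\<integral>\<^sup>+x. (ennreal (cmod (v x)))\<^sup>2 \<partial>N)"
    by (rule Cauchy_Schwarz_nn_integral) auto
  also have "\<dots> = ennreal (?U * ?V)"
    by (simp add: ennreal_power nn_integral_square[OF u] nn_integral_square[OF v] ennreal_mult)
  finally have "?I\<^sup>2 \<le> ?U * ?V" by simp
  then have "?I \<le> sqrt ?U * sqrt ?V" by (simp add: real_le_rsqrt flip: real_sqrt_mult)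
  then show ?thesis using integral_norm_bound[of N "\<lambda>x. u x * cnj (v x)"] by linarith
qed

lemma
  assumes u: "\<And>k. square_integrable N (u k)" and v: "square_integrable N v"
    and lim: "(\<lambda>k. \<integral>\<^sup>+x. ennreal ((cmod (u k x - v x))\<^sup>2) \<partial>N) \<longlonglongrightarrow> 0"
  shows tendsto_integral_mult_cnj:
      "square_integrable N w \<Longrightarrow> (\<lambda>k. \<integral>x. w x * cnj (u k x) \<partial>N) \<longlonglongrightarrow> (\<integral>x. w x * cnj (v x) \<partial>N)"
    and tendsto_integral_cmod_squared:
      "(\<lambda>k. \<integral>x. (cmod (u k x))\<^sup>2 \<partial>N) \<longlonglongrightarrow> (\<integral>x. (cmod (v x))\<^sup>2 \<partial>N)"
proof -
  let ?d = "\<lambda>k. \<integral>x. (cmod (u k x - v x))\<^sup>2 \<partial>N"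
  note d = square_integrable_diff[OF u v]
  have d0: "?d \<longlonglongrightarrow> 0"
    using lim unfolding nn_integral_square[OF d] ennreal_0[symmetric] by (subst (asm) tendsto_ennreal_iff) auto
  have cross: "(\<lambda>k. \<integral>x. w x * cnj (u k x - v x) \<partial>N) \<longlonglongrightarrow> 0" if w: "square_integrable N w" for w
  proof (rule Lim_null_comparison)
    show "\<forall>\<^sub>F k in sequentially. norm (\<integral>x. w x * cnj (u k x - v x) \<partial>N)
        \<le> sqrt (\<integral>x. (cmod (w x))\<^sup>2 \<partial>N) * sqrt (?d k)"
      by (intro always_eventually allI cauchy_schwarz_integral w d)
    have "(\<lambda>k. sqrt (\<integral>x. (cmod (w x))\<^sup>2 \<partial>N) * sqrt (?d k)) \<longlonglongrightarrow> sqrt (\<integral>x. (cmod (w x))\<^sup>2 \<partial>N) * sqrt 0"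
      by (intro tendsto_intros d0)
    then show "(\<lambda>k. sqrt (\<integral>x. (cmod (w x))\<^sup>2 \<partial>N) * sqrt (?d k)) \<longlonglongrightarrow> 0" by simp
  qed
  show "(\<lambda>k. \<integral>x. w x * cnj (u k x) \<partial>N) \<longlonglongrightarrow> (\<integral>x. w x * cnj (v x) \<partial>N)" if w: "square_integrable N w"
  proof (rule LIM_zero_cancel)
    have "(\<integral>x. w x * cnj (u k x) \<partial>N) - (\<integral>x. w x * cnj (v x) \<partial>N) = (\<integral>x. w x * cnj (u k x - v x) \<partial>N)" for k
      by (subst Bochner_Integration.integral_diff[symmetric]) (auto intro!: integrable_mult_cnj w u v simp: algebra_simps)
    then show "(\<lambda>k. (\<integral>x. w x * cnj (u k x) \<partial>N) - (\<integral>x. w x * cnj (v x) \<partial>N)) \<longlonglongrightarrow> 0"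
      using cross[OF w] by simp
  qed
  have "(\<integral>x. (cmod (u k x))\<^sup>2 \<partial>N)
      = (\<integral>x. (cmod (v x))\<^sup>2 \<partial>N) + ?d k + 2 * Re (\<integral>x. v x * cnj (u k x - v x) \<partial>N)" for k
    using integral_cmod_add_squared[OF v d[of k]] by simp
  moreover have "(\<lambda>k. (\<integral>x. (cmod (v x))\<^sup>2 \<partial>N) + ?d k + 2 * Re (\<integral>x. v x * cnj (u k x - v x) \<partial>N))
      \<longlonglongrightarrow> (\<integral>x. (cmod (v x))\<^sup>2 \<partial>N) + 0 + 2 * Re 0"
    by (intro tendsto_intros d0 cross v)
  ultimately show "(\<lambda>k. \<integral>x. (cmod (u k x))\<^sup>2 \<partial>N) \<longlonglongrightarrow> (\<integral>x. (cmod (v x))\<^sup>2 \<partial>N)" by simp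
qed

lemma (in prob_space) square_integrable_const: "square_integrable M (\<lambda>x. c)"
  by (simp add: square_integrable_def)

lemma (in prob_space) square_integrable_imp_integrable:
  assumes "square_integrable M u"
  shows "integrable M u"
  using integrable_mult_cnj[OF assms square_integrable_const[of 1]] by simp

text \<open>
  A Riesz--Fischer theorem for sequences whose increments decay geometrically. On a probability space the
  \<open>L\<^sup>2\<close>-norm dominates the \<open>L\<^sup>1\<close>-norm, so that the series of increments converges absolutely almost surely;
  Fatou's lemma then turns the almost sure limit into a limit in \<open>L\<^sup>2\<close>.
\<close>

lemma (in prob_space) geometric_L2_limit:
  assumes u: "\<And>k. square_integrable M (u k)"
    and step: "\<And>k. (\<integral>x. (cmod (u (Suc k) x - u k x))\<^sup>2 \<partial>M) \<le> (c * (1 / 2) ^ k)\<^sup>2" and c: "0 \<le> c"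
  shows "\<exists>v. square_integrable M v \<and> (\<lambda>k. \<integral>\<^sup>+x. ennreal ((cmod (u k x - v x))\<^sup>2) \<partial>M) \<longlonglongrightarrow> 0"
proof -
  define g where "g k x = u (Suc k) x - u k x" for k x
  have g: "square_integrable M (g k)" for k unfolding g_def by (intro square_integrable_diff u)
  have [measurable]: "u k \<in> borel_measurable M" for k using u by (simp add: square_integrable_def)
  have [measurable]: "g k \<in> borel_measurable M" for k using g by (simp add: square_integrable_def)
  define L2 where "L2 f = sqrt (\<integral>x. (cmod (f x))\<^sup>2 \<partial>M)" for f :: "'a \<Rightarrow> complex"
  have tri: "L2 (\<lambda>x. f x + h x) \<le> L2 f + L2 h" if "square_integrable M f" "square_integrable M h" for f h
  proof -
    have "(\<integral>x. (cmod (f x + h x))\<^sup>2 \<partial>M) \<le> (L2 f)\<^sup>2 + (L2 h)\<^sup>2 + 2 * (L2 f * L2 h)"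
      unfolding integral_cmod_add_squared[OF that]
      using cauchy_schwarz_integral[OF that] complex_Re_le_cmod[of "\<integral>x. f x * cnj (h x) \<partial>M"]
      by (simp add: L2_def)
    also have "\<dots> = (L2 f + L2 h)\<^sup>2" by (simp add: power2_eq_square algebra_simps)
    finally show ?thesis unfolding L2_def[of "\<lambda>x. f x + h x"] by (rule real_le_lsqrt[rotated]) (simp add: L2_def)
  qed
  have L2g: "L2 (g k) \<le> c * (1 / 2) ^ k" for k
    unfolding L2_def g_def by (rule real_le_lsqrt[OF _ step]) (use c in simp)
  have L1: "(\<integral>\<^sup>+x. ennreal (cmod (g k x)) \<partial>M) \<le> ennreal (c * (1 / 2) ^ k)" for k
  proof -
    have "integrable M (\<lambda>x. cmod (g k x))"
      by (intro integrable_norm square_integrable_imp_integrable g)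
    moreover have "square_integrable M (\<lambda>x. of_real (cmod (g k x)))"
      using g by (auto simp: square_integrable_def)
    from cauchy_schwarz_integral[OF this square_integrable_const[of 1]]
    have "(\<integral>x. cmod (g k x) \<partial>M) \<le> L2 (g k)"
      by (simp add: L2_def prob_space)
    ultimately show ?thesis using L2g[of k]
      by (subst nn_integral_eq_integral) (auto intro: ennreal_leI)
  qed
  have "(\<integral>\<^sup>+x. (\<Sum>k. ennreal (cmod (g k x))) \<partial>M) = (\<Sum>k. \<integral>\<^sup>+x. ennreal (cmod (g k x)) \<partial>M)"
    by (rule nn_integral_suminf) simp
  also have "\<dots> \<le> (\<Sum>k. ennreal (c * (1 / 2) ^ k))" by (intro suminf_le L1) auto
  also have "\<dots> < \<infinity>" using c by (subst suminf_ennreal2) (auto intro!: summable_mult)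
  finally have "AE x in M. (\<Sum>k. ennreal (cmod (g k x))) \<noteq> \<infinity>" by (intro nn_integral_PInf_AE) auto
  then have conv: "AE x in M. (\<lambda>k. u k x) \<longlonglongrightarrow> lim (\<lambda>k. u k x)"
  proof eventually_elim
    case (elim x)
    then have "summable (\<lambda>k. cmod (g k x))" by (intro summable_suminf_not_top) auto
    then have "summable (\<lambda>k. g k x)" by (rule summable_norm_cancel)
    then have "convergent (\<lambda>n. (u n x - u 0 x) + u 0 x)"
      unfolding summable_iff_convergent g_def sum_lessThan_telescope[of "\<lambda>k. u k x"]
      by (intro convergent_add convergent_const)
    then show ?case by (simp add: convergent_LIMSEQ_iff)
  qed
  define v where "v x = lim (\<lambda>k. u k x)" for x
  have [measurable]: "v \<in> borel_measurable M" unfolding v_def by (rule borel_measurable_lim_metric) simp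
  have tail: "L2 (\<lambda>x. u (k + n) x - u k x) \<le> 2 * c * (1 / 2) ^ k" for k n
  proof -
    have "L2 (\<lambda>x. u (k + n) x - u k x) \<le> 2 * c * (1 / 2) ^ k * (1 - (1 / 2) ^ n)"
    proof (induction n)
      case 0
      then show ?case by (simp add: L2_def)
    next
      case (Suc n)
      have "L2 (\<lambda>x. (u (k + n) x - u k x) + g (k + n) x) \<le> L2 (\<lambda>x. u (k + n) x - u k x) + L2 (g (k + n))"
        by (intro tri square_integrable_diff u g)
      also have "\<dots> \<le> 2 * c * (1 / 2) ^ k * (1 - (1 / 2) ^ n) + c * (1 / 2) ^ (k + n)"
        by (intro add_mono Suc L2g)
      also have "\<dots> = 2 * c * (1 / 2) ^ k * (1 - (1 / 2) ^ Suc n)" by (simp add: power_add algebra_simps)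
      finally show ?case by (simp add: g_def)
    qed
    also have "\<dots> \<le> 2 * c * (1 / 2) ^ k * 1" using c by (intro mult_left_mono) auto
    finally show ?thesis by simp
  qed
  have dist: "(\<integral>\<^sup>+x. ennreal ((cmod (v x - u k x))\<^sup>2) \<partial>M) \<le> ennreal ((2 * c * (1 / 2) ^ k)\<^sup>2)" for k
  proof -
    have "AE x in M. ennreal ((cmod (v x - u k x))\<^sup>2) = liminf (\<lambda>n. ennreal ((cmod (u (k + n) x - u k x))\<^sup>2))"
      using conv
    proof eventually_elim
      case (elim x)
      then have "(\<lambda>n. u (k + n) x) \<longlonglongrightarrow> v x"
        unfolding v_def by (subst add.commute) (rule LIMSEQ_ignore_initial_segment)
      then have "(\<lambda>n. ennreal ((cmod (u (k + n) x - u k x))\<^sup>2)) \<longlonglongrightarrow> ennreal ((cmod (v x - u k x))\<^sup>2)"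
        by (intro tendsto_intros)
      then show ?case by (rule lim_imp_Liminf[OF trivial_limit_sequentially, symmetric])
    qed
    then have "(\<integral>\<^sup>+x. ennreal ((cmod (v x - u k x))\<^sup>2) \<partial>M) =
        (\<integral>\<^sup>+x. liminf (\<lambda>n. ennreal ((cmod (u (k + n) x - u k x))\<^sup>2)) \<partial>M)"
      by (rule nn_integral_cong_AE)
    also have "\<dots> \<le> liminf (\<lambda>n. \<integral>\<^sup>+x. ennreal ((cmod (u (k + n) x - u k x))\<^sup>2) \<partial>M)"
      by (rule nn_integral_liminf) simp
    also have "\<dots> \<le> liminf (\<lambda>n. ennreal ((2 * c * (1 / 2) ^ k)\<^sup>2))"
    proof (intro Liminf_mono always_eventually allI)
      fix n
      have "(L2 (\<lambda>x. u (k + n) x - u k x))\<^sup>2 \<le> (2 * c * (1 / 2) ^ k)\<^sup>2"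
        by (intro power_mono tail) (simp add: L2_def)
      then show "(\<integral>\<^sup>+x. ennreal ((cmod (u (k + n) x - u k x))\<^sup>2) \<partial>M) \<le> ennreal ((2 * c * (1 / 2) ^ k)\<^sup>2)"
        unfolding nn_integral_square[OF square_integrable_diff[OF u u]] by (simp add: L2_def ennreal_leI)
    qed
    finally show ?thesis by (simp add: Liminf_const)
  qed
  have "square_integrable M (\<lambda>x. v x - u 0 x)"
    unfolding square_integrable_def
    by (intro conjI integrableI_bounded) (auto intro: le_less_trans[OF dist])
  from square_integrable_add[OF this u[of 0]] have "square_integrable M v" by simp
  moreover have "(\<lambda>k. \<integral>\<^sup>+x. ennreal ((cmod (u k x - v x))\<^sup>2) \<partial>M) \<longlonglongrightarrow> 0"
  proof (rule tendsto_sandwich[OF _ _ tendsto_const])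
    show "\<forall>\<^sub>F k in sequentially. (\<integral>\<^sup>+x. ennreal ((cmod (u k x - v x))\<^sup>2) \<partial>M) \<le> ennreal ((2 * c * (1 / 2) ^ k)\<^sup>2)"
      using dist by (intro always_eventually allI) (simp add: norm_minus_commute)
    have "(\<lambda>k. ennreal ((2 * c * (1 / 2) ^ k)\<^sup>2)) \<longlonglongrightarrow> ennreal ((2 * c * 0)\<^sup>2)"
      by (intro tendsto_intros LIMSEQ_power_zero) simp
    then show "(\<lambda>k. ennreal ((2 * c * (1 / 2) ^ k)\<^sup>2)) \<longlonglongrightarrow> 0" by simp
  qed simp
  ultimately show ?thesis by blast
qed

section \<open>Noise with orthogonal increments\<close>

locale filtered_prob_space = prob_space M for M :: "'w measure" +
  fixes F :: "real \<Rightarrow> 'w measure"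
  assumes filtration_subalgebra: "0 \<le> t \<Longrightarrow> subalgebra M (F t)"
    and filtration_mono: "0 \<le> s \<Longrightarrow> s \<le> t \<Longrightarrow> sets (F s) \<subseteq> sets (F t)"
begin

text \<open>
  The second-order structure of a driving process: its increments have second moment \<open>a\<close> times the elapsed time
  and are orthogonal to all square-integrable functions of the past.
\<close>

definition orthogonal_noise :: "real \<Rightarrow> (real \<Rightarrow> 'w \<Rightarrow> complex) \<Rightarrow> bool" where
  "orthogonal_noise a Z \<longleftrightarrow> (\<forall>t\<ge>0. Z t \<in> borel_measurable (F t)) \<and>
    (\<forall>s\<ge>0. \<forall>t\<ge>s. square_integrable M (\<lambda>\<omega>. Z t \<omega> - Z s \<omega>) \<and>
      (\<integral>\<omega>. (cmod (Z t \<omega> - Z s \<omega>))\<^sup>2 \<partial>M) = a * (t - s) \<and>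
      (\<forall>V. V \<in> borel_measurable (F s) \<longrightarrow> square_integrable M V \<longrightarrow>
        (\<integral>\<omega>. V \<omega> * cnj (Z t \<omega> - Z s \<omega>) \<partial>M) = 0))"

lemma orthogonal_noiseD:
  assumes "orthogonal_noise a Z"
  shows "0 \<le> t \<Longrightarrow> Z t \<in> borel_measurable (F t)"
    and "0 \<le> s \<Longrightarrow> s \<le> t \<Longrightarrow> square_integrable M (\<lambda>\<omega>. Z t \<omega> - Z s \<omega>)"
    and "0 \<le> s \<Longrightarrow> s \<le> t \<Longrightarrow> (\<integral>\<omega>. (cmod (Z t \<omega> - Z s \<omega>))\<^sup>2 \<partial>M) = a * (t - s)"
    and "0 \<le> s \<Longrightarrow> s \<le> t \<Longrightarrow> V \<in> borel_measurable (F s) \<Longrightarrow> square_integrable M V \<Longrightarrow>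
      (\<integral>\<omega>. V \<omega> * cnj (Z t \<omega> - Z s \<omega>) \<partial>M) = 0"
  using assms unfolding orthogonal_noise_def by blast+

lemma measurable_filtration_mono:
  assumes "0 \<le> s" "s \<le> t" "f \<in> borel_measurable (F s)"
  shows "f \<in> borel_measurable (F t)"
proof -
  have "subalgebra (F t) (F s)"
    using filtration_subalgebra[of s] filtration_subalgebra[of t] filtration_mono[of s t] assms
    by (auto simp: subalgebra_def)
  then show ?thesis using assms(3) by (rule measurable_from_subalg)
qed

lemma measurable_filtration: "0 \<le> t \<Longrightarrow> f \<in> borel_measurable (F t) \<Longrightarrow> f \<in> borel_measurable M"
  using filtration_subalgebra by (rule measurable_from_subalg)

text \<open>
  The second moment of the increment is that of its normal distribution. Independence of the past gives
  \<open>E (V (B\<^sub>t - B\<^sub>s)) = E V \<cdot> E (B\<^sub>t - B\<^sub>s)\<close>, and the last factor is zero.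
\<close>

lemma brownian_increment:
  assumes B: "brownian_motion M F B" and s: "0 \<le> s" "s \<le> t"
  shows "integrable M (\<lambda>\<omega>. (B t \<omega> - B s \<omega>)\<^sup>2)" "(\<integral>\<omega>. (B t \<omega> - B s \<omega>)\<^sup>2 \<partial>M) = t - s"
    and "V \<in> borel_measurable (F s) \<Longrightarrow> square_integrable M V \<Longrightarrow>
      (\<integral>\<omega>. V \<omega> * complex_of_real (B t \<omega> - B s \<omega>) \<partial>M) = 0"
proof -
  let ?D = "\<lambda>\<omega>. B t \<omega> - B s \<omega>"
  have "integrable M (\<lambda>\<omega>. (?D \<omega>)\<^sup>2) \<and> (\<integral>\<omega>. (?D \<omega>)\<^sup>2 \<partial>M) = t - s \<and>
    (V \<in> borel_measurable (F s) \<longrightarrow> square_integrable M V \<longrightarrow> (\<integral>\<omega>. V \<omega> * complex_of_real (?D \<omega>) \<partial>M) = 0)"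
  proof (cases "s = t")
    case False
    then have st: "s < t" using s by simp
    define \<sigma> where "\<sigma> = sqrt (t - s)"
    have \<sigma>: "0 < \<sigma>" "\<sigma>\<^sup>2 = t - s" using st by (auto simp: \<sigma>_def)
    have dist: "distributed M lborel ?D (normal_density 0 \<sigma>)"
      and indep: "indep_set (sets (F s)) {?D -` U \<inter> space M |U. U \<in> sets borel}"
      using B s st by (auto simp: brownian_motion_def \<sigma>_def)
    have D: "?D \<in> borel_measurable M" using dist by (simp add: distributed_def)
    have m2: "has_bochner_integral lborel (\<lambda>x. normal_density 0 \<sigma> x * x\<^sup>2) (t - s)"
      using normal_moment_even[OF \<sigma>(1), of 0 1] \<sigma> by (simp add: fact_numeral diff_divide_distrib)
    have m1: "has_bochner_integral lborel (\<lambda>x. normal_density 0 \<sigma> x * x) 0"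
      using normal_moment_odd[OF \<sigma>(1), of 0 0] by simp
    have sq: "integrable M (\<lambda>\<omega>. (?D \<omega>)\<^sup>2)" "(\<integral>\<omega>. (?D \<omega>)\<^sup>2 \<partial>M) = t - s"
      using distributed_integrable[OF dist, of "\<lambda>x. x\<^sup>2"] distributed_integral[OF dist, of "\<lambda>x. x\<^sup>2"] m2
      by (auto simp: has_bochner_integral_iff)
    have lin: "integrable M ?D" "(\<integral>\<omega>. ?D \<omega> \<partial>M) = 0"
      using distributed_integrable[OF dist, of "\<lambda>x. x"] distributed_integral[OF dist, of "\<lambda>x. x"] m1
      by (auto simp: has_bochner_integral_iff)
    have "(\<integral>\<omega>. V \<omega> * complex_of_real (?D \<omega>) \<partial>M) = 0"
      if V: "V \<in> borel_measurable (F s)" and V2: "square_integrable M V"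
    proof -
      have sp: "space (F s) = space M" using filtration_subalgebra[OF s(1)] by (simp add: subalgebra_def)
      \<comment> \<open>Preimages of Borel sets form a sigma-algebra already.\<close>
      have vim: "sigma_sets (space M) {X -` U \<inter> space M |U. U \<in> sets borel} = {X -` U \<inter> space M |U. U \<in> sets borel}"
        for X :: "'w \<Rightarrow> 'b::topological_space"
        using sets.sigma_sets_eq[of "vimage_algebra (space M) X borel"]
        by (simp add: sets_vimage_algebra2)
      have D': "(\<lambda>\<omega>. complex_of_real (?D \<omega>)) \<in> borel_measurable M" using D by measurable
      have "{V -` U \<inter> space M |U. U \<in> sets borel} \<subseteq> sets (F s)"
        using measurable_sets[OF V] by (auto simp: sp)
      moreover have "{(\<lambda>\<omega>. complex_of_real (?D \<omega>)) -` U \<inter> space M |U. U \<in> sets borel}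
          \<subseteq> {?D -` U \<inter> space M |U. U \<in> sets borel}"
      proof safe
        fix U :: "complex set" assume "U \<in> sets borel"
        then have "complex_of_real -` U \<in> sets borel"
          using measurable_sets[of complex_of_real borel borel U] by simp
        then show "\<exists>U'. (\<lambda>\<omega>. complex_of_real (?D \<omega>)) -` U \<inter> space M = ?D -` U' \<inter> space M \<and> U' \<in> sets borel"
          by (intro exI[of _ "complex_of_real -` U"]) auto
      qed
      ultimately have "indep_var borel V borel (\<lambda>\<omega>. complex_of_real (?D \<omega>))"
        unfolding indep_var_eq vim using indep D' square_integrable_measurable[OF V2]
        unfolding indep_sets2_eq by (meson subset_eq)
      then have "(\<integral>\<omega>. V \<omega> * complex_of_real (?D \<omega>) \<partial>M) = (\<integral>\<omega>. V \<omega> \<partial>M) * (\<integral>\<omega>. complex_of_real (?D \<omega>) \<partial>M)"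
        by (rule indep_var_lebesgue_integral) (use square_integrable_imp_integrable[OF V2] lin in \<open>auto simp del: of_real_diff\<close>)
      also have "(\<integral>\<omega>. complex_of_real (?D \<omega>) \<partial>M) = 0"
        unfolding integral_complex_of_real lin by simp
      finally show ?thesis by simp
    qed
    then show ?thesis using sq by blast
  qed simp
  then show "integrable M (\<lambda>\<omega>. (?D \<omega>)\<^sup>2)" "(\<integral>\<omega>. (?D \<omega>)\<^sup>2 \<partial>M) = t - s"
    and "V \<in> borel_measurable (F s) \<Longrightarrow> square_integrable M V \<Longrightarrow>
      (\<integral>\<omega>. V \<omega> * complex_of_real (?D \<omega>) \<partial>M) = 0" by auto
qed

text \<open>
  If \<open>c\<^sub>1\<close> and \<open>c\<^sub>2\<close> are perpendicular as vectors in the plane, then \<open>|c\<^sub>1 x + c\<^sub>2 y|\<^sup>2 = |c\<^sub>1|\<^sup>2 x\<^sup>2 + |c\<^sub>2|\<^sup>2 y\<^sup>2\<close> for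
  all real \<open>x\<close> and \<open>y\<close>. The mixed moments of the two Brownian motions therefore cancel pathwise.
\<close>

lemma orthogonal_noise_brownian:
  assumes B: "brownian_motion M F B1" "brownian_motion M F B2" and orth: "Re (c1 * cnj c2) = 0"
  shows "orthogonal_noise ((cmod c1)\<^sup>2 + (cmod c2)\<^sup>2)
    (\<lambda>t \<omega>. c1 * complex_of_real (B1 t \<omega>) + c2 * complex_of_real (B2 t \<omega>))"
  unfolding orthogonal_noise_def
proof (intro conjI allI impI)
  fix t :: real assume "0 \<le> t"
  then have [measurable]: "B1 t \<in> borel_measurable (F t)" "B2 t \<in> borel_measurable (F t)"
    using B by (auto simp: brownian_motion_def)
  show "(\<lambda>\<omega>. c1 * complex_of_real (B1 t \<omega>) + c2 * complex_of_real (B2 t \<omega>)) \<in> borel_measurable (F t)"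
    by measurable
next
  fix s t :: real assume st: "0 \<le> s" "s \<le> t"
  let ?D1 = "\<lambda>\<omega>. B1 t \<omega> - B1 s \<omega>" and ?D2 = "\<lambda>\<omega>. B2 t \<omega> - B2 s \<omega>"
  let ?D = "\<lambda>\<omega>. c1 * complex_of_real (B1 t \<omega>) + c2 * complex_of_real (B2 t \<omega>) -
      (c1 * complex_of_real (B1 s \<omega>) + c2 * complex_of_real (B2 s \<omega>))"
  have D_eq: "?D \<omega> = c1 * complex_of_real (?D1 \<omega>) + c2 * complex_of_real (?D2 \<omega>)" for \<omega>
    by (simp add: algebra_simps)
  have meas: "B i \<in> borel_measurable M" if "i \<in> {s, t}" "brownian_motion M F B" for B i
    using that st by (intro measurable_filtration[of i]) (auto simp: brownian_motion_def)
  have [measurable]: "B1 s \<in> borel_measurable M" "B1 t \<in> borel_measurable M"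
      "B2 s \<in> borel_measurable M" "B2 t \<in> borel_measurable M"
    using meas B by auto
  note inc1 = brownian_increment[OF B(1) st] and inc2 = brownian_increment[OF B(2) st]
  have sq1: "square_integrable M (\<lambda>\<omega>. complex_of_real (?D1 \<omega>))"
    and sq2: "square_integrable M (\<lambda>\<omega>. complex_of_real (?D2 \<omega>))"
    using inc1(1) inc2(1) by (auto simp: square_integrable_def simp flip: of_real_diff)
  show "square_integrable M ?D"
    unfolding D_eq by (intro square_integrable_add square_integrable_cmult sq1 sq2)
  have pyth: "(cmod (?D \<omega>))\<^sup>2 = (cmod c1)\<^sup>2 * (?D1 \<omega>)\<^sup>2 + (cmod c2)\<^sup>2 * (?D2 \<omega>)\<^sup>2" for \<omega>
  proof -
    have "c1 * of_real (?D1 \<omega>) * cnj (c2 * of_real (?D2 \<omega>)) = of_real (?D1 \<omega> * ?D2 \<omega>) * (c1 * cnj c2)"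
      by simp
    moreover have "Re (of_real r * z) = r * Re z" for r z by simp
    ultimately have "Re (c1 * of_real (?D1 \<omega>) * cnj (c2 * of_real (?D2 \<omega>))) = 0"
      using orth by (metis mult_zero_right)
    then show ?thesis unfolding D_eq cmod_add_squared
      by (simp add: norm_mult power_mult_distrib del: of_real_diff)
  qed
  show "(\<integral>\<omega>. (cmod (?D \<omega>))\<^sup>2 \<partial>M) = ((cmod c1)\<^sup>2 + (cmod c2)\<^sup>2) * (t - s)"
    unfolding pyth by (simp add: inc1(1,2) inc2(1,2) distrib_right)
  fix V :: "'w \<Rightarrow> complex" assume V: "V \<in> borel_measurable (F s)" and V2: "square_integrable M V"
  have int: "integrable M (\<lambda>\<omega>. cnj c1 * (V \<omega> * of_real (?D1 \<omega>)))" "integrable M (\<lambda>\<omega>. cnj c2 * (V \<omega> * of_real (?D2 \<omega>)))"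
    using integrable_mult_cnj[OF V2 sq1] integrable_mult_cnj[OF V2 sq2]
    by (auto intro!: integrable_mult_right)
  have "(\<integral>\<omega>. V \<omega> * cnj (?D \<omega>) \<partial>M)
      = (\<integral>\<omega>. cnj c1 * (V \<omega> * of_real (?D1 \<omega>)) + cnj c2 * (V \<omega> * of_real (?D2 \<omega>)) \<partial>M)"
    unfolding D_eq by (intro Bochner_Integration.integral_cong refl) (simp add: algebra_simps)
  also have "\<dots> = 0"
    unfolding Bochner_Integration.integral_add[OF int] integral_mult_right_zero inc1(3)[OF V V2] inc2(3)[OF V V2] by simp
  finally show "(\<integral>\<omega>. V \<omega> * cnj (?D \<omega>) \<partial>M) = 0" .
qed

text \<open>
  The coefficient \<open>a\<^sub>l\<^sub>m\<close> is \<open>c\<^sub>1 \<beta>\<^sup>1 + c\<^sub>2 \<beta>\<^sup>2\<close> with \<open>c\<^sub>1\<close> real and \<open>c\<^sub>2\<close> imaginary, whatever the sign of \<open>m\<close>, and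
  \<open>|c\<^sub>1|\<^sup>2 + |c\<^sub>2|\<^sup>2 = A\<^sub>l\<close>.
\<close>

lemma orthogonal_noise_coeff:
  assumes \<beta>: "independent_brownian_motions M F \<beta>" and A: "0 \<le> A l" and m: "\<bar>m\<bar> \<le> int l"
  shows "orthogonal_noise (A l) (noise_coeff A \<beta> l m)"
proof -
  define k where "k = nat \<bar>m\<bar>"
  have k: "k \<le> l" using m by (simp add: k_def)
  have B: "brownian_motion M F (\<beta> j l k)" if "(j, l, k) \<in> noise_indices" for j
    using \<beta> that unfolding independent_brownian_motions_def by blast
  have B1: "brownian_motion M F (\<beta> 1 l k)"
    using k by (intro B) (auto simp: noise_indices_def)
  show ?thesis
  proof (cases "m = 0")
    case True
    have "noise_coeff A \<beta> l m = (\<lambda>t \<omega>. complex_of_real (sqrt (A l)) * complex_of_real (\<beta> 1 l k t \<omega>)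
        + 0 * complex_of_real (\<beta> 1 l k t \<omega>))"
      using True by (simp add: fun_eq_iff noise_coeff_def noise_coeff_nonneg_def k_def)
    then show ?thesis
      using orthogonal_noise_brownian[OF B1 B1, of "complex_of_real (sqrt (A l))" 0] A by simp
  next
    case False
    then have B2: "brownian_motion M F (\<beta> 2 l k)"
      using k by (intro B) (auto simp: noise_indices_def k_def)
    define \<sigma> where "\<sigma> = (if 0 \<le> m then 1 else (- 1) ^ k :: real)"
    define \<tau> where "\<tau> = (if 0 \<le> m then 1 else - 1 :: real)"
    define c1 where "c1 = complex_of_real (\<sigma> * sqrt (A l / 2))"
    define c2 where "c2 = complex_of_real (\<tau> * \<sigma> * sqrt (A l / 2)) * \<i>"
    have "noise_coeff A \<beta> l m t \<omega> = c1 * complex_of_real (\<beta> 1 l k t \<omega>) + c2 * complex_of_real (\<beta> 2 l k t \<omega>)" for t \<omega>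
    proof (cases "0 \<le> m")
      case True
      then show ?thesis using \<open>m \<noteq> 0\<close>
        by (simp add: noise_coeff_def noise_coeff_nonneg_def k_def c1_def c2_def \<sigma>_def \<tau>_def Complex_eq algebra_simps)
    next
      case False
      then show ?thesis
        by (simp add: noise_coeff_def noise_coeff_nonneg_def k_def c1_def c2_def \<sigma>_def \<tau>_def Complex_eq algebra_simps)
    qed
    then have eq: "noise_coeff A \<beta> l m = (\<lambda>t \<omega>. c1 * complex_of_real (\<beta> 1 l k t \<omega>) + c2 * complex_of_real (\<beta> 2 l k t \<omega>))"
      by (simp add: fun_eq_iff)
    have "\<bar>\<sigma>\<bar> = 1" "\<bar>\<tau>\<bar> = 1" by (auto simp: \<sigma>_def \<tau>_def power_abs)
    then have "(cmod c1)\<^sup>2 + (cmod c2)\<^sup>2 = A l"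
      using A by (simp add: c1_def c2_def norm_mult power_mult_distrib abs_mult del: of_real_mult)
    moreover have "Re (c1 * cnj c2) = 0" by (simp add: c1_def c2_def)
    ultimately show ?thesis unfolding eq using orthogonal_noise_brownian[OF B1 B2, of c1 c2] by simp
  qed
qed

end

lemma complete_filtered_imp_filtered_prob_space:
  "complete_filtered_prob_space M F \<Longrightarrow> filtered_prob_space M F"
  by (intro filtered_prob_space.intro filtered_prob_space_axioms.intro)
    (auto simp: complete_filtered_prob_space_def)

section \<open>Wiener integrals\<close>

lemma partition_mono:
  fixes p :: "nat \<Rightarrow> real"
  assumes "\<forall>i<n. p i \<le> p (Suc i)" "i \<le> j" "j \<le> n"
  shows "p i \<le> p j"
  using assms(2,3)
proof (induction j rule: dec_induct)
  case (step j)
  then show ?case using assms(1) by (meson Suc_le_lessD less_imp_le_nat order_trans)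
qed simp

lemma step_fun_outside:
  assumes "\<forall>i<n. p i \<le> p (Suc i)" "s \<le> p 0 \<or> p n < s"
  shows "step_fun p c n s = 0"
  unfolding step_fun_def
proof (intro sum.neutral ballI)
  fix i assume "i \<in> {..<n}"
  then have "p 0 \<le> p i" "p (Suc i) \<le> p n" by (auto intro!: partition_mono[OF assms(1)])
  then show "c i * indicator {p i<..p (Suc i)} s = 0" using assms(2) by (auto simp: indicator_def)
qed

lemma step_fun_Suc:
  "step_fun p c (Suc n) s = step_fun p c n s + c n * indicator {p n<..p (Suc n)} s"
  by (simp add: step_fun_def)

lemma step_fun_squared:
  assumes "\<forall>i<n. p i \<le> p (Suc i)"
  shows "(step_fun p c n s)\<^sup>2 = (\<Sum>i<n. (c i)\<^sup>2 * indicator {p i<..p (Suc i)} s)"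
  using assms
proof (induction n)
  case (Suc n)
  have "step_fun p c n s * indicator {p n<..p (Suc n)} s = 0"
    using Suc.prems step_fun_outside[of n p s c] by (auto simp: indicator_def)
  then have "(step_fun p c (Suc n) s)\<^sup>2 = (step_fun p c n s)\<^sup>2 + (c n)\<^sup>2 * indicator {p n<..p (Suc n)} s"
    unfolding step_fun_Suc by (auto simp: indicator_def)
  then show ?case using Suc by simp
qed (simp add: step_fun_def)

lemma step_fun_eq:
  assumes "\<forall>i<n. p i \<le> p (Suc i)" "i < n" "p i < s" "s \<le> p (Suc i)"
  shows "step_fun p c n s = c i"
proof -
  have "step_fun p c n s = (\<Sum>j<n. if j = i then c i else 0)"
    unfolding step_fun_def
  proof (intro sum.cong refl)
    fix j assume "j \<in> {..<n}"
    then have "j < i \<Longrightarrow> p (Suc j) \<le> p i" "i < j \<Longrightarrow> p (Suc i) \<le> p j"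
      using assms(2) by (auto intro!: partition_mono[OF assms(1)])
    then show "c j * indicator {p j<..p (Suc j)} s = (if j = i then c i else 0)"
      using assms(3,4) by (cases j i rule: linorder_cases) (auto simp: indicator_def)
  qed
  then show ?thesis using assms(2) by simp
qed

lemma
  assumes "\<forall>i<n. p i \<le> p (Suc i)"
  shows square_integrable_step_fun: "square_integrable lborel (\<lambda>s. of_real (step_fun p c n s))"
    and integral_step_fun_squared:
      "(\<integral>s. (cmod (of_real (step_fun p c n s)))\<^sup>2 \<partial>lborel) = (\<Sum>i<n. (c i)\<^sup>2 * (p (Suc i) - p i))"
proof -
  have int: "integrable lborel (\<lambda>s. (c i)\<^sup>2 * indicat_real {p i<..p (Suc i)} s)" if "i < n" for i
    using assms that by (intro integrable_mult_right integrable_real_indicator) auto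
  have [measurable]: "step_fun p c n \<in> borel_measurable borel"
    unfolding step_fun_def by measurable
  show "square_integrable lborel (\<lambda>s. of_real (step_fun p c n s))"
    unfolding square_integrable_def norm_of_real power2_abs step_fun_squared[OF assms]
  proof
    show "(\<lambda>s. complex_of_real (step_fun p c n s)) \<in> borel_measurable lborel" by measurable
    show "integrable lborel (\<lambda>s. \<Sum>i<n. (c i)\<^sup>2 * indicat_real {p i<..p (Suc i)} s)"
      by (rule Bochner_Integration.integrable_sum) (simp only: int lessThan_iff)
  qed
  show "(\<integral>s. (cmod (of_real (step_fun p c n s)))\<^sup>2 \<partial>lborel) = (\<Sum>i<n. (c i)\<^sup>2 * (p (Suc i) - p i))"
  proof -
    have "(\<integral>s. (c i)\<^sup>2 * indicat_real {p i<..p (Suc i)} s \<partial>lborel) = (c i)\<^sup>2 * (p (Suc i) - p i)" if "i < n" for i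
      using assms that by (simp only: integral_mult_right_zero) simp
    then have "(\<Sum>i<n. (\<integral>s. (c i)\<^sup>2 * indicat_real {p i<..p (Suc i)} s \<partial>lborel)) = (\<Sum>i<n. (c i)\<^sup>2 * (p (Suc i) - p i))"
      by (intro sum.cong) auto
    moreover have "(\<integral>s. (\<Sum>i<n. (c i)\<^sup>2 * indicat_real {p i<..p (Suc i)} s) \<partial>lborel)
        = (\<Sum>i<n. (\<integral>s. (c i)\<^sup>2 * indicat_real {p i<..p (Suc i)} s \<partial>lborel))"
      by (rule Bochner_Integration.integral_sum) (simp only: int lessThan_iff)
    ultimately show ?thesis
      unfolding norm_of_real power2_abs step_fun_squared[OF assms] by (simp only:)
  qed
qed

lemma step_integral_Suc:
  "step_integral Z p c (Suc n) \<omega> = step_integral Z p c n \<omega> + complex_of_real (c n) * (Z (p (Suc n)) \<omega> - Z (p n) \<omega>)"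
  by (simp add: step_integral_def)

lemma sum_lessThan_double: "(\<Sum>j<2 * n. g j) = (\<Sum>i<n. g (2 * i) + g (Suc (2 * i)))"
  for g :: "nat \<Rightarrow> 'a::comm_monoid_add"
  by (induction n) (simp_all add: add.assoc)

definition dyadic :: "real \<Rightarrow> nat \<Rightarrow> nat \<Rightarrow> real" where
  "dyadic t k i = t * real i / 2 ^ k"

lemma dyadic_simps:
  "dyadic t k 0 = 0" "dyadic t k (2 ^ k) = t" "dyadic t (Suc k) (2 * i) = dyadic t k i"
  "dyadic t (Suc k) (Suc (Suc (2 * i))) = dyadic t k (Suc i)"
  by (simp_all add: dyadic_def field_simps)

lemma dyadic_gap: "dyadic t k (Suc i) - dyadic t k i = t / 2 ^ k"
  by (simp add: dyadic_def field_simps)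

lemma dyadic_mono: "0 \<le> t \<Longrightarrow> i \<le> j \<Longrightarrow> dyadic t k i \<le> dyadic t k j"
  unfolding dyadic_def by (intro divide_right_mono mult_left_mono) auto

text \<open>
  A step function on the partition of level \<open>k\<close> is one on the partition of level \<open>k + 1\<close>, each value being
  used twice. This puts two consecutive approximations on a common partition.
\<close>

lemma step_integral_refine:
  "step_integral Z (dyadic t (Suc k)) (\<lambda>j. c (j div 2)) (2 ^ Suc k) \<omega> = step_integral Z (dyadic t k) c (2 ^ k) \<omega>"
  unfolding step_integral_def power_Suc sum_lessThan_double
  by (intro sum.cong refl) (simp add: dyadic_simps flip: distrib_left)

text \<open>
  The integral of \<open>e\<^bsup>-2\<mu>(t-s)\<^esup>\<close> over \<open>[0, t]\<close>; the case \<open>\<mu> = 0\<close> is that of the constant mode \<open>l = 0\<close>.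
\<close>

definition heat_variance :: "real \<Rightarrow> real \<Rightarrow> real" where
  "heat_variance \<mu> t = (if \<mu> = 0 then t else (1 - exp (- 2 * \<mu> * t)) / (2 * \<mu>))"

lemma integral_heat_kernel_squared:
  assumes "0 \<le> t"
  shows "(\<integral>s. indicator {0..t} s *\<^sub>R (exp (- \<mu> * (t - s)))\<^sup>2 \<partial>lborel) = heat_variance \<mu> t"
proof (cases "\<mu> = 0")
  case True
  then show ?thesis using assms by (simp add: heat_variance_def)
next
  case False
  have sq: "(exp (- \<mu> * (t - s)))\<^sup>2 = exp (- 2 * \<mu> * (t - s))" for s
    by (simp add: power2_eq_square flip: exp_add)
  have "(\<integral>s. indicator {0..t} s *\<^sub>R exp (- 2 * \<mu> * (t - s)) \<partial>lborel)
      = exp (- 2 * \<mu> * (t - t)) / (2 * \<mu>) - exp (- 2 * \<mu> * (t - 0)) / (2 * \<mu>)"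
    by (rule integral_FTC_Icc[OF assms])
      (use False in \<open>auto intro!: derivative_eq_intros continuous_intros
        simp flip: has_real_derivative_iff_has_vector_derivative\<close>)
  then show ?thesis using False unfolding sq by (simp add: heat_variance_def diff_divide_distrib)
qed

lemma exp_lipschitz:
  fixes \<mu> r s t :: real
  assumes \<mu>: "0 \<le> \<mu>" and rs: "r \<in> {0..t}" "s \<in> {0..t}"
  shows "\<bar>exp (- \<mu> * (t - r)) - exp (- \<mu> * (t - s))\<bar> \<le> \<mu> * \<bar>r - s\<bar>"
proof -
  have *: "exp (- \<mu> * (t - s)) - exp (- \<mu> * (t - r)) \<le> \<mu> * (s - r)"
    and **: "0 \<le> exp (- \<mu> * (t - s)) - exp (- \<mu> * (t - r))" if "r \<le> s" "s \<le> t" for r s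
  proof -
    have "exp (- \<mu> * (t - r)) = exp (- \<mu> * (t - s)) * exp (- \<mu> * (s - r))"
      by (simp only: mult_exp_exp) (simp add: algebra_simps)
    then have "exp (- \<mu> * (t - s)) - exp (- \<mu> * (t - r)) = exp (- \<mu> * (t - s)) * (1 - exp (- \<mu> * (s - r)))"
      by (simp add: algebra_simps)
    also have "\<dots> \<le> 1 * (\<mu> * (s - r))"
      using \<mu> that exp_ge_add_one_self[of "- \<mu> * (s - r)"] by (intro mult_mono) (auto simp: mult_nonneg_nonneg)
    finally show "exp (- \<mu> * (t - s)) - exp (- \<mu> * (t - r)) \<le> \<mu> * (s - r)" by simp
    show "0 \<le> exp (- \<mu> * (t - s)) - exp (- \<mu> * (t - r))"
      using \<mu> that by (simp add: mult_left_mono)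
  qed
  show ?thesis
  proof (cases "r \<le> s")
    case True
    then show ?thesis using *[OF True] **[OF True] rs by auto
  next
    case False
    then show ?thesis using *[of s r] **[of s r] rs by auto
  qed
qed

context filtered_prob_space
begin

text \<open>
  Each new increment is orthogonal to the preceding partial sum, which belongs to the past, so that the
  second moments add up.
\<close>

lemma step_integral_orthogonal_noise:
  assumes Z: "orthogonal_noise a Z" and p: "p 0 = 0" "\<forall>i<n. p i \<le> p (Suc i)"
  shows "step_integral Z p c n \<in> borel_measurable (F (p n)) \<and> square_integrable M (step_integral Z p c n) \<and>
    (\<integral>\<omega>. (cmod (step_integral Z p c n \<omega>))\<^sup>2 \<partial>M) = a * (\<Sum>i<n. (c i)\<^sup>2 * (p (Suc i) - p i)) \<and>
    (\<forall>V. V \<in> borel_measurable (F 0) \<longrightarrow> square_integrable M V \<longrightarrow>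
      (\<integral>\<omega>. V \<omega> * cnj (step_integral Z p c n \<omega>) \<partial>M) = 0)"
  using p(2)
proof (induction n)
  case 0
  have "step_integral Z p c 0 = (\<lambda>\<omega>. 0)" by (simp add: step_integral_def fun_eq_iff)
  then show ?case by (simp add: square_integrable_zero)
next
  case (Suc n)
  let ?S = "step_integral Z p c n" and ?D = "\<lambda>\<omega>. Z (p (Suc n)) \<omega> - Z (p n) \<omega>"
  have le: "0 \<le> p n" "p n \<le> p (Suc n)"
    using partition_mono[OF Suc.prems, of 0 n] Suc.prems p(1) by auto
  have IH: "?S \<in> borel_measurable (F (p n))" "square_integrable M ?S"
    "(\<integral>\<omega>. (cmod (?S \<omega>))\<^sup>2 \<partial>M) = a * (\<Sum>i<n. (c i)\<^sup>2 * (p (Suc i) - p i))"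
    "\<And>V. V \<in> borel_measurable (F 0) \<Longrightarrow> square_integrable M V \<Longrightarrow> (\<integral>\<omega>. V \<omega> * cnj (?S \<omega>) \<partial>M) = 0"
    using Suc by auto
  have D: "square_integrable M ?D" "(\<integral>\<omega>. (cmod (?D \<omega>))\<^sup>2 \<partial>M) = a * (p (Suc n) - p n)"
    and perp: "\<And>V. V \<in> borel_measurable (F (p n)) \<Longrightarrow> square_integrable M V \<Longrightarrow> (\<integral>\<omega>. V \<omega> * cnj (?D \<omega>) \<partial>M) = 0"
    using Z le by (auto simp: orthogonal_noise_def)
  have [measurable]: "Z (p (Suc n)) \<in> borel_measurable (F (p (Suc n)))"
    using Z le by (auto simp: orthogonal_noise_def)
  have [measurable]: "Z (p n) \<in> borel_measurable (F (p (Suc n)))" "?S \<in> borel_measurable (F (p (Suc n)))"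
    using Z le IH(1) by (auto simp: orthogonal_noise_def intro: measurable_filtration_mono[of "p n"])
  have eq: "step_integral Z p c (Suc n) = (\<lambda>\<omega>. ?S \<omega> + complex_of_real (c n) * ?D \<omega>)"
    by (simp add: step_integral_Suc fun_eq_iff)
  note cD = square_integrable_cmult[OF D(1), of "complex_of_real (c n)"]
  have cnjD: "V * cnj (complex_of_real (c n) * d) = complex_of_real (c n) * (V * cnj d)" for V d by simp
  show ?case unfolding eq
  proof (intro conjI allI impI)
    show "(\<lambda>\<omega>. ?S \<omega> + complex_of_real (c n) * ?D \<omega>) \<in> borel_measurable (F (p (Suc n)))" by measurable
    show "square_integrable M (\<lambda>\<omega>. ?S \<omega> + complex_of_real (c n) * ?D \<omega>)"
      by (intro square_integrable_add IH cD)
    have "(\<integral>\<omega>. ?S \<omega> * cnj (complex_of_real (c n) * ?D \<omega>) \<partial>M) = 0"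
      unfolding cnjD integral_mult_right_zero perp[OF IH(1,2)] by simp
    then show "(\<integral>\<omega>. (cmod (?S \<omega> + complex_of_real (c n) * ?D \<omega>))\<^sup>2 \<partial>M) = a * (\<Sum>i<Suc n. (c i)\<^sup>2 * (p (Suc i) - p i))"
      unfolding integral_cmod_add_squared[OF IH(2) cD] IH(3) norm_mult power_mult_distrib norm_of_real power2_abs
        integral_mult_right_zero D(2) by (simp add: algebra_simps)
    fix V assume V: "V \<in> borel_measurable (F 0)" and V2: "square_integrable M V"
    have V': "V \<in> borel_measurable (F (p n))" using V le by (auto intro: measurable_filtration_mono)
    have "(\<integral>\<omega>. V \<omega> * cnj (?S \<omega> + complex_of_real (c n) * ?D \<omega>) \<partial>M)
        = (\<integral>\<omega>. V \<omega> * cnj (?S \<omega>) \<partial>M) + (\<integral>\<omega>. V \<omega> * cnj (complex_of_real (c n) * ?D \<omega>) \<partial>M)"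
      unfolding complex_cnj_add distrib_left
      by (intro Bochner_Integration.integral_add integrable_mult_cnj V2 IH cD)
    also have "\<dots> = 0"
      unfolding cnjD integral_mult_right_zero IH(4)[OF V V2] perp[OF V' V2] by simp
    finally show "(\<integral>\<omega>. V \<omega> * cnj (?S \<omega> + complex_of_real (c n) * ?D \<omega>) \<partial>M) = 0" .
  qed
qed

text \<open>
  The isometry and the orthogonality to the past hold for step functions and pass to the limit in
  \<open>L\<^sup>2\<close>, so that they are shared by all versions of the integral.
\<close>

lemma wiener_isometry:
  assumes Z: "orthogonal_noise a Z" and f: "continuous_on {0..t} f" and I: "has_wiener_integral M Z f t I"
  shows "square_integrable M I"
    and "(\<integral>\<omega>. (cmod (I \<omega>))\<^sup>2 \<partial>M) = a * (\<integral>s. indicator {0..t} s *\<^sub>R (f s)\<^sup>2 \<partial>lborel)"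
    and "V \<in> borel_measurable (F 0) \<Longrightarrow> square_integrable M V \<Longrightarrow> (\<integral>\<omega>. V \<omega> * cnj (I \<omega>) \<partial>M) = 0"
proof -
  show I2: "square_integrable M I" using I by (simp add: has_wiener_integral_def square_integrable_def)
  obtain p c n where
    p: "\<And>k. p k 0 = 0" "\<And>k. p k (n k) = t" "\<And>k. \<forall>i<n k. p k i \<le> p k (Suc i)" and
    step: "(\<lambda>k. \<integral>\<^sup>+s\<in>{0..t}. ennreal ((step_fun (p k) (c k) (n k) s - f s)\<^sup>2) \<partial>lborel) \<longlonglongrightarrow> 0" and
    lim: "(\<lambda>k. \<integral>\<^sup>+\<omega>. ennreal ((cmod (step_integral Z (p k) (c k) (n k) \<omega> - I \<omega>))\<^sup>2) \<partial>M) \<longlonglongrightarrow> 0"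
    using I unfolding has_wiener_integral_def by blast
  note S = step_integral_orthogonal_noise[OF Z p(1) p(3), THEN conjunct2]
  note S2 = S[THEN conjunct1] and S_norm = S[THEN conjunct2, THEN conjunct1]
    and S_perp = S[THEN conjunct2, THEN conjunct2, rule_format]
  let ?g = "\<lambda>k s. complex_of_real (step_fun (p k) (c k) (n k) s)"
  let ?f = "\<lambda>s. complex_of_real (indicator {0..t} s *\<^sub>R f s)"
  have f2: "square_integrable lborel ?f"
  proof -
    have "integrable lborel (\<lambda>s. indicator {0..t} s *\<^sub>R f s)"
      by (rule borel_integrable_compact) (auto intro: f)
    then have "?f \<in> borel_measurable lborel"
      by (intro measurable_compose[OF borel_measurable_integrable borel_measurable_of_real])
    moreover have "integrable lborel (\<lambda>s. indicator {0..t} s *\<^sub>R (f s)\<^sup>2)"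
      by (rule borel_integrable_compact) (auto intro!: f continuous_intros)
    moreover have "(cmod (?f s))\<^sup>2 = indicator {0..t} s *\<^sub>R (f s)\<^sup>2" for s by (simp add: indicator_def)
    ultimately show ?thesis unfolding square_integrable_def by simp
  qed
  have "(\<lambda>k. \<integral>\<^sup>+s. ennreal ((cmod (?g k s - ?f s))\<^sup>2) \<partial>lborel) \<longlonglongrightarrow> 0"
  proof -
    have "ennreal ((cmod (?g k s - ?f s))\<^sup>2)
        = ennreal ((step_fun (p k) (c k) (n k) s - f s)\<^sup>2) * indicator {0..t} s" for k s
      using step_fun_outside[OF p(3)[of k], of s "c k"]
      by (cases "s \<in> {0..t}") (auto simp: p(1,2) indicator_def simp flip: of_real_diff)
    then show ?thesis using step by simp
  qed
  from tendsto_integral_cmod_squared[OF square_integrable_step_fun[OF p(3)] f2 this]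
  have "(\<lambda>k. a * (\<integral>s. (cmod (?g k s))\<^sup>2 \<partial>lborel)) \<longlonglongrightarrow> a * (\<integral>s. (cmod (?f s))\<^sup>2 \<partial>lborel)"
    by (intro tendsto_intros)
  moreover have "(\<lambda>k. a * (\<integral>s. (cmod (?g k s))\<^sup>2 \<partial>lborel)) = (\<lambda>k. \<integral>\<omega>. (cmod (step_integral Z (p k) (c k) (n k) \<omega>))\<^sup>2 \<partial>M)"
    unfolding integral_step_fun_squared[OF p(3)] S_norm ..
  moreover have "\<dots> \<longlonglongrightarrow> (\<integral>\<omega>. (cmod (I \<omega>))\<^sup>2 \<partial>M)"
    by (rule tendsto_integral_cmod_squared[OF S2 I2 lim])
  ultimately have "(\<integral>\<omega>. (cmod (I \<omega>))\<^sup>2 \<partial>M) = a * (\<integral>s. (cmod (?f s))\<^sup>2 \<partial>lborel)"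
    by (simp only:) (rule LIMSEQ_unique)
  moreover have "(cmod (?f s))\<^sup>2 = indicator {0..t} s *\<^sub>R (f s)\<^sup>2" for s by (simp add: indicator_def)
  ultimately show "(\<integral>\<omega>. (cmod (I \<omega>))\<^sup>2 \<partial>M) = a * (\<integral>s. indicator {0..t} s *\<^sub>R (f s)\<^sup>2 \<partial>lborel)" by simp
  assume V: "V \<in> borel_measurable (F 0)" and V2: "square_integrable M V"
  have "(\<lambda>k. \<integral>\<omega>. V \<omega> * cnj (step_integral Z (p k) (c k) (n k) \<omega>) \<partial>M) \<longlonglongrightarrow> (\<integral>\<omega>. V \<omega> * cnj (I \<omega>) \<partial>M)"
    by (rule tendsto_integral_mult_cnj[OF S2 I2 lim V2])
  moreover have "(\<integral>\<omega>. V \<omega> * cnj (step_integral Z (p k) (c k) (n k) \<omega>) \<partial>M) = 0" for k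
    by (rule S_perp[OF V V2])
  ultimately show "(\<integral>\<omega>. V \<omega> * cnj (I \<omega>) \<partial>M) = 0" by (simp add: LIMSEQ_const_iff)
qed

text \<open>
  On dyadic partitions of \<open>[0, t]\<close> with left end points as nodes, consecutive step functions differ by at
  most \<open>L t / 2\<^bsup>k+1\<^esup>\<close>. By the isometry the step integrals form a geometrically Cauchy sequence.
\<close>

lemma wiener_integral_exists:
  assumes Z: "orthogonal_noise a Z" and a: "0 \<le> a" and t: "0 \<le> t" and L: "0 \<le> L"
    and lip: "\<And>r s. r \<in> {0..t} \<Longrightarrow> s \<in> {0..t} \<Longrightarrow> \<bar>f r - f s\<bar> \<le> L * \<bar>r - s\<bar>"
  shows "\<exists>I. has_wiener_integral M Z f t I"
proof -
  define p where "p = dyadic t"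
  define c where "c k i = f (p k i)" for k i
  define n :: "nat \<Rightarrow> nat" where "n k = 2 ^ k" for k
  have p: "p k 0 = 0" "p k (n k) = t" "\<forall>i<n k. p k i \<le> p k (Suc i)" for k
    using t by (auto simp: p_def n_def dyadic_simps intro: dyadic_mono)
  have p_in: "p k i \<in> {0..t}" if "i \<le> n k" for k i
    using dyadic_mono[OF t that, of k] dyadic_mono[OF t, of 0 i k] by (simp add: p_def n_def dyadic_simps)
  note S = step_integral_orthogonal_noise[OF Z p(1) p(3)]
  let ?S = "\<lambda>k. step_integral Z (p k) (c k) (n k)"
  define B where "B = sqrt (a * t) * (L * t)"
  have "\<exists>I. square_integrable M I \<and> (\<lambda>k. \<integral>\<^sup>+\<omega>. ennreal ((cmod (?S k \<omega> - I \<omega>))\<^sup>2) \<partial>M) \<longlonglongrightarrow> 0"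
  proof (rule geometric_L2_limit)
    show "square_integrable M (?S k)" for k by (rule S[THEN conjunct2, THEN conjunct1])
    show "0 \<le> B" using a t L by (simp add: B_def)
    fix k
    define d where "d j = c (Suc k) j - c k (j div 2)" for j
    have "?S (Suc k) \<omega> - ?S k \<omega> = step_integral Z (p (Suc k)) d (n (Suc k)) \<omega>" for \<omega>
      unfolding n_def p_def step_integral_refine[symmetric, of _ _ k]
      by (simp add: step_integral_def d_def p_def left_diff_distrib sum_subtractf)
    then have "(\<integral>\<omega>. (cmod (?S (Suc k) \<omega> - ?S k \<omega>))\<^sup>2 \<partial>M)
        = a * (\<Sum>j<n (Suc k). (d j)\<^sup>2 * (p (Suc k) (Suc j) - p (Suc k) j))"
      by (simp only: S[THEN conjunct2, THEN conjunct2, THEN conjunct1])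
    also have "\<dots> \<le> a * (\<Sum>j<n (Suc k). (L * (t / 2 ^ Suc k))\<^sup>2 * (t / 2 ^ Suc k))"
    proof (intro mult_left_mono sum_mono a)
      fix j assume j: "j \<in> {..<n (Suc k)}"
      define i where "i = j div 2"
      have ji: "j = 2 * i \<or> j = Suc (2 * i)" unfolding i_def by presburger
      have e: "p k i = p (Suc k) (2 * i)" by (simp add: p_def dyadic_simps)
      have "\<bar>d j\<bar> \<le> L * \<bar>p (Suc k) j - p k i\<bar>"
        unfolding d_def c_def i_def[symmetric] using j ji by (intro lip p_in) (auto simp: n_def)
      also have "\<dots> \<le> L * (t / 2 ^ Suc k)"
      proof (intro mult_left_mono L)
        show "\<bar>p (Suc k) j - p k i\<bar> \<le> t / 2 ^ Suc k"
          using ji dyadic_gap[of t "Suc k" "2 * i"] t unfolding e by (auto simp: p_def)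
      qed
      finally have "(d j)\<^sup>2 \<le> (L * (t / 2 ^ Suc k))\<^sup>2"
        using power_mono[OF _ abs_ge_zero, of "d j" _ 2] by simp
      then show "(d j)\<^sup>2 * (p (Suc k) (Suc j) - p (Suc k) j) \<le> (L * (t / 2 ^ Suc k))\<^sup>2 * (t / 2 ^ Suc k)"
        unfolding p_def dyadic_gap using t by (intro mult_right_mono) auto
    qed
    also have "\<dots> = (a * t) * (L * (t / 2 ^ Suc k))\<^sup>2"
      by (simp add: n_def)
    also have "\<dots> \<le> (a * t) * (L * (t / 2 ^ k))\<^sup>2"
      using a t L by (intro mult_left_mono power_mono divide_left_mono) auto
    also have "\<dots> = (B * (1 / 2) ^ k)\<^sup>2"
      using a t by (simp add: B_def power_mult_distrib power_divide)
    finally show "(\<integral>\<omega>. (cmod (?S (Suc k) \<omega> - ?S k \<omega>))\<^sup>2 \<partial>M) \<le> (B * (1 / 2) ^ k)\<^sup>2" .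
  qed
  then obtain I where I: "square_integrable M I" "(\<lambda>k. \<integral>\<^sup>+\<omega>. ennreal ((cmod (?S k \<omega> - I \<omega>))\<^sup>2) \<partial>M) \<longlonglongrightarrow> 0"
    by blast
  have near: "(step_fun (p k) (c k) (n k) s - f s)\<^sup>2 \<le> (L * t * (1 / 2) ^ k)\<^sup>2" if s: "0 < s" "s \<le> t" for k s
  proof -
    have t0: "0 < t" using s by simp
    \<comment> \<open>The point \<open>s\<close> lies in the dyadic interval number \<open>i\<close>, which is open on the left.\<close>
    define x where "x = s * 2 ^ k / t"
    define i where "i = nat (\<lceil>x\<rceil> - 1)"
    have x: "0 < x" "x \<le> 2 ^ k" using s t0 by (auto simp: x_def field_simps)
    have ix: "real i < x" "x \<le> real (Suc i)" using x(1) unfolding i_def by linarith+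
    have "real i < 2 ^ k" using ix x by linarith
    then have i: "i < n k" by (simp add: n_def flip: of_nat_less_iff)
    have sx: "s = t * x / 2 ^ k" using t0 by (simp add: x_def)
    have ps: "p k i < s" "s \<le> p k (Suc i)"
      unfolding sx p_def dyadic_def using ix t0
      by (auto intro!: divide_strict_right_mono divide_right_mono mult_left_mono)
    have "step_fun (p k) (c k) (n k) s = f (p k i)"
      using step_fun_eq[OF p(3) i ps] by (simp add: c_def)
    moreover have "\<bar>f (p k i) - f s\<bar> \<le> L * \<bar>p k i - s\<bar>"
      by (intro lip p_in) (use i s in auto)
    moreover have "L * \<bar>p k i - s\<bar> \<le> L * (t / 2 ^ k)"
      using ps dyadic_gap[of t k i] by (intro mult_left_mono L) (auto simp: p_def)
    ultimately have "\<bar>step_fun (p k) (c k) (n k) s - f s\<bar> \<le> L * t * (1 / 2) ^ k"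
      by (simp add: power_one_over)
    from power_mono[OF this abs_ge_zero, of 2] show ?thesis by simp
  qed
  have "(\<lambda>k. \<integral>\<^sup>+s\<in>{0..t}. ennreal ((step_fun (p k) (c k) (n k) s - f s)\<^sup>2) \<partial>lborel) \<longlonglongrightarrow> 0"
  proof (rule tendsto_sandwich[OF _ _ tendsto_const])
    show "\<forall>\<^sub>F k in sequentially. (\<integral>\<^sup>+s\<in>{0..t}. ennreal ((step_fun (p k) (c k) (n k) s - f s)\<^sup>2) \<partial>lborel)
        \<le> ennreal ((L * t * (1 / 2) ^ k)\<^sup>2 * t)"
    proof (intro always_eventually allI)
      fix k
      \<comment> \<open>The step functions vanish at 0, which belongs to none of the half-open intervals.\<close>
      have "AE s in lborel. s \<noteq> (0::real)" by (rule AE_lborel_singleton)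
      then have "(\<integral>\<^sup>+s\<in>{0..t}. ennreal ((step_fun (p k) (c k) (n k) s - f s)\<^sup>2) \<partial>lborel)
          \<le> (\<integral>\<^sup>+s. ennreal ((L * t * (1 / 2) ^ k)\<^sup>2) * indicator {0..t} s \<partial>lborel)"
        by (intro nn_integral_mono_AE, eventually_elim)
          (auto simp: indicator_def intro!: ennreal_leI near)
      also have "\<dots> = ennreal ((L * t * (1 / 2) ^ k)\<^sup>2) * ennreal t"
        using t by (subst nn_integral_cmult_indicator) auto
      finally show "(\<integral>\<^sup>+s\<in>{0..t}. ennreal ((step_fun (p k) (c k) (n k) s - f s)\<^sup>2) \<partial>lborel)
        \<le> ennreal ((L * t * (1 / 2) ^ k)\<^sup>2 * t)" using t by (simp add: ennreal_mult)
    qed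
    have "(\<lambda>k. ennreal ((L * t * (1 / 2) ^ k)\<^sup>2 * t)) \<longlonglongrightarrow> ennreal ((L * t * 0)\<^sup>2 * t)"
      by (intro tendsto_intros LIMSEQ_power_zero) simp
    then show "(\<lambda>k. ennreal ((L * t * (1 / 2) ^ k)\<^sup>2 * t)) \<longlonglongrightarrow> 0" by simp
  qed simp
  then have "has_wiener_integral M Z f t I"
    using p I(2) I(1)[unfolded square_integrable_def] unfolding has_wiener_integral_def
    by (intro conjI exI[of _ p] exI[of _ c] exI[of _ n]) auto
  then show ?thesis by (rule exI[where x = I])
qed

lemma heat_wiener_integral:
  assumes Z: "orthogonal_noise a Z" and a: "0 \<le> a" and t: "0 \<le> t" and \<mu>: "0 \<le> \<mu>"
  defines "I \<equiv> wiener_integral M Z (\<lambda>s. exp (- \<mu> * (t - s))) t"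
  shows "square_integrable M I" "(\<integral>\<omega>. (cmod (I \<omega>))\<^sup>2 \<partial>M) = a * heat_variance \<mu> t"
    and "V \<in> borel_measurable (F 0) \<Longrightarrow> square_integrable M V \<Longrightarrow> (\<integral>\<omega>. V \<omega> * cnj (I \<omega>) \<partial>M) = 0"
proof -
  have "\<exists>I. has_wiener_integral M Z (\<lambda>s. exp (- \<mu> * (t - s))) t I"
    by (rule wiener_integral_exists[OF Z a t \<mu> exp_lipschitz[OF \<mu>]])
  then have "has_wiener_integral M Z (\<lambda>s. exp (- \<mu> * (t - s))) t I"
    unfolding I_def wiener_integral_def by (rule someI_ex)
  note * = wiener_isometry[OF Z _ this]
  have c: "continuous_on {0..t} (\<lambda>s. exp (- \<mu> * (t - s)))" by (intro continuous_intros)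
  show "square_integrable M I" "(\<integral>\<omega>. (cmod (I \<omega>))\<^sup>2 \<partial>M) = a * heat_variance \<mu> t"
    "V \<in> borel_measurable (F 0) \<Longrightarrow> square_integrable M V \<Longrightarrow> (\<integral>\<omega>. V \<omega> * cnj (I \<omega>) \<partial>M) = 0"
    using *[OF c] integral_heat_kernel_squared[OF t] by auto
qed

end

section \<open>First and second moments of the modes\<close>

definition harm_coeff :: "('w \<Rightarrow> real L2_sphere) \<Rightarrow> nat \<Rightarrow> int \<Rightarrow> 'w \<Rightarrow> complex" where
  "harm_coeff X l m \<omega> = sph_coeff (cplx_L2 (X \<omega>)) l m"

lemma bounded_linear_real_sph_coeff: "bounded_linear (\<lambda>f. sph_coeff (cplx_L2 f) l m)"
  by (rule bounded_linear_compose[OF bounded_linear_sph_coeff bounded_linear_cplx_L2])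

text \<open>
  The scheme evolves only the modes with \<open>m \<ge> 0\<close>. Those with \<open>m < 0\<close> are supplied here by the symmetry of
  the coefficients of a real function, so that both approximations become sums over all \<open>m\<close>.
\<close>

definition em_coeff :: "em_scheme \<Rightarrow> (nat \<Rightarrow> real) \<Rightarrow> (nat \<Rightarrow> nat \<Rightarrow> nat \<Rightarrow> real \<Rightarrow> 'w \<Rightarrow> real) \<Rightarrow>
    ('w \<Rightarrow> real L2_sphere) \<Rightarrow> real \<Rightarrow> nat \<Rightarrow> int \<Rightarrow> nat \<Rightarrow> 'w \<Rightarrow> complex" where
  "em_coeff sch A \<beta> X0 h l m k \<omega> =
    (if 0 \<le> m then em_mode sch A \<beta> X0 h l (nat m) k \<omega>
     else (- 1) ^ nat (- m) * cnj (em_mode sch A \<beta> X0 h l (nat (- m)) k \<omega>))"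

lemma sum_symmetric_int:
  fixes f :: "int \<Rightarrow> 'a::comm_monoid_add"
  shows "(\<Sum>m\<in>{- int l..int l}. f m) = f 0 + (\<Sum>m=1..l. f (int m) + f (- int m))"
proof (induction l)
  case (Suc l)
  have "{- int (Suc l)..int (Suc l)} = insert (int (Suc l)) (insert (- int (Suc l)) {- int l..int l})" by auto
  then have "(\<Sum>m\<in>{- int (Suc l)..int (Suc l)}. f m)
      = f (int (Suc l)) + (f (- int (Suc l)) + (\<Sum>m\<in>{- int l..int l}. f m))"
    by (simp only:) (subst sum.insert; simp)+
  then show ?case using Suc by (simp add: ac_simps)
qed simp

text \<open>
  The terms of \<open>m\<close> and \<open>-m\<close> are complex conjugates, and their sum is twice the real part of
  \<open>X\<^sub>l\<^sub>m Y\<^sub>l\<^sub>m\<close>.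
\<close>

lemma em_approx_eq_harmonic_sum:
  "em_approx sch A \<beta> X0 h \<kappa> k \<omega> = harmonic_sum {..\<kappa>} (\<lambda>l m. em_coeff sch A \<beta> X0 h l m k \<omega>)"
proof -
  let ?e = "\<lambda>l m. em_mode sch A \<beta> X0 h l m k \<omega>" and ?c = "\<lambda>l m. em_coeff sch A \<beta> X0 h l m k \<omega>"
  have pair: "?c l (int m) * sph_harm l (int m) x + ?c l (- int m) * sph_harm l (- int m) x
      = 2 * complex_of_real (Re (?e l m) * Re (sph_harm l (int m) x) - Im (?e l m) * Im (sph_harm l (int m) x))"
    if "1 \<le> m" for l m x
  proof -
    have "(- 1) ^ m * (- 1) ^ m = (1 :: complex)" by (simp flip: power_mult_distrib)
    then have "?c l (- int m) * sph_harm l (- int m) x = cnj (?e l m * sph_harm l (int m) x)"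
      using that by (simp add: em_coeff_def sph_harm_def mult.left_commute mult.commute)
    moreover have "?c l (int m) = ?e l m" by (simp add: em_coeff_def)
    ultimately have "?c l (int m) * sph_harm l (int m) x + ?c l (- int m) * sph_harm l (- int m) x
        = ?e l m * sph_harm l (int m) x + cnj (?e l m * sph_harm l (int m) x)" by simp
    then show ?thesis unfolding complex_add_cnj by simp
  qed
  have "(\<Sum>l\<le>\<kappa>. ?e l 0 * sph_harm l 0 x + 2 * (\<Sum>m=1..l. complex_of_real
         (Re (?e l m) * Re (sph_harm l (int m) x) - Im (?e l m) * Im (sph_harm l (int m) x))))
      = (\<Sum>l\<le>\<kappa>. \<Sum>m\<in>{- int l..int l}. ?c l m * sph_harm l m x)" for x
    unfolding sum_symmetric_int sum_distrib_left
    by (intro sum.cong arg_cong2[where f = "(+)"] refl) (simp_all add: pair em_coeff_def[of _ _ _ _ _ _ 0])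
  then show ?thesis
    unfolding em_approx_def by (simp only: to_L2_harmonic_sum[OF finite_atMost])
qed

definition spectral_coeff :: "'w measure \<Rightarrow> (nat \<Rightarrow> real) \<Rightarrow> (nat \<Rightarrow> nat \<Rightarrow> nat \<Rightarrow> real \<Rightarrow> 'w \<Rightarrow> real) \<Rightarrow>
    ('w \<Rightarrow> real L2_sphere) \<Rightarrow> real \<Rightarrow> nat \<Rightarrow> int \<Rightarrow> 'w \<Rightarrow> complex" where
  "spectral_coeff M A \<beta> X0 t l m \<omega> = complex_of_real (exp (- sph_eigenvalue l * t)) * harm_coeff X0 l m \<omega>
    + wiener_integral M (noise_coeff A \<beta> l m) (\<lambda>s. exp (- sph_eigenvalue l * (t - s))) t \<omega>"

lemma spectral_approx_eq_harmonic_sum: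
  "spectral_approx M A \<beta> X0 \<kappa> t \<omega> = harmonic_sum {..\<kappa>} (\<lambda>l m. spectral_coeff M A \<beta> X0 t l m \<omega>)"
  unfolding spectral_approx_def spectral_coeff_def harm_coeff_def by (rule to_L2_harmonic_sum) simp

lemma harm_coeff_measurable:
  assumes "X \<in> borel_measurable N"
  shows "harm_coeff X l m \<in> borel_measurable N"
  unfolding harm_coeff_def[abs_def]
  by (rule measurable_compose[OF assms borel_measurable_continuous_onI])
    (intro linear_continuous_on bounded_linear_real_sph_coeff)

lemma square_integrable_coeff:
  assumes X: "X \<in> borel_measurable N" and X2: "integrable N (\<lambda>\<omega>. (norm (X \<omega>))\<^sup>2)"
  shows "square_integrable N (harm_coeff X l m)"
proof -
  obtain K where K: "\<And>f. cmod (sph_coeff (cplx_L2 f) l m) \<le> norm f * K"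
    using bounded_linear.bounded[OF bounded_linear_real_sph_coeff] by blast
  note meas = harm_coeff_measurable[OF X, of l m]
  have "(cmod (harm_coeff X l m \<omega>))\<^sup>2 \<le> (norm (X \<omega>))\<^sup>2 * K\<^sup>2" for \<omega>
    unfolding power_mult_distrib[symmetric] harm_coeff_def by (intro power_mono K) simp
  moreover have "integrable N (\<lambda>\<omega>. (norm (X \<omega>))\<^sup>2 * K\<^sup>2)" by (intro integrable_mult_left X2)
  ultimately have "integrable N (\<lambda>\<omega>. (cmod (harm_coeff X l m \<omega>))\<^sup>2)"
    using meas by (elim Bochner_Integration.integrable_bound) auto
  then show ?thesis
    using meas by (simp add: square_integrable_def)
qed

context filtered_prob_space
begin

text \<open>
  Orthogonality to the constant function 1.
\<close>

lemma orthogonal_noise_mean: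
  assumes Z: "orthogonal_noise a Z" and st: "0 \<le> s" "s \<le> t"
  shows "(\<integral>\<omega>. Z t \<omega> - Z s \<omega> \<partial>M) = 0"
proof -
  have "(\<integral>\<omega>. 1 * cnj (Z t \<omega> - Z s \<omega>) \<partial>M) = 0"
    by (rule orthogonal_noiseD(4)[OF Z st _ square_integrable_const]) simp
  then have "cnj (\<integral>\<omega>. Z t \<omega> - Z s \<omega> \<partial>M) = 0"
    unfolding Bochner_Integration.integral_cnj mult_1 .
  then show ?thesis by (metis complex_cnj_zero_iff)
qed

text \<open>
  The current state is a function of the past and hence orthogonal to the next increment. Second
  moments thus satisfy the scalar recursion \<open>v\<^bsub>k+1\<^esub> = \<xi>\<^sup>2 v\<^sub>k + a h \<zeta>\<^sup>2\<close>.
\<close>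

lemma autoregression_moments:
  assumes Z: "orthogonal_noise a Z" and h: "0 \<le> h"
    and y0: "y 0 \<in> borel_measurable (F 0)" "square_integrable M (y 0)"
    and y: "\<And>k \<omega>. y (Suc k) \<omega> = complex_of_real \<xi> * y k \<omega>
      + complex_of_real \<zeta> * (Z (real (Suc k) * h) \<omega> - Z (real k * h) \<omega>)"
  shows "y k \<in> borel_measurable (F (real k * h)) \<and> square_integrable M (y k) \<and>
    (\<integral>\<omega>. y k \<omega> \<partial>M) = \<xi> ^ k * (\<integral>\<omega>. y 0 \<omega> \<partial>M) \<and>
    (\<integral>\<omega>. (cmod (y k \<omega>))\<^sup>2 \<partial>M) = \<xi> ^ (2 * k) * (\<integral>\<omega>. (cmod (y 0 \<omega>))\<^sup>2 \<partial>M)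
      + a * (h * \<zeta>\<^sup>2 * (\<Sum>j<k. \<xi>\<^sup>2 ^ j))"
proof (induction k)
  case 0
  then show ?case using y0 by simp
next
  case (Suc k)
  let ?s = "real k * h" and ?t = "real (Suc k) * h"
  let ?D = "\<lambda>\<omega>. Z ?t \<omega> - Z ?s \<omega>"
  have st: "0 \<le> ?s" "?s \<le> ?t" "?t - ?s = h" using h by (auto simp: algebra_simps)
  have IH: "y k \<in> borel_measurable (F ?s)" "square_integrable M (y k)"
    "(\<integral>\<omega>. y k \<omega> \<partial>M) = \<xi> ^ k * (\<integral>\<omega>. y 0 \<omega> \<partial>M)"
    "(\<integral>\<omega>. (cmod (y k \<omega>))\<^sup>2 \<partial>M) = \<xi> ^ (2 * k) * (\<integral>\<omega>. (cmod (y 0 \<omega>))\<^sup>2 \<partial>M) + a * (h * \<zeta>\<^sup>2 * (\<Sum>j<k. \<xi>\<^sup>2 ^ j))"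
    using Suc by auto
  have D: "square_integrable M ?D" "(\<integral>\<omega>. (cmod (?D \<omega>))\<^sup>2 \<partial>M) = a * h"
    "(\<integral>\<omega>. y k \<omega> * cnj (?D \<omega>) \<partial>M) = 0"
    using orthogonal_noiseD(2-4)[OF Z st(1,2)] IH(1,2) st(3) by simp_all
  have [measurable]: "Z ?t \<in> borel_measurable (F ?t)" using Z st by (auto simp: orthogonal_noise_def)
  have [measurable]: "Z ?s \<in> borel_measurable (F ?t)" "y k \<in> borel_measurable (F ?t)"
    using Z st IH(1) by (auto simp: orthogonal_noise_def intro: measurable_filtration_mono[of ?s])
  have yS: "y (Suc k) = (\<lambda>\<omega>. complex_of_real \<xi> * y k \<omega> + complex_of_real \<zeta> * ?D \<omega>)"
    using y by (simp add: fun_eq_iff)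
  note sq = square_integrable_cmult[OF IH(2), of "complex_of_real \<xi>"] square_integrable_cmult[OF D(1), of "complex_of_real \<zeta>"]
  show ?case unfolding yS
  proof (intro conjI)
    show "(\<lambda>\<omega>. complex_of_real \<xi> * y k \<omega> + complex_of_real \<zeta> * ?D \<omega>) \<in> borel_measurable (F ?t)" by measurable
    show "square_integrable M (\<lambda>\<omega>. complex_of_real \<xi> * y k \<omega> + complex_of_real \<zeta> * ?D \<omega>)"
      by (intro square_integrable_add sq)
    have "(\<integral>\<omega>. complex_of_real \<xi> * y k \<omega> + complex_of_real \<zeta> * ?D \<omega> \<partial>M)
        = complex_of_real \<xi> * (\<integral>\<omega>. y k \<omega> \<partial>M) + complex_of_real \<zeta> * (\<integral>\<omega>. ?D \<omega> \<partial>M)"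
      unfolding integral_mult_right_zero[symmetric]
      by (intro Bochner_Integration.integral_add square_integrable_imp_integrable sq)
    then show "(\<integral>\<omega>. complex_of_real \<xi> * y k \<omega> + complex_of_real \<zeta> * ?D \<omega> \<partial>M) = \<xi> ^ Suc k * (\<integral>\<omega>. y 0 \<omega> \<partial>M)"
      unfolding orthogonal_noise_mean[OF Z st(1,2)] IH(3) by simp
    have "complex_of_real \<xi> * y k \<omega> * cnj (complex_of_real \<zeta> * ?D \<omega>)
        = complex_of_real (\<xi> * \<zeta>) * (y k \<omega> * cnj (?D \<omega>))" for \<omega> by simp
    then have cross: "(\<integral>\<omega>. complex_of_real \<xi> * y k \<omega> * cnj (complex_of_real \<zeta> * ?D \<omega>) \<partial>M) = 0"
      by (simp only: integral_mult_right_zero D(3) mult_zero_right)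
    have geo: "(\<Sum>j<Suc k. \<xi>\<^sup>2 ^ j) = 1 + \<xi>\<^sup>2 * (\<Sum>j<k. \<xi>\<^sup>2 ^ j)"
      unfolding sum.lessThan_Suc_shift by (simp add: sum_distrib_left)
    show "(\<integral>\<omega>. (cmod (complex_of_real \<xi> * y k \<omega> + complex_of_real \<zeta> * ?D \<omega>))\<^sup>2 \<partial>M)
        = \<xi> ^ (2 * Suc k) * (\<integral>\<omega>. (cmod (y 0 \<omega>))\<^sup>2 \<partial>M) + a * (h * \<zeta>\<^sup>2 * (\<Sum>j<Suc k. \<xi>\<^sup>2 ^ j))"
      unfolding integral_cmod_add_squared[OF sq] cross norm_mult power_mult_distrib norm_of_real power2_abs
        integral_mult_right_zero D(2) IH(4) geo
      by (simp add: algebra_simps power2_eq_square)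
  qed
qed

lemma em_coeff_moments:
  assumes X: "X0 \<in> borel_measurable (F 0)" and X2: "integrable M (\<lambda>\<omega>. (norm (X0 \<omega>))\<^sup>2)"
    and \<beta>: "independent_brownian_motions M F \<beta>" and A: "0 \<le> A l" and m: "\<bar>m\<bar> \<le> int l" and h: "0 \<le> h"
  shows "square_integrable M (em_coeff sch A \<beta> X0 h l m k)"
    and "(\<integral>\<omega>. em_coeff sch A \<beta> X0 h l m k \<omega> \<partial>M) = em_xi sch h l ^ k * (\<integral>\<omega>. harm_coeff X0 l m \<omega> \<partial>M)"
    and "(\<integral>\<omega>. (cmod (em_coeff sch A \<beta> X0 h l m k \<omega>))\<^sup>2 \<partial>M) =
      em_xi sch h l ^ (2 * k) * (\<integral>\<omega>. (cmod (harm_coeff X0 l m \<omega>))\<^sup>2 \<partial>M)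
      + A l * (h * (em_xi sch h l ^ em_delta sch)\<^sup>2 * (\<Sum>j<k. (em_xi sch h l)\<^sup>2 ^ j))"
proof -
  have X': "X0 \<in> borel_measurable M" by (rule measurable_filtration[OF _ X]) simp
  note sqc = square_integrable_coeff[OF X' X2]
  define i where "i = nat \<bar>m\<bar>"
  let ?y = "em_mode sch A \<beta> X0 h l i"
  have y0: "?y 0 = harm_coeff X0 l (int i)" by (simp add: fun_eq_iff harm_coeff_def)
  have mom: "square_integrable M (?y k)"
    "(\<integral>\<omega>. ?y k \<omega> \<partial>M) = em_xi sch h l ^ k * (\<integral>\<omega>. harm_coeff X0 l (int i) \<omega> \<partial>M)"
    "(\<integral>\<omega>. (cmod (?y k \<omega>))\<^sup>2 \<partial>M) = em_xi sch h l ^ (2 * k) * (\<integral>\<omega>. (cmod (harm_coeff X0 l (int i) \<omega>))\<^sup>2 \<partial>M)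
      + A l * (h * (em_xi sch h l ^ em_delta sch)\<^sup>2 * (\<Sum>j<k. (em_xi sch h l)\<^sup>2 ^ j))"
    using autoregression_moments[OF orthogonal_noise_coeff[where A = A and l = l and m = "int i", OF \<beta> A] h, where y = ?y and k = k
        and \<xi> = "em_xi sch h l" and \<zeta> = "em_xi sch h l ^ em_delta sch"] m sqc harm_coeff_measurable[OF X]
    unfolding y0 by (auto simp: i_def)
  show "square_integrable M (em_coeff sch A \<beta> X0 h l m k)"
    and "(\<integral>\<omega>. em_coeff sch A \<beta> X0 h l m k \<omega> \<partial>M) = em_xi sch h l ^ k * (\<integral>\<omega>. harm_coeff X0 l m \<omega> \<partial>M)"
    and "(\<integral>\<omega>. (cmod (em_coeff sch A \<beta> X0 h l m k \<omega>))\<^sup>2 \<partial>M) =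
      em_xi sch h l ^ (2 * k) * (\<integral>\<omega>. (cmod (harm_coeff X0 l m \<omega>))\<^sup>2 \<partial>M)
      + A l * (h * (em_xi sch h l ^ em_delta sch)\<^sup>2 * (\<Sum>j<k. (em_xi sch h l)\<^sup>2 ^ j))"
  proof (atomize(full), cases "0 \<le> m")
    case True
    then have "em_coeff sch A \<beta> X0 h l m k = ?y k" "int i = m" by (auto simp: em_coeff_def fun_eq_iff i_def)
    then show "square_integrable M (em_coeff sch A \<beta> X0 h l m k) \<and>
      (\<integral>\<omega>. em_coeff sch A \<beta> X0 h l m k \<omega> \<partial>M) = em_xi sch h l ^ k * (\<integral>\<omega>. harm_coeff X0 l m \<omega> \<partial>M) \<and>
      (\<integral>\<omega>. (cmod (em_coeff sch A \<beta> X0 h l m k \<omega>))\<^sup>2 \<partial>M) =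
      em_xi sch h l ^ (2 * k) * (\<integral>\<omega>. (cmod (harm_coeff X0 l m \<omega>))\<^sup>2 \<partial>M)
      + A l * (h * (em_xi sch h l ^ em_delta sch)\<^sup>2 * (\<Sum>j<k. (em_xi sch h l)\<^sup>2 ^ j))" using mom by simp
  next
    case False
    then have e: "em_coeff sch A \<beta> X0 h l m k = (\<lambda>\<omega>. (- 1) ^ i * cnj (?y k \<omega>))"
      and i: "m = - int i" by (auto simp: em_coeff_def fun_eq_iff i_def)
    have c: "harm_coeff X0 l m = (\<lambda>\<omega>. (- 1) ^ i * cnj (harm_coeff X0 l (int i) \<omega>))"
      unfolding i by (simp add: fun_eq_iff harm_coeff_def sph_coeff_cplx_minus)
    show "square_integrable M (em_coeff sch A \<beta> X0 h l m k) \<and>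
      (\<integral>\<omega>. em_coeff sch A \<beta> X0 h l m k \<omega> \<partial>M) = em_xi sch h l ^ k * (\<integral>\<omega>. harm_coeff X0 l m \<omega> \<partial>M) \<and>
      (\<integral>\<omega>. (cmod (em_coeff sch A \<beta> X0 h l m k \<omega>))\<^sup>2 \<partial>M) =
      em_xi sch h l ^ (2 * k) * (\<integral>\<omega>. (cmod (harm_coeff X0 l m \<omega>))\<^sup>2 \<partial>M)
      + A l * (h * (em_xi sch h l ^ em_delta sch)\<^sup>2 * (\<Sum>j<k. (em_xi sch h l)\<^sup>2 ^ j))"
    proof (intro conjI)
      show "square_integrable M (em_coeff sch A \<beta> X0 h l m k)"
        unfolding e by (intro square_integrable_cmult square_integrable_cnj mom)
      show "(\<integral>\<omega>. em_coeff sch A \<beta> X0 h l m k \<omega> \<partial>M) = em_xi sch h l ^ k * (\<integral>\<omega>. harm_coeff X0 l m \<omega> \<partial>M)"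
        unfolding e c integral_mult_right_zero Bochner_Integration.integral_cnj mom(2) by simp
      show "(\<integral>\<omega>. (cmod (em_coeff sch A \<beta> X0 h l m k \<omega>))\<^sup>2 \<partial>M) =
        em_xi sch h l ^ (2 * k) * (\<integral>\<omega>. (cmod (harm_coeff X0 l m \<omega>))\<^sup>2 \<partial>M)
        + A l * (h * (em_xi sch h l ^ em_delta sch)\<^sup>2 * (\<Sum>j<k. (em_xi sch h l)\<^sup>2 ^ j))"
        unfolding e c norm_mult norm_power norm_minus_cancel norm_one power_one mult_1_left complex_mod_cnj by (rule mom(3))
    qed
  qed
qed

text \<open>
  The mixed term vanishes because the Wiener integral is orthogonal to the initial value.
\<close>

lemma spectral_coeff_moments:
  assumes X: "X0 \<in> borel_measurable (F 0)" and X2: "integrable M (\<lambda>\<omega>. (norm (X0 \<omega>))\<^sup>2)"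
    and \<beta>: "independent_brownian_motions M F \<beta>" and A: "0 \<le> A l" and m: "\<bar>m\<bar> \<le> int l" and t: "0 \<le> t"
  shows "square_integrable M (spectral_coeff M A \<beta> X0 t l m)"
    and "(\<integral>\<omega>. spectral_coeff M A \<beta> X0 t l m \<omega> \<partial>M) = exp (- sph_eigenvalue l * t) * (\<integral>\<omega>. harm_coeff X0 l m \<omega> \<partial>M)"
    and "(\<integral>\<omega>. (cmod (spectral_coeff M A \<beta> X0 t l m \<omega>))\<^sup>2 \<partial>M) =
      (exp (- sph_eigenvalue l * t))\<^sup>2 * (\<integral>\<omega>. (cmod (harm_coeff X0 l m \<omega>))\<^sup>2 \<partial>M)
      + A l * heat_variance (sph_eigenvalue l) t"
proof -
  let ?e = "complex_of_real (exp (- sph_eigenvalue l * t))"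
  define I where "I = wiener_integral M (noise_coeff A \<beta> l m) (\<lambda>s. exp (- sph_eigenvalue l * (t - s))) t"
  note I = heat_wiener_integral[OF orthogonal_noise_coeff[where A = A and l = l and m = m, OF \<beta> A m] A t sph_eigenvalue_nonneg[of l], folded I_def]
  have X': "X0 \<in> borel_measurable M" by (rule measurable_filtration[OF _ X]) simp
  have c: "harm_coeff X0 l m \<in> borel_measurable (F 0)" "square_integrable M (harm_coeff X0 l m)"
    by (rule harm_coeff_measurable[OF X], rule square_integrable_coeff[OF X' X2])
  note ec = square_integrable_cmult[OF c(2), of ?e]
  have eq: "spectral_coeff M A \<beta> X0 t l m = (\<lambda>\<omega>. ?e * harm_coeff X0 l m \<omega> + I \<omega>)"
    by (simp add: fun_eq_iff spectral_coeff_def I_def)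
  show "square_integrable M (spectral_coeff M A \<beta> X0 t l m)"
    unfolding eq by (intro square_integrable_add ec I(1))
  have "(\<integral>\<omega>. 1 * cnj (I \<omega>) \<partial>M) = 0" by (intro I(3) square_integrable_const) simp
  then have "cnj (\<integral>\<omega>. I \<omega> \<partial>M) = 0" unfolding Bochner_Integration.integral_cnj mult_1 .
  then have I0: "(\<integral>\<omega>. I \<omega> \<partial>M) = 0" by (metis complex_cnj_zero_iff)
  have "(\<integral>\<omega>. ?e * harm_coeff X0 l m \<omega> + I \<omega> \<partial>M) = (\<integral>\<omega>. ?e * harm_coeff X0 l m \<omega> \<partial>M) + (\<integral>\<omega>. I \<omega> \<partial>M)"
    by (intro Bochner_Integration.integral_add square_integrable_imp_integrable ec I(1))
  then show "(\<integral>\<omega>. spectral_coeff M A \<beta> X0 t l m \<omega> \<partial>M) = ?e * (\<integral>\<omega>. harm_coeff X0 l m \<omega> \<partial>M)"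
    unfolding eq I0 by (simp only: integral_mult_right_zero add_0_right)
  have "(\<integral>\<omega>. ?e * harm_coeff X0 l m \<omega> * cnj (I \<omega>) \<partial>M) = 0"
    unfolding mult.assoc integral_mult_right_zero I(3)[OF c] by simp
  then show "(\<integral>\<omega>. (cmod (spectral_coeff M A \<beta> X0 t l m \<omega>))\<^sup>2 \<partial>M) =
      (exp (- sph_eigenvalue l * t))\<^sup>2 * (\<integral>\<omega>. (cmod (harm_coeff X0 l m \<omega>))\<^sup>2 \<partial>M)
      + A l * heat_variance (sph_eigenvalue l) t"
    unfolding eq integral_cmod_add_squared[OF ec I(1)] I(2) norm_mult power_mult_distrib norm_of_real power2_abs
      integral_mult_right_zero by simp
qed

end

section \<open>The weak error\<close>

lemma integral_harmonic_sum:
  assumes L: "finite L" and c: "\<And>l m. l \<in> L \<Longrightarrow> \<bar>m\<bar> \<le> int l \<Longrightarrow> integrable M (c l m)"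
  shows "(\<integral>\<omega>. harmonic_sum L (\<lambda>l m. c l m \<omega>) \<partial>M) = harmonic_sum L (\<lambda>l m. \<integral>\<omega>. c l m \<omega> \<partial>M)"
proof -
  have int: "integrable M (\<lambda>\<omega>. case p of (l, m) \<Rightarrow> harmonic l m (c l m \<omega>))"
    and eq: "(\<integral>\<omega>. (case p of (l, m) \<Rightarrow> harmonic l m (c l m \<omega>)) \<partial>M) = (case p of (l, m) \<Rightarrow> harmonic l m (\<integral>\<omega>. c l m \<omega> \<partial>M))"
    if "p \<in> harmonic_indices L" for p
  proof -
    obtain l m where p: "p = (l, m)" by (cases p)
    have i: "integrable M (c l m)" using that c by (auto simp: p harmonic_indices_def)
    show "integrable M (\<lambda>\<omega>. case p of (l, m) \<Rightarrow> harmonic l m (c l m \<omega>))"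
      unfolding p prod.case by (rule integrable_bounded_linear[OF bounded_linear_harmonic i])
    show "(\<integral>\<omega>. (case p of (l, m) \<Rightarrow> harmonic l m (c l m \<omega>)) \<partial>M) = (case p of (l, m) \<Rightarrow> harmonic l m (\<integral>\<omega>. c l m \<omega> \<partial>M))"
      unfolding p prod.case by (rule integral_bounded_linear[OF bounded_linear_harmonic i])
  qed
  show ?thesis unfolding harmonic_sum_def
    by (subst Bochner_Integration.integral_sum[OF int], assumption) (rule sum.cong[OF refl eq])
qed

lemma
  assumes L: "finite L" and c: "\<And>l m. l \<in> L \<Longrightarrow> \<bar>m\<bar> \<le> int l \<Longrightarrow> square_integrable M (c l m)"
  shows integrable_norm_harmonic_sum: "integrable M (\<lambda>\<omega>. (norm (harmonic_sum L (\<lambda>l m. c l m \<omega>)))\<^sup>2)"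
    and integral_norm_harmonic_sum: "(\<integral>\<omega>. (norm (harmonic_sum L (\<lambda>l m. c l m \<omega>)))\<^sup>2 \<partial>M)
      = (\<Sum>l\<in>L. \<Sum>m\<in>{- int l..int l}. \<integral>\<omega>. (cmod (c l m \<omega>))\<^sup>2 \<partial>M)"
proof -
  have int: "integrable M (\<lambda>\<omega>. (cmod (c l m \<omega>))\<^sup>2)" if "l \<in> L" "m \<in> {- int l..int l}" for l m
    using c[of l m] that by (auto simp: square_integrable_def)
  show "integrable M (\<lambda>\<omega>. (norm (harmonic_sum L (\<lambda>l m. c l m \<omega>)))\<^sup>2)"
    unfolding norm_harmonic_sum[OF L] by (intro Bochner_Integration.integrable_sum int)
  show "(\<integral>\<omega>. (norm (harmonic_sum L (\<lambda>l m. c l m \<omega>)))\<^sup>2 \<partial>M)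
      = (\<Sum>l\<in>L. \<Sum>m\<in>{- int l..int l}. \<integral>\<omega>. (cmod (c l m \<omega>))\<^sup>2 \<partial>M)"
    unfolding norm_harmonic_sum[OF L]
    by (subst Bochner_Integration.integral_sum, intro Bochner_Integration.integrable_sum int, assumption+)
      (intro sum.cong refl Bochner_Integration.integral_sum int)
qed

context filtered_prob_space
begin

text \<open>
  The expectation of the Sobolev density of a random function.
\<close>

definition mean_density :: "real \<Rightarrow> ('w \<Rightarrow> real L2_sphere) \<Rightarrow> nat \<Rightarrow> real" where
  "mean_density s X l =
    (\<Sum>m\<in>{- int l..int l}. (1 + sph_eigenvalue l) powr s * (\<integral>\<omega>. (cmod (harm_coeff X l m \<omega>))\<^sup>2 \<partial>M))"

lemma sum_mean_density_le:
  assumes X2: "integrable M (\<lambda>\<omega>. (norm (X \<omega>))\<^sup>2)" and sob: "sobolev_L2_rv M s X" and s: "0 \<le> s"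
  shows "(\<Sum>l<N. mean_density s X l) \<le> (sobolev_L2_norm M s X)\<^sup>2"
proof -
  have X: "X \<in> borel_measurable M" and mem: "AE \<omega> in M. X \<omega> \<in> sobolev_space s"
    and S2: "integrable M (\<lambda>\<omega>. (sobolev_norm s (X \<omega>))\<^sup>2)"
    using sob by (auto simp: sobolev_L2_rv_def)
  have int: "integrable M (\<lambda>\<omega>. (1 + sph_eigenvalue l) powr s * (cmod (harm_coeff X l m \<omega>))\<^sup>2)" for l m
    using square_integrable_coeff[OF X X2] by (auto simp: square_integrable_def)
  have dens: "sobolev_density s (X \<omega>) l = (\<Sum>m\<in>{- int l..int l}. (1 + sph_eigenvalue l) powr s * (cmod (harm_coeff X l m \<omega>))\<^sup>2)" for \<omega> l
    by (simp add: sobolev_density_def harm_coeff_def)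
  have int_d: "integrable M (\<lambda>\<omega>. sobolev_density s (X \<omega>) l)" for l
    unfolding dens by (intro Bochner_Integration.integrable_sum int)
  have "mean_density s X l = (\<integral>\<omega>. sobolev_density s (X \<omega>) l \<partial>M)" for l
    unfolding dens mean_density_def integral_mult_right_zero[symmetric]
    by (rule Bochner_Integration.integral_sum[symmetric]) (rule int)
  then have "(\<Sum>l<N. mean_density s X l) = (\<integral>\<omega>. (\<Sum>l<N. sobolev_density s (X \<omega>) l) \<partial>M)"
    using int_d by simp
  also have "\<dots> \<le> (\<integral>\<omega>. (sobolev_norm s (X \<omega>))\<^sup>2 \<partial>M)"
    using mem by (intro integral_mono_AE Bochner_Integration.integrable_sum int_d S2, eventually_elim)
      (rule sobolev_space_density_le_norm[OF _ s])
  also have "\<dots> = (sobolev_L2_norm M s X)\<^sup>2"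
    unfolding sobolev_L2_norm_def by simp
  finally show ?thesis .
qed

lemma coeff_expectation:
  assumes X: "X \<in> borel_measurable M" and X2: "integrable M (\<lambda>\<omega>. (norm (X \<omega>))\<^sup>2)"
  shows "sph_coeff (cplx_L2 (\<integral>\<omega>. X \<omega> \<partial>M)) l m = (\<integral>\<omega>. harm_coeff X l m \<omega> \<partial>M)"
proof -
  have "integrable M X"
  proof (rule Bochner_Integration.integrable_bound)
    show "integrable M (\<lambda>\<omega>. 1 + (norm (X \<omega>))\<^sup>2)" using X2 by simp
    have "norm (X \<omega>) \<le> 1 + (norm (X \<omega>))\<^sup>2" for \<omega>
    proof -
      have "2 * norm (X \<omega>) \<le> (norm (X \<omega>))\<^sup>2 + 1" using sum_squares_bound[of "norm (X \<omega>)" 1] by simp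
      then show ?thesis using norm_ge_zero[of "X \<omega>"] by linarith
    qed
    then show "AE \<omega> in M. norm (X \<omega>) \<le> norm (1 + (norm (X \<omega>))\<^sup>2)" by (intro AE_I2) simp
  qed (rule X)
  from integral_bounded_linear[OF bounded_linear_real_sph_coeff this, of l m]
  show ?thesis unfolding harm_coeff_def by simp
qed

text \<open>
  By \<open>|E X\<^sub>l\<^sub>m|\<^sup>2 \<le> E |X\<^sub>l\<^sub>m|\<^sup>2\<close> the densities of \<open>E X\<close> have bounded sums, so that the series defining the
  Sobolev norm of \<open>E X\<close> converges and the norm is a genuine bound rather than the default value of a
  divergent series.
\<close>

lemma sum_sobolev_density_expectation_le:
  assumes X2: "integrable M (\<lambda>\<omega>. (norm (X \<omega>))\<^sup>2)" and sob: "sobolev_L2_rv M s X" and s: "0 \<le> s"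
  shows "(\<Sum>l<N. sobolev_density s (\<integral>\<omega>. X \<omega> \<partial>M) l) \<le> (sobolev_norm s (\<integral>\<omega>. X \<omega> \<partial>M))\<^sup>2"
proof (rule sobolev_density_le_norm)
  fix N
  have X: "X \<in> borel_measurable M" using sob by (simp add: sobolev_L2_rv_def)
  have "(cmod (\<integral>\<omega>. harm_coeff X l m \<omega> \<partial>M))\<^sup>2 \<le> (\<integral>\<omega>. (cmod (harm_coeff X l m \<omega>))\<^sup>2 \<partial>M)" for l m
  proof -
    have "cmod (\<integral>\<omega>. harm_coeff X l m \<omega> \<partial>M) \<le> sqrt (\<integral>\<omega>. (cmod (harm_coeff X l m \<omega>))\<^sup>2 \<partial>M)"
      using cauchy_schwarz_integral[OF square_integrable_coeff[OF X X2] square_integrable_const[of 1]]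
      by (simp add: prob_space)
    from power_mono[OF this norm_ge_zero, of 2] show ?thesis by simp
  qed
  then have "sobolev_density s (\<integral>\<omega>. X \<omega> \<partial>M) l \<le> mean_density s X l" for l
    unfolding sobolev_density_def mean_density_def coeff_expectation[OF X X2]
    by (intro sum_mono mult_left_mono) auto
  then have "(\<Sum>l<N. sobolev_density s (\<integral>\<omega>. X \<omega> \<partial>M) l) \<le> (\<Sum>l<N. mean_density s X l)"
    by (rule sum_mono)
  also have "\<dots> \<le> (sobolev_L2_norm M s X)\<^sup>2" by (rule sum_mean_density_le[OF X2 sob s])
  finally show "(\<Sum>l<N. sobolev_density s (\<integral>\<omega>. X \<omega> \<partial>M) l) \<le> (sobolev_L2_norm M s X)\<^sup>2" .
qed

end

text \<open>
  In the constant mode \<open>l = 0\<close> the scheme reproduces the variance exactly. This matters because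
  \<open>A\<^sub>0\<close> is not controlled by the decay assumption.
\<close>

lemma em_noise_variance_error:
  assumes h: "0 < h" and stab: "sch = Forward \<Longrightarrow> sph_eigenvalue l * h \<le> 1"
  shows "\<bar>heat_variance (sph_eigenvalue l) (real k * h)
      - h * (em_xi sch h l ^ em_delta sch)\<^sup>2 * (\<Sum>j<k. (em_xi sch h l)\<^sup>2 ^ j)\<bar> \<le> (if l = 0 then 0 else h)"
proof (cases "l = 0")
  case True
  then have "sph_eigenvalue l = 0" by (simp add: sph_eigenvalue_def)
  moreover from this have "em_xi sch h l = 1" by (cases sch) auto
  ultimately show ?thesis using True by (simp add: heat_variance_def)
next
  case False
  then have "sph_eigenvalue l \<noteq> 0" by (simp add: sph_eigenvalue_def add_eq_0_iff)
  then show ?thesis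
    using False em_variance_error[of h sch l k] h stab by (simp add: heat_variance_def)
qed

text \<open>
  There are \<open>2 l + 1 \<le> 3 l\<close> modes of degree \<open>l \<ge> 1\<close>, each contributing at most \<open>C l\<^bsup>-\<alpha>\<^esup> h\<close>.
\<close>

lemma mode_variance_sum_le:
  assumes A: "\<And>l. 0 \<le> A l" and AC: "\<And>l. 0 < l \<Longrightarrow> A l \<le> C * real l powr (- \<alpha>)" and h: "0 < h" and C: "0 < C"
    and D: "\<And>l. l \<le> \<kappa> \<Longrightarrow> \<bar>D l\<bar> \<le> (if l = 0 then 0 else h)"
  shows "(\<Sum>l\<le>\<kappa>. \<Sum>m\<in>{- int l..int l}. A l * \<bar>D l\<bar>) \<le> 3 * C * (h * (\<Sum>l=1..\<kappa>. real l powr (1 - \<alpha>)))"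
proof -
  have "(\<Sum>l\<le>\<kappa>. \<Sum>m\<in>{- int l..int l}. A l * \<bar>D l\<bar>) = (\<Sum>l\<in>{1..\<kappa>}. \<Sum>m\<in>{- int l..int l}. A l * \<bar>D l\<bar>)"
    by (rule sum.mono_neutral_right) (use D[of 0] in \<open>auto simp: not_le\<close>)
  also have "\<dots> \<le> (\<Sum>l\<in>{1..\<kappa>}. 3 * C * (h * real l powr (1 - \<alpha>)))"
  proof (rule sum_mono)
    fix l assume l: "l \<in> {1..\<kappa>}"
    have "(\<Sum>m\<in>{- int l..int l}. A l * \<bar>D l\<bar>) = (2 * real l + 1) * (A l * \<bar>D l\<bar>)" by simp
    also have "\<dots> \<le> (3 * real l) * ((C * real l powr (- \<alpha>)) * h)"
      using l A[of l] AC[of l] D[of l] h C by (intro mult_mono) auto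
    also have "\<dots> = 3 * C * (h * (real l powr 1 * real l powr (- \<alpha>)))" using l by simp
    also have "real l powr 1 * real l powr (- \<alpha>) = real l powr (1 - \<alpha>)" unfolding powr_add[symmetric] by simp
    finally show "(\<Sum>m\<in>{- int l..int l}. A l * \<bar>D l\<bar>) \<le> 3 * C * (h * real l powr (1 - \<alpha>))" .
  qed
  also have "\<dots> = 3 * C * (h * (\<Sum>l=1..\<kappa>. real l powr (1 - \<alpha>)))" by (simp add: sum_distrib_left)
  finally show ?thesis .
qed

context filtered_prob_space
begin

text \<open>
  Squaring the error of a mode doubles the exponent of \<open>1 + \<mu>\<close>, whence \<open>p = min 1 (\<eta> / 2)\<close>.
\<close>

lemma weak_error_expectation:
  assumes X: "X0 \<in> borel_measurable (F 0)" and X2: "integrable M (\<lambda>\<omega>. (norm (X0 \<omega>))\<^sup>2)"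
    and sob: "sobolev_L2_rv M \<eta> X0" and \<eta>: "0 < \<eta>"
    and \<beta>: "independent_brownian_motions M F \<beta>" and A: "\<And>l. 0 \<le> A l" and h: "0 < h"
    and stab: "\<And>l. l \<le> \<kappa> \<Longrightarrow> sph_eigenvalue l * h \<le> c" "sch = Forward \<Longrightarrow> c \<le> 1"
  shows "norm (\<integral>\<omega>. spectral_approx M A \<beta> X0 \<kappa> (real k * h) \<omega> - em_approx sch A \<beta> X0 h \<kappa> k \<omega> \<partial>M)
    \<le> max 1 c * h powr min 1 (\<eta> / 2) * sobolev_norm \<eta> (\<integral>\<omega>. X0 \<omega> \<partial>M)"
proof -
  define p where "p = min 1 (\<eta> / 2)"
  have p: "0 < p" "p \<le> 1" "2 * p \<le> \<eta>" using \<eta> by (auto simp: p_def)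
  define B where "B = max 1 c * h powr p"
  have B: "0 \<le> B" by (simp add: B_def)
  let ?S = "\<lambda>l m. spectral_coeff M A \<beta> X0 (real k * h) l m" and ?E = "\<lambda>l m \<omega>. em_coeff sch A \<beta> X0 h l m k \<omega>"
  let ?g = "\<lambda>l. exp (- sph_eigenvalue l * (real k * h)) - em_xi sch h l ^ k"
  have X': "X0 \<in> borel_measurable M" by (rule measurable_filtration[OF _ X]) simp
  have t: "0 \<le> real k * h" and h0: "0 \<le> h" using h by auto
  note S = spectral_coeff_moments[where A = A, OF X X2 \<beta> A _ t]
    and E = em_coeff_moments[where A = A and sch = sch and k = k, OF X X2 \<beta> A _ h0]
  have iS: "integrable M (?S l m)" and iE: "integrable M (?E l m)" if "\<bar>m\<bar> \<le> int l" for l m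
    using S(1)[OF that] E(1)[OF that] by (auto intro: square_integrable_imp_integrable)
  let ?x = "\<lambda>l m. sph_coeff (cplx_L2 (\<integral>\<omega>. X0 \<omega> \<partial>M)) l m"
  have "(\<integral>\<omega>. spectral_approx M A \<beta> X0 \<kappa> (real k * h) \<omega> - em_approx sch A \<beta> X0 h \<kappa> k \<omega> \<partial>M)
      = harmonic_sum {..\<kappa>} (\<lambda>l m. \<integral>\<omega>. ?S l m \<omega> - ?E l m \<omega> \<partial>M)"
    unfolding spectral_approx_eq_harmonic_sum em_approx_eq_harmonic_sum harmonic_sum_diff
    by (rule integral_harmonic_sum) (auto intro!: Bochner_Integration.integrable_diff iS iE)
  then have "(norm (\<integral>\<omega>. spectral_approx M A \<beta> X0 \<kappa> (real k * h) \<omega> - em_approx sch A \<beta> X0 h \<kappa> k \<omega> \<partial>M))\<^sup>2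
      = (\<Sum>l\<le>\<kappa>. \<Sum>m\<in>{- int l..int l}. (cmod (\<integral>\<omega>. ?S l m \<omega> - ?E l m \<omega> \<partial>M))\<^sup>2)"
    by (simp only: norm_harmonic_sum[OF finite_atMost])
  also have "\<dots> \<le> (\<Sum>l\<le>\<kappa>. \<Sum>m\<in>{- int l..int l}. B\<^sup>2 * ((1 + sph_eigenvalue l) powr \<eta> * (cmod (?x l m))\<^sup>2))"
  proof (intro sum_mono)
    fix l m assume l: "l \<in> {..\<kappa>}" and "m \<in> {- int l..int l}"
    then have m: "\<bar>m\<bar> \<le> int l" by auto
    have "(\<integral>\<omega>. ?S l m \<omega> - ?E l m \<omega> \<partial>M) = complex_of_real (?g l) * ?x l m"
      using S(2)[OF m] E(2)[OF m] iS[OF m] iE[OF m]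
      by (simp add: coeff_expectation[OF X' X2] left_diff_distrib)
    then have "(cmod (\<integral>\<omega>. ?S l m \<omega> - ?E l m \<omega> \<partial>M))\<^sup>2 = \<bar>?g l\<bar>\<^sup>2 * (cmod (?x l m))\<^sup>2"
      by (simp only: norm_mult norm_of_real power_mult_distrib)
    also have "\<dots> \<le> (B * (1 + sph_eigenvalue l) powr p)\<^sup>2 * (cmod (?x l m))\<^sup>2"
    proof (intro mult_right_mono power_mono)
      show "\<bar>?g l\<bar> \<le> B * (1 + sph_eigenvalue l) powr p"
        unfolding B_def using stab(1)[of l] stab(2) l p by (intro power_error_rate h) auto
    qed auto
    also have "\<dots> \<le> B\<^sup>2 * ((1 + sph_eigenvalue l) powr \<eta> * (cmod (?x l m))\<^sup>2)"
    proof -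
      have "((1 + sph_eigenvalue l) powr p)\<^sup>2 = (1 + sph_eigenvalue l) powr (2 * p)"
        by (simp add: power2_eq_square flip: powr_add)
      also have "\<dots> \<le> (1 + sph_eigenvalue l) powr \<eta>"
        using p sph_eigenvalue_nonneg[of l] by (intro powr_mono) auto
      finally show ?thesis unfolding power_mult_distrib mult.assoc by (intro mult_left_mono mult_right_mono) auto
    qed
    finally show "(cmod (\<integral>\<omega>. ?S l m \<omega> - ?E l m \<omega> \<partial>M))\<^sup>2 \<le> B\<^sup>2 * ((1 + sph_eigenvalue l) powr \<eta> * (cmod (?x l m))\<^sup>2)" .
  qed
  also have "\<dots> = B\<^sup>2 * (\<Sum>l<Suc \<kappa>. sobolev_density \<eta> (\<integral>\<omega>. X0 \<omega> \<partial>M) l)"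
    unfolding sobolev_density_def lessThan_Suc_atMost by (simp only: sum_distrib_left)
  also have "\<dots> \<le> B\<^sup>2 * (sobolev_norm \<eta> (\<integral>\<omega>. X0 \<omega> \<partial>M))\<^sup>2"
    using \<eta> by (intro mult_left_mono sum_sobolev_density_expectation_le X2 sob) auto
  finally have "(norm (\<integral>\<omega>. spectral_approx M A \<beta> X0 \<kappa> (real k * h) \<omega> - em_approx sch A \<beta> X0 h \<kappa> k \<omega> \<partial>M))\<^sup>2
      \<le> (B * sobolev_norm \<eta> (\<integral>\<omega>. X0 \<omega> \<partial>M))\<^sup>2" by (simp only: power_mult_distrib)
  then show ?thesis
    unfolding B_def p_def[symmetric] by (rule power2_le_imp_le) (simp add: sobolev_norm_def)
qed

text \<open>
  Here the weight \<open>(1 + \<mu>)\<^sup>\<eta>\<close> is compared with the error \<open>(1 + \<mu>)\<^sup>p\<close> itself rather than with its square,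
  which is why the second moment converges at up to twice the rate of the expectation.
\<close>

lemma weak_error_second_moment:
  assumes X: "X0 \<in> borel_measurable (F 0)" and X2: "integrable M (\<lambda>\<omega>. (norm (X0 \<omega>))\<^sup>2)"
    and sob: "sobolev_L2_rv M \<eta> X0" and \<eta>: "0 < \<eta>"
    and \<beta>: "independent_brownian_motions M F \<beta>" and A: "\<And>l. 0 \<le> A l" and h: "0 < h"
    and stab: "\<And>l. l \<le> \<kappa> \<Longrightarrow> sph_eigenvalue l * h \<le> c" "sch = Forward \<Longrightarrow> c \<le> 1"
    and C: "0 < C" and AC: "\<And>l. 0 < l \<Longrightarrow> A l \<le> C * real l powr (- \<alpha>)"
  shows "\<bar>\<integral>\<omega>. (norm (spectral_approx M A \<beta> X0 \<kappa> (real k * h) \<omega>))\<^sup>2 - (norm (em_approx sch A \<beta> X0 h \<kappa> k \<omega>))\<^sup>2 \<partial>M\<bar>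
    \<le> max 1 c * h powr min 1 \<eta> * (sobolev_L2_norm M \<eta> X0)\<^sup>2
      + 3 * C * (h * (\<Sum>l=1..\<kappa>. real l powr (1 - \<alpha>)))"
proof -
  define p where "p = min 1 \<eta>"
  have p: "0 < p" "p \<le> 1" "p \<le> \<eta>" using \<eta> by (auto simp: p_def)
  define B where "B = max 1 c * h powr p"
  let ?S = "\<lambda>l m. spectral_coeff M A \<beta> X0 (real k * h) l m" and ?E = "\<lambda>l m \<omega>. em_coeff sch A \<beta> X0 h l m k \<omega>"
  let ?g = "\<lambda>l. exp (- sph_eigenvalue l * (real (2 * k) * h)) - em_xi sch h l ^ (2 * k)"
  let ?x = "\<lambda>l m. \<integral>\<omega>. (cmod (harm_coeff X0 l m \<omega>))\<^sup>2 \<partial>M"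
  define D where "D l = heat_variance (sph_eigenvalue l) (real k * h)
      - h * (em_xi sch h l ^ em_delta sch)\<^sup>2 * (\<Sum>j<k. (em_xi sch h l)\<^sup>2 ^ j)" for l
  have st: "sch = Forward \<Longrightarrow> sph_eigenvalue l * h \<le> 1" if "l \<le> \<kappa>" for l
    using stab(1)[OF that] stab(2) by auto
  have t: "0 \<le> real k * h" and h0: "0 \<le> h" using h by auto
  note S = spectral_coeff_moments[where A = A, OF X X2 \<beta> A _ t]
    and E = em_coeff_moments[where A = A and sch = sch and k = k, OF X X2 \<beta> A _ h0]
  have "(\<integral>\<omega>. (norm (spectral_approx M A \<beta> X0 \<kappa> (real k * h) \<omega>))\<^sup>2 - (norm (em_approx sch A \<beta> X0 h \<kappa> k \<omega>))\<^sup>2 \<partial>M)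
      = (\<Sum>l\<le>\<kappa>. \<Sum>m\<in>{- int l..int l}. \<integral>\<omega>. (cmod (?S l m \<omega>))\<^sup>2 \<partial>M)
        - (\<Sum>l\<le>\<kappa>. \<Sum>m\<in>{- int l..int l}. \<integral>\<omega>. (cmod (?E l m \<omega>))\<^sup>2 \<partial>M)"
    unfolding spectral_approx_eq_harmonic_sum em_approx_eq_harmonic_sum
    by (subst Bochner_Integration.integral_diff)
      (simp_all add: integral_norm_harmonic_sum integrable_norm_harmonic_sum S(1) E(1))
  also have "\<dots> = (\<Sum>l\<le>\<kappa>. \<Sum>m\<in>{- int l..int l}. ?g l * ?x l m + A l * D l)"
    unfolding sum_subtractf[symmetric]
  proof (intro sum.cong refl)
    fix l m assume "m \<in> {- int l..int l}"
    then have m: "\<bar>m\<bar> \<le> int l" by auto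
    have "(exp (- sph_eigenvalue l * (real k * h)))\<^sup>2 = exp (- sph_eigenvalue l * (real (2 * k) * h))"
      by (simp add: power2_eq_square mult_exp_exp)
    then show "(\<integral>\<omega>. (cmod (?S l m \<omega>))\<^sup>2 \<partial>M) - (\<integral>\<omega>. (cmod (?E l m \<omega>))\<^sup>2 \<partial>M) = ?g l * ?x l m + A l * D l"
      unfolding S(3)[OF m] E(3)[OF m] D_def by (simp only: left_diff_distrib right_diff_distrib)
  qed
  also have "\<bar>\<dots>\<bar> \<le> (\<Sum>l\<le>\<kappa>. \<Sum>m\<in>{- int l..int l}. B * ((1 + sph_eigenvalue l) powr \<eta> * ?x l m) + A l * \<bar>D l\<bar>)"
  proof (intro order_trans[OF sum_abs] sum_mono)
    fix l m assume l: "l \<in> {..\<kappa>}"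
    have "\<bar>?g l\<bar> \<le> B * (1 + sph_eigenvalue l) powr p"
      unfolding B_def using st[of l] stab(1)[of l] l p by (intro power_error_rate h) auto
    also have "\<dots> \<le> B * (1 + sph_eigenvalue l) powr \<eta>"
      using p sph_eigenvalue_nonneg[of l] by (intro mult_left_mono powr_mono) (auto simp: B_def)
    finally have "\<bar>?g l\<bar> * ?x l m \<le> (B * (1 + sph_eigenvalue l) powr \<eta>) * ?x l m"
      by (intro mult_right_mono) auto
    moreover have "\<bar>?g l * ?x l m + A l * D l\<bar> \<le> \<bar>?g l\<bar> * ?x l m + A l * \<bar>D l\<bar>"
      by (rule order_trans[OF abs_triangle_ineq]) (simp add: abs_mult A)
    ultimately show "\<bar>?g l * ?x l m + A l * D l\<bar> \<le> B * ((1 + sph_eigenvalue l) powr \<eta> * ?x l m) + A l * \<bar>D l\<bar>"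
      by (simp only: mult.assoc)
  qed
  also have "\<dots> = B * (\<Sum>l<Suc \<kappa>. mean_density \<eta> X0 l) + (\<Sum>l\<le>\<kappa>. \<Sum>m\<in>{- int l..int l}. A l * \<bar>D l\<bar>)"
    unfolding mean_density_def lessThan_Suc_atMost by (simp only: sum_distrib_left sum.distrib)
  also have "\<dots> \<le> B * (sobolev_L2_norm M \<eta> X0)\<^sup>2 + 3 * C * (h * (\<Sum>l=1..\<kappa>. real l powr (1 - \<alpha>)))"
  proof (intro add_mono mult_left_mono)
    show "(\<Sum>l<Suc \<kappa>. mean_density \<eta> X0 l) \<le> (sobolev_L2_norm M \<eta> X0)\<^sup>2"
      using \<eta> by (intro sum_mean_density_le X2 sob) auto
    show "0 \<le> B" by (simp add: B_def)
    show "(\<Sum>l\<le>\<kappa>. \<Sum>m\<in>{- int l..int l}. A l * \<bar>D l\<bar>) \<le> 3 * C * (h * (\<Sum>l=1..\<kappa>. real l powr (1 - \<alpha>)))"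
      by (rule mode_variance_sum_le[where A = A, OF A AC h C]) (simp_all only: D_def em_noise_variance_error[OF h st])
  qed
  finally show ?thesis by (simp only: B_def p_def)
qed

end

theorem theorem4p5:
  fixes M :: "'w measure" and F :: "real \<Rightarrow> 'w measure"
    and A :: "nat \<Rightarrow> real" and \<beta> :: "nat \<Rightarrow> nat \<Rightarrow> nat \<Rightarrow> real \<Rightarrow> 'w \<Rightarrow> real"
    and X0 :: "'w \<Rightarrow> real L2_sphere"
    and T \<alpha> C \<eta> C\<^sub>c :: real and sch :: em_scheme
  assumes "complete_filtered_prob_space M F"
    and "0 < T"
    and "\<And>l. 0 \<le> A l"
    and "independent_brownian_motions M F \<beta>"
    and "X0 \<in> borel_measurable (F 0)"
    and "integrable M (\<lambda>\<omega>. (norm (X0 \<omega>))\<^sup>2)"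
    and "0 < \<alpha>" and "0 < C"
    and "\<And>l. 0 < l \<Longrightarrow> A l \<le> C * real l powr (- \<alpha>)"
    and "0 < \<eta>"
    and "sobolev_L2_rv M \<eta> X0"
    and "0 < C\<^sub>c" and "sch = Forward \<Longrightarrow> C\<^sub>c \<le> 1"
  shows "\<exists>K>0. \<forall>\<kappa>\<ge>1. \<forall>n\<ge>1. \<forall>h. h = T / real n \<and> real \<kappa> * (real \<kappa> + 1) * h \<le> C\<^sub>c \<longrightarrow>
    (\<forall>k\<le>n.
      norm (\<integral>\<omega>. spectral_approx M A \<beta> X0 \<kappa> (real k * h) \<omega> - em_approx sch A \<beta> X0 h \<kappa> k \<omega> \<partial>M)
        \<le> K * h powr min 1 (\<eta> / 2) * sobolev_norm \<eta> (\<integral>\<omega>. X0 \<omega> \<partial>M)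
      \<and>
      (\<alpha> \<noteq> 2 \<longrightarrow>
        \<bar>\<integral>\<omega>. (norm (spectral_approx M A \<beta> X0 \<kappa> (real k * h) \<omega>))\<^sup>2
            - (norm (em_approx sch A \<beta> X0 h \<kappa> k \<omega>))\<^sup>2 \<partial>M\<bar>
          \<le> K * (h powr min 1 \<eta> * (sobolev_L2_norm M \<eta> X0)\<^sup>2 + h powr min 1 (\<alpha> / 2))))"
proof -
  interpret filtered_prob_space M F
    using assms(1) by (rule complete_filtered_imp_filtered_prob_space)
  \<comment> \<open>For \<open>\<alpha> = 2\<close> the second estimate is void and any positive \<open>K2\<close> serves.\<close>
  obtain K2 where K2: "0 < K2" "\<alpha> \<noteq> 2 \<Longrightarrow> \<forall>\<kappa>\<ge>1. \<forall>h>0. real \<kappa> * (real \<kappa> + 1) * h \<le> C\<^sub>c \<longrightarrow>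
      h * (\<Sum>l=1..\<kappa>. real l powr (1 - \<alpha>)) \<le> K2 * h powr min 1 (\<alpha> / 2)"
    using noise_sum_rate[OF assms(7) _ assms(12)] zero_less_one by metis
  define K1 where "K1 = max 1 C\<^sub>c"
  define K where "K = K1 + 3 * C * K2"
  have "0 < K1" by (simp add: K1_def)
  then have K: "0 < K" "K1 \<le> K" "3 * C * K2 \<le> K" using K2(1) \<open>0 < C\<close> by (auto simp: K_def intro: add_pos_pos)
  show ?thesis
  proof (intro exI[of _ K] conjI allI impI)
    fix \<kappa> n k :: nat and h :: real
    assume \<kappa>: "1 \<le> \<kappa>" and n: "1 \<le> n" and hc: "h = T / real n \<and> real \<kappa> * (real \<kappa> + 1) * h \<le> C\<^sub>c"
    have h: "0 < h" using hc n assms(2) by simp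
    have stab: "sph_eigenvalue l * h \<le> C\<^sub>c" if "l \<le> \<kappa>" for l
    proof -
      have "sph_eigenvalue l * h \<le> real \<kappa> * (real \<kappa> + 1) * h"
        unfolding sph_eigenvalue_def using that h by (intro mult_right_mono mult_mono) auto
      then show ?thesis using hc by linarith
    qed
    have "norm (\<integral>\<omega>. spectral_approx M A \<beta> X0 \<kappa> (real k * h) \<omega> - em_approx sch A \<beta> X0 h \<kappa> k \<omega> \<partial>M)
        \<le> K1 * h powr min 1 (\<eta> / 2) * sobolev_norm \<eta> (\<integral>\<omega>. X0 \<omega> \<partial>M)"
      unfolding K1_def by (rule weak_error_expectation) (use assms h stab in auto)
    also have "\<dots> \<le> K * h powr min 1 (\<eta> / 2) * sobolev_norm \<eta> (\<integral>\<omega>. X0 \<omega> \<partial>M)"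
      using K by (intro mult_right_mono) (auto simp: sobolev_norm_def)
    finally show "norm (\<integral>\<omega>. spectral_approx M A \<beta> X0 \<kappa> (real k * h) \<omega> - em_approx sch A \<beta> X0 h \<kappa> k \<omega> \<partial>M)
        \<le> K * h powr min 1 (\<eta> / 2) * sobolev_norm \<eta> (\<integral>\<omega>. X0 \<omega> \<partial>M)" .
    assume \<alpha>2: "\<alpha> \<noteq> 2"
    have "\<bar>\<integral>\<omega>. (norm (spectral_approx M A \<beta> X0 \<kappa> (real k * h) \<omega>))\<^sup>2 - (norm (em_approx sch A \<beta> X0 h \<kappa> k \<omega>))\<^sup>2 \<partial>M\<bar>
        \<le> K1 * h powr min 1 \<eta> * (sobolev_L2_norm M \<eta> X0)\<^sup>2 + 3 * C * (h * (\<Sum>l=1..\<kappa>. real l powr (1 - \<alpha>)))"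
      unfolding K1_def by (rule weak_error_second_moment) (use assms h stab in auto)
    also have "h * (\<Sum>l=1..\<kappa>. real l powr (1 - \<alpha>)) \<le> K2 * h powr min 1 (\<alpha> / 2)"
      using K2(2)[OF \<alpha>2] \<kappa> h hc by blast
    then have "K1 * h powr min 1 \<eta> * (sobolev_L2_norm M \<eta> X0)\<^sup>2 + 3 * C * (h * (\<Sum>l=1..\<kappa>. real l powr (1 - \<alpha>)))
        \<le> K1 * h powr min 1 \<eta> * (sobolev_L2_norm M \<eta> X0)\<^sup>2 + 3 * C * (K2 * h powr min 1 (\<alpha> / 2))"
      using \<open>0 < C\<close> by (intro add_left_mono mult_left_mono) auto
    also have "\<dots> = K1 * (h powr min 1 \<eta> * (sobolev_L2_norm M \<eta> X0)\<^sup>2) + 3 * C * K2 * h powr min 1 (\<alpha> / 2)"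
      by simp
    also have "\<dots> \<le> K * (h powr min 1 \<eta> * (sobolev_L2_norm M \<eta> X0)\<^sup>2) + K * h powr min 1 (\<alpha> / 2)"
      using K by (intro add_mono mult_right_mono) auto
    finally show "\<bar>\<integral>\<omega>. (norm (spectral_approx M A \<beta> X0 \<kappa> (real k * h) \<omega>))\<^sup>2
            - (norm (em_approx sch A \<beta> X0 h \<kappa> k \<omega>))\<^sup>2 \<partial>M\<bar>
          \<le> K * (h powr min 1 \<eta> * (sobolev_L2_norm M \<eta> X0)\<^sup>2 + h powr min 1 (\<alpha> / 2))"
      by (simp only: distrib_left)
  qed (rule K(1))
qed

end
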